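(* Let $\varphi\colon T\rightarrow S$ be a morphism of Tambara functors on $G$. Then the family of images $\mathrm{Im}\,\varphi=\{\mathrm{Im}(\varphi_X)\}_{X}$ ($X$ running over all finite $G$-sets) is a Tambara subfunctor of $S$, and there is a natural isomorphism of Tambara functors $$T/\mathrm{Ker}\,\varphi\overset{\cong}{\longrightarrow}\mathrm{Im}\,\varphi$$ compatible with $\varphi$ and the projection $T\rightarrow T/\mathrm{Ker}\,\varphi$. Moreover, the following two facts, (A) for every ideal $\mathscr{I}$ of a Tambara functor $T$ the quotient $T/\mathscr{I}$ is a Tambara functor and the projections $T(X)\to T(X)/\mathscr{I}(X)$ form a morphism of Tambara functors $T\to T/\mathscr{I}$, and (B) the kernel of every morphism of Tambara functors from $T$ is an ideal of $T$, mean that the ideals of a Tambara functor $T$ and the projections from $T$ correspond essentially bijectively.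
   Context: $G$ is a fixed finite group; ${}_G\mathrm{set}$ is the category of finite $G$-sets and $G$-equivariant maps. Rings and monoids are commutative with unit. Semi-Mackey functor $M=(M^*,M_* )$ on $G$: a contravariant functor $M^*$ and a covariant functor $M_*$ from ${}_G\mathrm{set}$ to sets with $M^*(X)=M_*(X)=:M(X)$ such that (a) $M^*$ sends finite coproducts to products; (b) for every pull-back square with $f\colon X\to Y$, $\eta\colon Y'\to Y$, $\xi\colon X'\to X$, $f'\colon X'\to Y'$ one has $M^*(\eta)M_*(f)=M_*(f')M^*(\xi)$. Each $M(X)$ is then a commutative monoid (operation $M_*(\nabla)$, $\nabla\colon X\amalg X\to X$ the folding map). It is a Mackey functor if all $M(X)$ are abelian groups. Exponential diagram of $p\colon A\to X$ and $f\colon X\to Y$: up to isomorphism, $\Pi=\{(y,\sigma)\mid y\in Y,\ \sigma\colon f^{-1}(y)\to A \text{ a map of sets},\ p\circ\sigma=\mathrm{id}\}$ with $G$-action $g\cdot(y,\sigma)=(gy,{}^g\sigma)$, ${}^g\sigma(x)=g\sigma(g^{-1}x)$; $\pi\colon\Pi\to Y$, $\pi(y,\sigma)=y$; $Z=X\times_Y\Pi$; $\rho\colon Z\to\Pi$ the projection; $\lambda\colon Z\to A$, $\lambda(x,(y,\sigma))=\sigma(x)$. Tambara functor $T=(T^*,T_+,T_\bullet)$ on $G$: $T^*$ contravariant, $T_+,T_\bullet$ covariant functors ${}_G\mathrm{set}\to\mathrm{Set}$ such that $(T^*,T_+)$ is a Mackey functor, $(T^*,T_\bullet)$ is a semi-Mackey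 functor, and $T_\bullet(f)T_+(p)=T_+(\pi)T_\bullet(\rho)T^*(\lambda)$ for every exponential diagram. Each $T(X)$ is a ring. For $f\colon X\to Y$ write $f^*=T^*(f)$ (a ring homomorphism), $f_+=T_+(f)$ (additive), $f_\bullet=T_\bullet(f)$ (multiplicative). A morphism $\varphi\colon T\to S$ is a family of ring homomorphisms $\varphi_X\colon T(X)\to S(X)$ commuting with all $f^*,f_+,f_\bullet$. A Tambara subfunctor of $S$ is a family of subrings of the $S(X)$ closed under all $f^*,f_+,f_\bullet$. An ideal $\mathscr{I}$ of $T$ is a family of ideals $\mathscr{I}(X)\subseteq T(X)$ such that for every $f\colon X\to Y$: $f^*(\mathscr{I}(Y))\subseteq\mathscr{I}(X)$, $f_+(\mathscr{I}(X))\subseteq\mathscr{I}(Y)$, $f_\bullet(\mathscr{I}(X))\subseteq f_\bullet(0)+\mathscr{I}(Y)$. For an ideal $\mathscr{I}$, $T/\mathscr{I}=\{T(X)/\mathscr{I}(X)\}_X$ with structure morphisms induced from those of $T$ on residue classes. $\mathrm{Ker}\,\varphi=\{\mathrm{Ker}(\varphi_X)\}_X$, which is an ideal of $T$. In the last assertion, an ideal $\mathscr{I}$ corresponds to the projection $T\to T/\mathscr{I}$, and a projection from $T$ (a morphism of Tambara functors out of $T$ that is surjective on each $X$) corresponds to its kernel; "essentially" is understood as up to isomorphism compatible with the morphisms from $T$. *)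

theory Defs
  imports "HOL-Algebra.Group_Action" "HOL-Algebra.Subrings" "HOL-Algebra.QuotRing"
begin

section \<open>Finite G-sets\<close>

record ('g, 'x) gset =
  pts :: "'x set"
  act :: "'g \<Rightarrow> 'x \<Rightarrow> 'x"

definition fin_gset :: "('g, 'm) monoid_scheme \<Rightarrow> ('g, 'x) gset \<Rightarrow> bool" where
  "fin_gset G X \<longleftrightarrow> finite (pts X) \<and> group_action G (pts X) (act X)"

text \<open>Equivariant maps are extensional functions, so that equality of maps \<open>X \<rightarrow> Y\<close> is equality
  in HOL; identities and composites are \<open>\<lambda>x\<in>pts X. x\<close> and \<open>compose (pts X) g f\<close>. Source and target
  may have different point types.\<close>

definition gmaps :: "('g, 'm) monoid_scheme \<Rightarrow> ('g, 'x) gset \<Rightarrow> ('g, 'y) gset \<Rightarrow> ('x \<Rightarrow> 'y) set" where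
  "gmaps G X Y =
    {f \<in> pts X \<rightarrow>\<^sub>E pts Y. \<forall>g\<in>carrier G. \<forall>x\<in>pts X. f (act X g x) = act Y g (f x)}"

definition gset_isos :: "('g, 'm) monoid_scheme \<Rightarrow> ('g, 'x) gset \<Rightarrow> ('g, 'y) gset \<Rightarrow> ('x \<Rightarrow> 'y) set" where
  "gset_isos G X Y = {f \<in> gmaps G X Y. bij_betw f (pts X) (pts Y)}"

text \<open>\<open>W\<close> with \<open>\<iota> i : X i \<rightarrow> W\<close> is a coproduct of \<open>X 0, \<dots>, X (n - 1)\<close>.\<close>

definition is_coproduct ::
  "('g, 'm) monoid_scheme \<Rightarrow> nat \<Rightarrow> (nat \<Rightarrow> ('g, 'x) gset) \<Rightarrow> ('g, 'x) gset
    \<Rightarrow> (nat \<Rightarrow> 'x \<Rightarrow> 'x) \<Rightarrow> bool" where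
  "is_coproduct G n X W \<iota> \<longleftrightarrow>
    fin_gset G W \<and> (\<forall>i<n. fin_gset G (X i) \<and> \<iota> i \<in> gmaps G (X i) W) \<and>
    bij_betw (\<lambda>(i, x). \<iota> i x) (SIGMA i:{..<n}. pts (X i)) (pts W)"

text \<open>The square \<open>f \<circ> \<xi> = \<eta> \<circ> f'\<close> with \<open>f : X \<rightarrow> Y\<close>, \<open>\<eta> : Y' \<rightarrow> Y\<close>, \<open>\<xi> : X' \<rightarrow> X\<close>, \<open>f' : X' \<rightarrow> Y'\<close>
  is a pull-back: \<open>(\<xi>, f')\<close> identifies \<open>X'\<close> with the fibre product.\<close>

definition is_pullback ::
  "('g, 'm) monoid_scheme \<Rightarrow> ('g, 'x) gset \<Rightarrow> ('g, 'x) gset \<Rightarrow> ('g, 'x) gset \<Rightarrow> ('g, 'x) gset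
    \<Rightarrow> ('x \<Rightarrow> 'x) \<Rightarrow> ('x \<Rightarrow> 'x) \<Rightarrow> ('x \<Rightarrow> 'x) \<Rightarrow> ('x \<Rightarrow> 'x) \<Rightarrow> bool" where
  "is_pullback G X Y X' Y' f \<eta> \<xi> f' \<longleftrightarrow>
    fin_gset G X \<and> fin_gset G Y \<and> fin_gset G X' \<and> fin_gset G Y' \<and>
    f \<in> gmaps G X Y \<and> \<eta> \<in> gmaps G Y' Y \<and> \<xi> \<in> gmaps G X' X \<and> f' \<in> gmaps G X' Y' \<and>
    bij_betw (\<lambda>z. (\<xi> z, f' z)) (pts X') {(x, y'). x \<in> pts X \<and> y' \<in> pts Y' \<and> f x = \<eta> y'}"


section \<open>Exponential diagrams\<close>

definition fibre :: "('g, 'x) gset \<Rightarrow> ('x \<Rightarrow> 'x) \<Rightarrow> 'x \<Rightarrow> 'x set" where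
  "fibre X f y = {x \<in> pts X. f x = y}"

definition exp_Pi ::
  "('g, 'm) monoid_scheme \<Rightarrow> ('g, 'x) gset \<Rightarrow> ('g, 'x) gset \<Rightarrow> ('g, 'x) gset
    \<Rightarrow> ('x \<Rightarrow> 'x) \<Rightarrow> ('x \<Rightarrow> 'x) \<Rightarrow> ('g, 'x \<times> ('x \<Rightarrow> 'x)) gset" where
  "exp_Pi G A X Y p f =
    \<lparr>pts = {(y, \<sigma>). y \<in> pts Y \<and> \<sigma> \<in> fibre X f y \<rightarrow>\<^sub>E pts A \<and> (\<forall>x\<in>fibre X f y. p (\<sigma> x) = x)},
     act = (\<lambda>g (y, \<sigma>). (act Y g y,
              \<lambda>x\<in>fibre X f (act Y g y). act A g (\<sigma> (act X (inv\<^bsub>G\<^esub> g) x))))\<rparr>"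

definition exp_Z ::
  "('g, 'm) monoid_scheme \<Rightarrow> ('g, 'x) gset \<Rightarrow> ('g, 'x) gset \<Rightarrow> ('g, 'x) gset
    \<Rightarrow> ('x \<Rightarrow> 'x) \<Rightarrow> ('x \<Rightarrow> 'x) \<Rightarrow> ('g, 'x \<times> ('x \<times> ('x \<Rightarrow> 'x))) gset" where
  "exp_Z G A X Y p f =
    \<lparr>pts = {(x, u). x \<in> pts X \<and> u \<in> pts (exp_Pi G A X Y p f) \<and> f x = fst u},
     act = (\<lambda>g (x, u). (act X g x, act (exp_Pi G A X Y p f) g u))\<rparr>"

text \<open>\<open>(\<pi> : P \<rightarrow> Y, \<rho> : Z \<rightarrow> P, \<lambda> : Z \<rightarrow> A)\<close> is isomorphic to the explicit exponential diagram
  of \<open>p : A \<rightarrow> X\<close> and \<open>f : X \<rightarrow> Y\<close>.\<close>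

definition is_exponential ::
  "('g, 'm) monoid_scheme \<Rightarrow> ('g, 'x) gset \<Rightarrow> ('g, 'x) gset \<Rightarrow> ('g, 'x) gset
    \<Rightarrow> ('g, 'x) gset \<Rightarrow> ('g, 'x) gset
    \<Rightarrow> ('x \<Rightarrow> 'x) \<Rightarrow> ('x \<Rightarrow> 'x) \<Rightarrow> ('x \<Rightarrow> 'x) \<Rightarrow> ('x \<Rightarrow> 'x) \<Rightarrow> ('x \<Rightarrow> 'x) \<Rightarrow> bool" where
  "is_exponential G A X Y P Z p f \<pi> \<rho> l \<longleftrightarrow>
    fin_gset G A \<and> fin_gset G X \<and> fin_gset G Y \<and> fin_gset G P \<and> fin_gset G Z \<and>
    p \<in> gmaps G A X \<and> f \<in> gmaps G X Y \<and>
    \<pi> \<in> gmaps G P Y \<and> \<rho> \<in> gmaps G Z P \<and> l \<in> gmaps G Z A \<and>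
    (\<exists>\<theta>\<in>gset_isos G P (exp_Pi G A X Y p f). \<exists>\<zeta>\<in>gset_isos G Z (exp_Z G A X Y p f).
      (\<forall>u\<in>pts P. \<pi> u = fst (\<theta> u)) \<and>
      (\<forall>z\<in>pts Z. \<theta> (\<rho> z) = snd (\<zeta> z)) \<and>
      (\<forall>z\<in>pts Z. l z = snd (snd (\<zeta> z)) (fst (\<zeta> z))))"


section \<open>Semi-Mackey and Mackey functors\<close>

text \<open>The objects are the finite G-sets with points in \<open>'x\<close>; for infinite \<open>'x\<close> every finite G-set
  is isomorphic to one of these. For \<open>f : X \<rightarrow> Y\<close>, \<open>Mup X Y f : M Y \<rightarrow> M X\<close> is the contravariant
  and \<open>Mlow X Y f : M X \<rightarrow> M Y\<close> the covariant structure map.\<close>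

definition semi_mackey ::
  "('g, 'm) monoid_scheme \<Rightarrow> (('g, 'x) gset \<Rightarrow> 't set)
    \<Rightarrow> (('g, 'x) gset \<Rightarrow> ('g, 'x) gset \<Rightarrow> ('x \<Rightarrow> 'x) \<Rightarrow> 't \<Rightarrow> 't)
    \<Rightarrow> (('g, 'x) gset \<Rightarrow> ('g, 'x) gset \<Rightarrow> ('x \<Rightarrow> 'x) \<Rightarrow> 't \<Rightarrow> 't) \<Rightarrow> bool" where
  "semi_mackey G M Mup Mlow \<longleftrightarrow>
    (\<forall>X Y f. fin_gset G X \<and> fin_gset G Y \<and> f \<in> gmaps G X Y \<longrightarrow>
       Mup X Y f \<in> M Y \<rightarrow> M X \<and> Mlow X Y f \<in> M X \<rightarrow> M Y) \<and>
    (\<forall>X. fin_gset G X \<longrightarrow> (\<forall>m\<in>M X.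
       Mup X X (\<lambda>x\<in>pts X. x) m = m \<and> Mlow X X (\<lambda>x\<in>pts X. x) m = m)) \<and>
    (\<forall>X Y Z f g. fin_gset G X \<and> fin_gset G Y \<and> fin_gset G Z \<and> f \<in> gmaps G X Y \<and> g \<in> gmaps G Y Z \<longrightarrow>
       (\<forall>m\<in>M Z. Mup X Z (compose (pts X) g f) m = Mup X Y f (Mup Y Z g m)) \<and>
       (\<forall>m\<in>M X. Mlow X Z (compose (pts X) g f) m = Mlow Y Z g (Mlow X Y f m))) \<and>
    (\<forall>n X W \<iota>. is_coproduct G n X W \<iota> \<longrightarrow>
       bij_betw (\<lambda>w. \<lambda>i\<in>{..<n}. Mup (X i) W (\<iota> i) w) (M W) (\<Pi>\<^sub>E i\<in>{..<n}. M (X i))) \<and>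
    (\<forall>X Y X' Y' f \<eta> \<xi> f'. is_pullback G X Y X' Y' f \<eta> \<xi> f' \<longrightarrow>
       (\<forall>m\<in>M X. Mup Y' Y \<eta> (Mlow X Y f m) = Mlow X' Y' f' (Mup X' X \<xi> m)))"

text \<open>The operation \<open>M(X) \<times> M(X) \<cong> M(X \<amalg> X) \<rightarrow> M(X)\<close> given by the folding map \<open>d\<close>. For a
  semi-Mackey functor the value does not depend on the coproduct \<open>(W, \<iota> 0, \<iota> 1)\<close> of \<open>X\<close> with itself,
  so that the definite description avoids choosing one. The unit comes from \<open>\<emptyset> \<rightarrow> X\<close>.\<close>

definition fold_op ::
  "('g, 'm) monoid_scheme \<Rightarrow> (('g, 'x) gset \<Rightarrow> 't set)
    \<Rightarrow> (('g, 'x) gset \<Rightarrow> ('g, 'x) gset \<Rightarrow> ('x \<Rightarrow> 'x) \<Rightarrow> 't \<Rightarrow> 't)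
    \<Rightarrow> (('g, 'x) gset \<Rightarrow> ('g, 'x) gset \<Rightarrow> ('x \<Rightarrow> 'x) \<Rightarrow> 't \<Rightarrow> 't)
    \<Rightarrow> ('g, 'x) gset \<Rightarrow> 't \<Rightarrow> 't \<Rightarrow> 't" where
  "fold_op G M Mup Mlow X a b =
    (THE c. \<exists>W \<iota> d w. is_coproduct G 2 (\<lambda>_. X) W \<iota> \<and> d \<in> gmaps G W X \<and>
       (\<forall>i<2. \<forall>x\<in>pts X. d (\<iota> i x) = x) \<and>
       w \<in> M W \<and> Mup X W (\<iota> 0) w = a \<and> Mup X W (\<iota> 1) w = b \<and> c = Mlow W X d w)"

definition fold_unit ::
  "('g, 'm) monoid_scheme \<Rightarrow> (('g, 'x) gset \<Rightarrow> 't set)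
    \<Rightarrow> (('g, 'x) gset \<Rightarrow> ('g, 'x) gset \<Rightarrow> ('x \<Rightarrow> 'x) \<Rightarrow> 't \<Rightarrow> 't)
    \<Rightarrow> ('g, 'x) gset \<Rightarrow> 't" where
  "fold_unit G M Mlow X =
    (THE c. \<exists>W d w. fin_gset G W \<and> pts W = {} \<and> d \<in> gmaps G W X \<and> w \<in> M W \<and> c = Mlow W X d w)"

definition mackey ::
  "('g, 'm) monoid_scheme \<Rightarrow> (('g, 'x) gset \<Rightarrow> 't set)
    \<Rightarrow> (('g, 'x) gset \<Rightarrow> ('g, 'x) gset \<Rightarrow> ('x \<Rightarrow> 'x) \<Rightarrow> 't \<Rightarrow> 't)
    \<Rightarrow> (('g, 'x) gset \<Rightarrow> ('g, 'x) gset \<Rightarrow> ('x \<Rightarrow> 'x) \<Rightarrow> 't \<Rightarrow> 't) \<Rightarrow> bool" where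
  "mackey G M Mup Mlow \<longleftrightarrow> semi_mackey G M Mup Mlow \<and>
    (\<forall>X. fin_gset G X \<longrightarrow> comm_group
       \<lparr>carrier = M X, mult = fold_op G M Mup Mlow X, one = fold_unit G M Mlow X\<rparr>)"


section \<open>Tambara functors\<close>

text \<open>\<open>res X Y f\<close>, \<open>tr X Y f\<close>, \<open>nm X Y f\<close> are \<open>f\<^sup>*\<close>, \<open>f\<^sub>+\<close>, \<open>f\<^sub>\<bullet>\<close> for \<open>f : X \<rightarrow> Y\<close>.\<close>

record ('g, 'x, 't) tambara_data =
  val :: "('g, 'x) gset \<Rightarrow> 't set"
  res :: "('g, 'x) gset \<Rightarrow> ('g, 'x) gset \<Rightarrow> ('x \<Rightarrow> 'x) \<Rightarrow> 't \<Rightarrow> 't"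
  tr :: "('g, 'x) gset \<Rightarrow> ('g, 'x) gset \<Rightarrow> ('x \<Rightarrow> 'x) \<Rightarrow> 't \<Rightarrow> 't"
  nm :: "('g, 'x) gset \<Rightarrow> ('g, 'x) gset \<Rightarrow> ('x \<Rightarrow> 'x) \<Rightarrow> 't \<Rightarrow> 't"

definition tambara_functor ::
  "('g, 'm) monoid_scheme \<Rightarrow> ('g, 'x, 't) tambara_data \<Rightarrow> bool" where
  "tambara_functor G T \<longleftrightarrow>
    mackey G (val T) (res T) (tr T) \<and>
    semi_mackey G (val T) (res T) (nm T) \<and>
    (\<forall>A X Y P Z p f \<pi> \<rho> l. is_exponential G A X Y P Z p f \<pi> \<rho> l \<longrightarrow>
       (\<forall>t\<in>val T A. nm T X Y f (tr T A X p t) = tr T P Y \<pi> (nm T Z P \<rho> (res T Z A l t))))"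

definition tring ::
  "('g, 'm) monoid_scheme \<Rightarrow> ('g, 'x, 't) tambara_data \<Rightarrow> ('g, 'x) gset \<Rightarrow> 't ring" where
  "tring G T X =
    \<lparr>carrier = val T X,
     mult = fold_op G (val T) (res T) (nm T) X,
     one = fold_unit G (val T) (nm T) X,
     zero = fold_unit G (val T) (tr T) X,
     add = fold_op G (val T) (res T) (tr T) X\<rparr>"

definition tambara_morphism ::
  "('g, 'm) monoid_scheme \<Rightarrow> ('g, 'x, 't) tambara_data \<Rightarrow> ('g, 'x, 's) tambara_data
    \<Rightarrow> (('g, 'x) gset \<Rightarrow> 't \<Rightarrow> 's) \<Rightarrow> bool" where
  "tambara_morphism G T S \<phi> \<longleftrightarrow>
    (\<forall>X. fin_gset G X \<longrightarrow> \<phi> X \<in> ring_hom (tring G T X) (tring G S X)) \<and>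
    (\<forall>X Y f. fin_gset G X \<and> fin_gset G Y \<and> f \<in> gmaps G X Y \<longrightarrow>
       (\<forall>t\<in>val T Y. \<phi> X (res T X Y f t) = res S X Y f (\<phi> Y t)) \<and>
       (\<forall>t\<in>val T X. \<phi> Y (tr T X Y f t) = tr S X Y f (\<phi> X t)) \<and>
       (\<forall>t\<in>val T X. \<phi> Y (nm T X Y f t) = nm S X Y f (\<phi> X t)))"

definition tambara_iso ::
  "('g, 'm) monoid_scheme \<Rightarrow> ('g, 'x, 't) tambara_data \<Rightarrow> ('g, 'x, 's) tambara_data
    \<Rightarrow> (('g, 'x) gset \<Rightarrow> 't \<Rightarrow> 's) \<Rightarrow> bool" where
  "tambara_iso G T S \<phi> \<longleftrightarrow> tambara_morphism G T S \<phi> \<and>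
    (\<exists>\<psi>. tambara_morphism G S T \<psi> \<and>
       (\<forall>X. fin_gset G X \<longrightarrow> (\<forall>t\<in>val T X. \<psi> X (\<phi> X t) = t) \<and> (\<forall>s\<in>val S X. \<phi> X (\<psi> X s) = s)))"

definition tambara_projection ::
  "('g, 'm) monoid_scheme \<Rightarrow> ('g, 'x, 't) tambara_data \<Rightarrow> ('g, 'x, 's) tambara_data
    \<Rightarrow> (('g, 'x) gset \<Rightarrow> 't \<Rightarrow> 's) \<Rightarrow> bool" where
  "tambara_projection G T S \<phi> \<longleftrightarrow> tambara_functor G S \<and> tambara_morphism G T S \<phi> \<and>
    (\<forall>X. fin_gset G X \<longrightarrow> \<phi> X ` val T X = val S X)"

definition tambara_subfunctor ::
  "('g, 'm) monoid_scheme \<Rightarrow> ('g, 'x, 't) tambara_data \<Rightarrow> (('g, 'x) gset \<Rightarrow> 't set) \<Rightarrow> bool" where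
  "tambara_subfunctor G T H \<longleftrightarrow>
    (\<forall>X. fin_gset G X \<longrightarrow> subring (H X) (tring G T X)) \<and>
    (\<forall>X Y f. fin_gset G X \<and> fin_gset G Y \<and> f \<in> gmaps G X Y \<longrightarrow>
       res T X Y f ` H Y \<subseteq> H X \<and> tr T X Y f ` H X \<subseteq> H Y \<and> nm T X Y f ` H X \<subseteq> H Y)"

definition sub_tambara ::
  "('g, 'x, 't) tambara_data \<Rightarrow> (('g, 'x) gset \<Rightarrow> 't set) \<Rightarrow> ('g, 'x, 't) tambara_data" where
  "sub_tambara T H = T\<lparr>val := H\<rparr>"

definition image_family ::
  "('g, 'x, 't) tambara_data \<Rightarrow> (('g, 'x) gset \<Rightarrow> 't \<Rightarrow> 's) \<Rightarrow> ('g, 'x) gset \<Rightarrow> 's set" where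
  "image_family T \<phi> X = \<phi> X ` val T X"

definition kernel_family ::
  "('g, 'm) monoid_scheme \<Rightarrow> ('g, 'x, 't) tambara_data \<Rightarrow> ('g, 'x, 's) tambara_data
    \<Rightarrow> (('g, 'x) gset \<Rightarrow> 't \<Rightarrow> 's) \<Rightarrow> ('g, 'x) gset \<Rightarrow> 't set" where
  "kernel_family G T S \<phi> X = a_kernel (tring G T X) (tring G S X) (\<phi> X)"


section \<open>Ideals and quotients\<close>

definition tambara_ideal ::
  "('g, 'm) monoid_scheme \<Rightarrow> ('g, 'x, 't) tambara_data \<Rightarrow> (('g, 'x) gset \<Rightarrow> 't set) \<Rightarrow> bool" where
  "tambara_ideal G T I \<longleftrightarrow>
    (\<forall>X. fin_gset G X \<longrightarrow> ideal (I X) (tring G T X)) \<and>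
    (\<forall>X Y f. fin_gset G X \<and> fin_gset G Y \<and> f \<in> gmaps G X Y \<longrightarrow>
       res T X Y f ` I Y \<subseteq> I X \<and>
       tr T X Y f ` I X \<subseteq> I Y \<and>
       nm T X Y f ` I X \<subseteq> nm T X Y f \<zero>\<^bsub>tring G T X\<^esub> <+\<^bsub>tring G T Y\<^esub> I Y)"

definition quot_proj ::
  "('g, 'm) monoid_scheme \<Rightarrow> ('g, 'x, 't) tambara_data \<Rightarrow> (('g, 'x) gset \<Rightarrow> 't set)
    \<Rightarrow> ('g, 'x) gset \<Rightarrow> 't \<Rightarrow> 't set" where
  "quot_proj G T I X t = I X +>\<^bsub>tring G T X\<^esub> t"

text \<open>A structure map \<open>h : T(X) \<rightarrow> T(Y)\<close> induces \<open>c \<mapsto> \<Union>t\<in>c. [h t]\<close> on residue classes; when the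
  residue class \<open>[h t]\<close> does not depend on the representative \<open>t\<close> of \<open>c\<close>, the union is that class.\<close>

definition quot_tambara ::
  "('g, 'm) monoid_scheme \<Rightarrow> ('g, 'x, 't) tambara_data \<Rightarrow> (('g, 'x) gset \<Rightarrow> 't set)
    \<Rightarrow> ('g, 'x, 't set) tambara_data" where
  "quot_tambara G T I =
    \<lparr>val = (\<lambda>X. carrier (tring G T X Quot I X)),
     res = (\<lambda>X Y f c. \<Union>t\<in>c. quot_proj G T I X (res T X Y f t)),
     tr = (\<lambda>X Y f c. \<Union>t\<in>c. quot_proj G T I Y (tr T X Y f t)),
     nm = (\<lambda>X Y f c. \<Union>t\<in>c. quot_proj G T I Y (nm T X Y f t))\<rparr>"

end

theory Submission
  imports Defs
begin

text \<open>Quotients and images are both treated as the image of a Tambara functor \<open>T\<close> under a family of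
  surjections compatible with the structure maps. Such an image inherits every axiom at once, except
  that an element over a coproduct must be shown to be determined by its restrictions. The only
  non-formal point is that norms descend to residue classes modulo an ideal. It follows from the
  exponential diagram of the folding map \<open>X \<amalg> X \<rightarrow> X\<close> and \<open>f : X \<rightarrow> Y\<close>: it expresses \<open>f\<^sub>\<bullet>(t + i)\<close> as
  \<open>\<pi>\<^sub>+ (c \<cdot> \<rho>\<^sub>1\<^sub>\<bullet> (\<mu>\<^sub>1\<^sup>* i))\<close>, where \<open>c\<close> depends only on \<open>t\<close>, and \<open>f\<^sub>\<bullet>(t)\<close> as the same expression with
  \<open>i\<close> replaced by \<open>0\<close>. Once \<open>T / Ker\<close> is known to be a Tambara functor, all isomorphisms come from
  factoring one projection through another with the same kernel.\<close>

section \<open>Finite G-sets\<close>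

text \<open>The axioms only supply maps between sets. The ring operations are definite descriptions
  built from folding maps, and apart from additive inverses every ring law has to be derived;
  distributivity again needs an exponential diagram. Restrictions and transfers pass to residue
  classes because they are additive. A norm is not additive, and the norm of \<open>0\<close> need
  not be \<open>0\<close> when \<open>f\<close> is not surjective. Hence the ideal condition
  compares the norm of \<open>i\<close> with the norm of \<open>0\<close>, and controls norms only
  around \<open>0\<close>. The exponential diagram moves this control to an arbitrary
  \<open>t\<close>: one factor is the norm of an element of the ideal, so it is \<open>e + j\<close>
  with \<open>e\<close> the norm of \<open>0\<close> and \<open>j\<close> in the ideal, and
  distributivity separates the error \<open>c \<cdot> j\<close>, which is then transferred. A second
  constraint is typing: all objects have points in the one type \<open>'x\<close>, whereas disjoint
  unions and the explicit exponential diagram live in product and function types. They are copied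
  into \<open>'x\<close>, which is possible because \<open>'x\<close> is infinite.\<close>

definition is_action :: "('g, 'm) monoid_scheme \<Rightarrow> ('g, 'x) gset \<Rightarrow> bool" where
  "is_action G X \<longleftrightarrow>
    (\<forall>g\<in>carrier G. \<forall>x\<in>pts X. act X g x \<in> pts X) \<and>
    (\<forall>x\<in>pts X. act X \<one>\<^bsub>G\<^esub> x = x) \<and>
    (\<forall>g\<in>carrier G. \<forall>h\<in>carrier G. \<forall>x\<in>pts X. act X (g \<otimes>\<^bsub>G\<^esub> h) x = act X g (act X h x))"

text \<open>Elements of \<open>BijGroup\<close> are extensional, so \<open>group_action\<close>
  mixes the action laws with a convention on values outside \<open>pts X\<close>.
  \<open>is_action\<close> keeps only the laws; the explicit models \<open>exp_Pi\<close> and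
  \<open>exp_Z\<close>, whose actions are not extensional, satisfy these.\<close>

lemma fin_gset_iff:
  fixes G (structure)
  assumes "group G"
  shows "fin_gset G X \<longleftrightarrow>
    finite (pts X) \<and> (\<forall>g\<in>carrier G. act X g \<in> extensional (pts X)) \<and> is_action G X"
proof -
  interpret group G by fact
  have "group_action G (pts X) (act X)"
    if ext: "\<forall>g\<in>carrier G. act X g \<in> extensional (pts X)" and A: "is_action G X"
  proof -
    have bij: "act X g \<in> Bij (pts X)" if g: "g \<in> carrier G" for g
    proof -
      have "bij_betw (act X g) (pts X) (pts X)"
      proof (rule bij_betw_byWitness[where f' = "act X (inv g)"])
        show "\<forall>a\<in>pts X. act X (inv g) (act X g a) = a"
          using A g unfolding is_action_def by (metis inv_closed l_inv)
        show "\<forall>a\<in>pts X. act X g (act X (inv g) a) = a"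
          using A g unfolding is_action_def by (metis inv_closed r_inv)
      qed (use A g in \<open>auto simp: is_action_def\<close>)
      with ext g show ?thesis by (auto simp: Bij_def)
    qed
    have "act X (g \<otimes> h) = compose (pts X) (act X g) (act X h)"
      if "g \<in> carrier G" "h \<in> carrier G" for g h
      using that ext A by (intro extensionalityI[where A = "pts X"]) (auto simp: is_action_def compose_def)
    then have "act X \<in> hom G (BijGroup (pts X))"
      using bij by (auto simp: hom_def BijGroup_def)
    then show ?thesis
      by (simp add: group_action_def group_hom_def group_hom_axioms_def group_BijGroup assms)
  qed
  moreover have "(\<forall>g\<in>carrier G. act X g \<in> extensional (pts X)) \<and> is_action G X"
    if "group_action G (pts X) (act X)"
  proof -
    interpret a: group_action G "pts X" "act X" by fact
    have "act X g \<in> extensional (pts X)" if "g \<in> carrier G" for g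
      using a.bij_prop0[OF that] by (simp add: Bij_def)
    moreover have "act X \<one> x = x" if "x \<in> pts X" for x
      using fun_cong[OF a.id_eq_one, of x] that by simp
    ultimately show ?thesis
      unfolding is_action_def using a.element_image[OF _ _ refl] a.composition_rule by blast
  qed
  ultimately show ?thesis unfolding fin_gset_def by blast
qed

lemma gmapsI:
  assumes "f \<in> extensional (pts X)" "\<And>x. x \<in> pts X \<Longrightarrow> f x \<in> pts Y"
    and "\<And>g x. g \<in> carrier G \<Longrightarrow> x \<in> pts X \<Longrightarrow> f (act X g x) = act Y g (f x)"
  shows "f \<in> gmaps G X Y"
  using assms by (auto simp: gmaps_def PiE_def)

lemma gmaps_closed: "f \<in> gmaps G X Y \<Longrightarrow> x \<in> pts X \<Longrightarrow> f x \<in> pts Y"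
  by (auto simp: gmaps_def)

lemma gmaps_act:
  "f \<in> gmaps G X Y \<Longrightarrow> g \<in> carrier G \<Longrightarrow> x \<in> pts X \<Longrightarrow> f (act X g x) = act Y g (f x)"
  by (auto simp: gmaps_def)

lemma gmaps_ext: "f \<in> gmaps G X Y \<Longrightarrow> f \<in> extensional (pts X)"
  by (auto simp: gmaps_def PiE_def)

lemma is_action_closed: "is_action G X \<Longrightarrow> g \<in> carrier G \<Longrightarrow> x \<in> pts X \<Longrightarrow> act X g x \<in> pts X"
  by (simp add: is_action_def)

lemma gmaps_compose:
  assumes "is_action G X" "f \<in> gmaps G X Y" "h \<in> gmaps G Y Z"
  shows "compose (pts X) h f \<in> gmaps G X Z"
  using assms
  by (intro gmapsI)
    (auto simp: compose_def is_action_closed gmaps_closed gmaps_act)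

lemma gmaps_id: "is_action G X \<Longrightarrow> (\<lambda>x\<in>pts X. x) \<in> gmaps G X X"
  by (auto intro!: gmapsI simp: is_action_closed)

lemma gset_iso_inverse:
  assumes "is_action G X" "h \<in> gset_isos G X Y"
  shows "restrict (inv_into (pts X) h) (pts Y) \<in> gset_isos G Y X"
proof -
  have h: "h \<in> gmaps G X Y" and b: "bij_betw h (pts X) (pts Y)"
    using assms by (auto simp: gset_isos_def)
  \<comment> \<open>Closure of \<open>pts Y\<close> under the action is carried over from
    \<open>X\<close> along the bijection \<open>h\<close>.\<close>
  have Y: "act Y g y \<in> pts Y" if "g \<in> carrier G" "y \<in> pts Y" for g y
  proof -
    obtain x where x: "x \<in> pts X" "y = h x" using \<open>y \<in> pts Y\<close> b by (auto simp: bij_betw_def)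
    then show ?thesis
      using gmaps_act[OF h that(1) x(1), symmetric] gmaps_closed[OF h] is_action_closed[OF assms(1) that(1) x(1)]
      by simp
  qed
  have "restrict (inv_into (pts X) h) (pts Y) \<in> gmaps G Y X"
  proof (rule gmapsI)
    fix g y assume g: "g \<in> carrier G" and y: "y \<in> pts Y"
    then obtain x where x: "x \<in> pts X" "y = h x" using b by (auto simp: bij_betw_def)
    have "inv_into (pts X) h (act Y g (h x)) = act X g x"
      using gmaps_act[OF h g x(1), symmetric] is_action_closed[OF assms(1) g x(1)]
      by (simp add: bij_betw_inv_into_left[OF b])
    then show "restrict (inv_into (pts X) h) (pts Y) (act Y g y) =
        act X g (restrict (inv_into (pts X) h) (pts Y) y)"
      using x y g Y b by (simp add: bij_betw_inv_into_left)
  qed (use b in \<open>auto simp: bij_betw_def inv_into_into\<close>)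
  moreover have "bij_betw (restrict (inv_into (pts X) h) (pts Y)) (pts Y) (pts X)"
    using bij_betw_inv_into[OF b] by (simp cong: bij_betw_cong)
  ultimately show ?thesis by (simp add: gset_isos_def)
qed

text \<open>An infinite type contains a finite set \<open>B\<close> with as many points as
  \<open>X\<close>, and the action is conjugated along a bijection. Restricting the conjugated
  action to \<open>B\<close> supplies the extensionality that \<open>fin_gset\<close>
  demands.\<close>

lemma gset_transport:
  fixes G (structure) and X :: "('g, 'y) gset"
  assumes "group G" "finite (pts X)" "is_action G X" "infinite (UNIV :: 'x set)"
  obtains X' :: "('g, 'x) gset" and h where "fin_gset G X'" "h \<in> gset_isos G X' X"
proof -
  obtain B :: "'x set" where "finite B" "card B = card (pts X)"
    using infinite_arbitrarily_large[OF assms(4)] by blast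
  then obtain k where k: "bij_betw k B (pts X)"
    using assms(2) finite_same_card_bij by blast
  define k' where "k' = inv_into B k"
  have kk': "k (k' y) = y" "k' y \<in> B" if "y \<in> pts X" for y
    using that k unfolding k'_def by (auto simp: bij_betw_inv_into_right bij_betw_def inv_into_into)
  have k'k: "k' (k b) = b" "k b \<in> pts X" if "b \<in> B" for b
    using that k unfolding k'_def by (auto simp: bij_betw_inv_into_left bij_betw_def)
  define X' :: "('g, 'x) gset" where
    "X' = \<lparr>pts = B, act = (\<lambda>g. \<lambda>b\<in>B. k' (act X g (k b)))\<rparr>"
  have A: "act X g y \<in> pts X" if "g \<in> carrier G" "y \<in> pts X" for g y
    using that assms(3) by (auto simp: is_action_def)
  have "fin_gset G X'"
    using assms(3) \<open>finite B\<close> A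
    unfolding fin_gset_iff[OF assms(1)] is_action_def X'_def by (auto simp: kk' k'k)
  moreover have "restrict k B \<in> gset_isos G X' X"
    using k A
    by (auto simp: gset_isos_def X'_def kk' k'k intro!: gmapsI bij_betw_cong[THEN iffD1, OF _ k])
  ultimately show thesis using that by blast
qed

text \<open>The disjoint union of tagged points is transported into \<open>'x\<close>; the
  inclusions are the inverse of the transport applied to tagged points.\<close>

lemma coproduct_exists:
  fixes G (structure) and X :: "nat \<Rightarrow> ('g, 'x) gset"
  assumes "group G" "infinite (UNIV :: 'x set)" "\<And>i. i < n \<Longrightarrow> fin_gset G (X i)"
  obtains W \<iota> where "is_coproduct G n X W \<iota>"
proof -
  let ?C = "\<lparr>pts = SIGMA i:{..<n}. pts (X i), act = \<lambda>g (i, x). (i, act (X i) g x)\<rparr>"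
  note X = assms(3)[unfolded fin_gset_iff[OF assms(1)] is_action_def]
  have "is_action G ?C"
    using X by (auto simp: is_action_def)
  moreover have "finite (pts ?C)" using X by auto
  ultimately obtain W :: "('g, 'x) gset" and h
    where W: "fin_gset G W" and h: "h \<in> gset_isos G W ?C"
    using gset_transport[OF assms(1)] assms(2) by blast
  have actW: "is_action G W" using W by (simp add: fin_gset_iff[OF assms(1)])
  define k where "k = restrict (inv_into (pts W) h) (pts ?C)"
  have k: "k \<in> gmaps G ?C W" "bij_betw k (pts ?C) (pts W)"
    using gset_iso_inverse[OF actW h] by (auto simp: k_def gset_isos_def)
  let ?\<iota> = "\<lambda>i. \<lambda>x\<in>pts (X i). k (i, x)"
  have "?\<iota> i \<in> gmaps G (X i) W" if i: "i < n" for i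
  proof (rule gmapsI)
    fix g x assume "g \<in> carrier G" "x \<in> pts (X i)"
    then show "?\<iota> i (act (X i) g x) = act W g (?\<iota> i x)"
      using gmaps_act[OF k(1), of g "(i, x)"] X[OF i] i by auto
  qed (use k(2) i in \<open>auto simp: bij_betw_def\<close>)
  moreover have "bij_betw (\<lambda>(i, x). ?\<iota> i x) (SIGMA i:{..<n}. pts (X i)) (pts W)"
    by (rule bij_betw_cong[THEN iffD1, OF _ k(2)[simplified]]) auto
  ultimately have "is_coproduct G n X W ?\<iota>"
    using W assms(3) by (simp add: is_coproduct_def)
  then show thesis using that by blast
qed

text \<open>The existence half of the universal property: inverting the bijection from tagged points
  recovers the summand and the point, and equivariance holds because each inclusion is
  equivariant.\<close>

lemma coproduct_map:
  assumes "is_coproduct G n X W \<iota>" "\<And>i. i < n \<Longrightarrow> is_action G (X i)"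
    and "\<And>i. i < n \<Longrightarrow> k i \<in> gmaps G (X i) V"
  obtains d where "d \<in> gmaps G W V" "\<And>i x. i < n \<Longrightarrow> x \<in> pts (X i) \<Longrightarrow> d (\<iota> i x) = k i x"
proof -
  let ?S = "SIGMA i:{..<n}. pts (X i)" and ?j = "\<lambda>(i, x). \<iota> i x"
  have b: "bij_betw ?j ?S (pts W)" and \<iota>: "\<And>i. i < n \<Longrightarrow> \<iota> i \<in> gmaps G (X i) W"
    using assms(1) by (auto simp: is_coproduct_def)
  define d where "d = (\<lambda>w\<in>pts W. (\<lambda>(i, x). k i x) (inv_into ?S ?j w))"
  have d: "d (\<iota> i x) = k i x" if "i < n" "x \<in> pts (X i)" for i x
    using bij_betw_inv_into_left[OF b, of "(i, x)"] that gmaps_closed[OF \<iota>[OF that(1)] that(2)]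
    by (simp add: d_def)
  have ex: "\<exists>i x. i < n \<and> x \<in> pts (X i) \<and> w = \<iota> i x" if "w \<in> pts W" for w
  proof -
    have "w \<in> ?j ` ?S" using b that by (simp add: bij_betw_def)
    then show ?thesis by auto
  qed
  have "d \<in> gmaps G W V"
  proof (rule gmapsI)
    fix w assume "w \<in> pts W"
    then show "d w \<in> pts V" using ex[of w] d assms(3) gmaps_closed by metis
  next
    fix g w assume g: "g \<in> carrier G" and "w \<in> pts W"
    then obtain i x where i: "i < n" "x \<in> pts (X i)" "w = \<iota> i x" using ex by blast
    have "act W g w = \<iota> i (act (X i) g x)"
      using gmaps_act[OF \<iota>[OF i(1)] g i(2)] i by simp
    moreover have "act (X i) g x \<in> pts (X i)"
      using assms(2)[OF i(1)] g i(2) by (rule is_action_closed)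
    ultimately show "d (act W g w) = act V g (d w)"
      using d i g gmaps_act[OF assms(3)] by simp
  qed (simp add: d_def)
  then show thesis using that d by blast
qed

lemma pullbackI:
  assumes "fin_gset G X" "fin_gset G Y" "fin_gset G X'" "fin_gset G Y'"
    and "f \<in> gmaps G X Y" "\<eta> \<in> gmaps G Y' Y" "\<xi> \<in> gmaps G X' X" "f' \<in> gmaps G X' Y'"
    and "\<And>z. z \<in> pts X' \<Longrightarrow> f (\<xi> z) = \<eta> (f' z)"
    and "\<And>z z'. z \<in> pts X' \<Longrightarrow> z' \<in> pts X' \<Longrightarrow> \<xi> z = \<xi> z' \<Longrightarrow> f' z = f' z' \<Longrightarrow> z = z'"
    and "\<And>x y. x \<in> pts X \<Longrightarrow> y \<in> pts Y' \<Longrightarrow> f x = \<eta> y \<Longrightarrow> \<exists>z\<in>pts X'. \<xi> z = x \<and> f' z = y"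
  shows "is_pullback G X Y X' Y' f \<eta> \<xi> f'"
proof -
  have "(\<lambda>z. (\<xi> z, f' z)) ` pts X' = {(x, y'). x \<in> pts X \<and> y' \<in> pts Y' \<and> f x = \<eta> y'}"
    using assms(9,11) gmaps_closed[OF assms(7)] gmaps_closed[OF assms(8)] by fastforce
  moreover have "inj_on (\<lambda>z. (\<xi> z, f' z)) (pts X')"
    using assms(10) by (auto simp: inj_on_def)
  ultimately show ?thesis
    using assms(1-8) by (simp add: is_pullback_def bij_betw_def)
qed

section \<open>Sub-G-sets given by invariant subsets\<close>

definition sub_gset :: "('g, 'x) gset \<Rightarrow> 'x set \<Rightarrow> ('g, 'x) gset" where
  "sub_gset X A = \<lparr>pts = A, act = \<lambda>g. restrict (act X g) A\<rparr>"

definition invariant_subset :: "('g, 'm) monoid_scheme \<Rightarrow> ('g, 'x) gset \<Rightarrow> 'x set \<Rightarrow> bool" where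
  "invariant_subset G X A \<longleftrightarrow> A \<subseteq> pts X \<and> (\<forall>g\<in>carrier G. \<forall>x\<in>A. act X g x \<in> A)"

lemma pts_sub_gset [simp]: "pts (sub_gset X A) = A"
  by (simp add: sub_gset_def)

lemma sub_gset_fin:
  assumes "group G" "fin_gset G X" "invariant_subset G X A"
  shows "fin_gset G (sub_gset X A)"
  using assms(2,3) unfolding fin_gset_iff[OF assms(1)] is_action_def invariant_subset_def sub_gset_def
  by (auto simp: subset_iff group.is_monoid[OF assms(1)] monoid.m_closed intro: finite_subset)

lemma sub_gset_restrict:
  assumes "invariant_subset G X A" "f \<in> gmaps G X Y"
  shows "restrict f A \<in> gmaps G (sub_gset X A) Y"
  using assms
  by (intro gmapsI) (auto simp: invariant_subset_def sub_gset_def gmaps_closed gmaps_act subset_iff)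

lemma sub_gset_incl:
  assumes "invariant_subset G X A" "invariant_subset G X B" "A \<subseteq> B"
  shows "(\<lambda>x\<in>A. x) \<in> gmaps G (sub_gset X A) (sub_gset X B)"
  using assms
  by (intro gmapsI) (auto simp: invariant_subset_def sub_gset_def subset_iff)

lemma sub_gset_incl':
  assumes "invariant_subset G X A"
  shows "(\<lambda>x\<in>A. x) \<in> gmaps G (sub_gset X A) X"
  using assms
  by (intro gmapsI) (auto simp: invariant_subset_def sub_gset_def subset_iff)

lemma invariant_Un:
  "invariant_subset G X A \<Longrightarrow> invariant_subset G X B \<Longrightarrow> invariant_subset G X (A \<union> B)"
  by (auto simp: invariant_subset_def)

lemma invariant_empty: "invariant_subset G X {}"
  by (auto simp: invariant_subset_def)

lemma invariant_pts: "is_action G X \<Longrightarrow> invariant_subset G X (pts X)"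
  by (auto simp: invariant_subset_def is_action_def)

lemma invariant_vimage:
  assumes "is_action G X" "f \<in> gmaps G X Y" "invariant_subset G Y B"
  shows "invariant_subset G X {x \<in> pts X. f x \<in> B}"
  using assms by (auto simp: invariant_subset_def is_action_closed gmaps_act)

lemma invariant_image:
  assumes "is_action G X" "f \<in> gmaps G X Y"
  shows "invariant_subset G Y (f ` pts X)"
  using assms(1) unfolding invariant_subset_def
  by (auto simp: gmaps_closed[OF assms(2)] gmaps_act[OF assms(2), symmetric] is_action_closed)

lemma sub_gset_coproduct:
  assumes G: "group G" "fin_gset G X" and A: "invariant_subset G X A" and B: "invariant_subset G X B"
    and disj: "A \<inter> B = {}"
  shows "is_coproduct G 2 (\<lambda>i. sub_gset X (if i = 0 then A else B)) (sub_gset X (A \<union> B))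
    (\<lambda>i. \<lambda>x\<in>if i = 0 then A else B. x)"
proof -
  have "bij_betw (\<lambda>(i, x). (\<lambda>x\<in>if i = 0 then A else B. x) x) (SIGMA i:{..<2::nat}. if i = 0 then A else B) (A \<union> B)"
  proof (rule bij_betw_imageI)
    show "inj_on (\<lambda>(i, x). (\<lambda>x\<in>if i = 0 then A else B. x) x) (SIGMA i:{..<2::nat}. if i = 0 then A else B)"
      using disj by (auto simp: inj_on_def less_2_cases_iff)
    show "(\<lambda>(i, x). (\<lambda>x\<in>if i = 0 then A else B. x) x) ` (SIGMA i:{..<2::nat}. if i = 0 then A else B) = A \<union> B"
    proof (intro equalityI subsetI)
      fix x assume "x \<in> A \<union> B"
      then show "x \<in> (\<lambda>(i, x). (\<lambda>x\<in>if i = 0 then A else B. x) x) ` (SIGMA i:{..<2::nat}. if i = 0 then A else B)"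
        by (intro image_eqI[where x = "(if x \<in> A then 0 else 1, x)"]) auto
    qed (auto split: if_splits)
  qed
  then show ?thesis
    using sub_gset_fin[OF G] sub_gset_incl[of G X A "A \<union> B"] sub_gset_incl[of G X B "A \<union> B"]
      A B invariant_Un[OF A B]
    by (auto simp: is_coproduct_def)
qed


section \<open>Semi-Mackey functors\<close>

text \<open>Infinitely many points guarantee that coproducts such as that of \<open>X\<close> with
  itself exist among the objects, so that the folding operation has something to be computed
  from.\<close>

locale semi_mackey_functor = group G for G :: "('g, 'm) monoid_scheme" (structure) +
  fixes M :: "('g, 'x) gset \<Rightarrow> 't set" and Mup Mlow
  assumes semi_mackey: "semi_mackey G M Mup Mlow"
    and infinite_points: "infinite (UNIV :: 'x set)"
begin

abbreviation fop where "fop \<equiv> fold_op G M Mup Mlow"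
abbreviation funit where "funit \<equiv> fold_unit G M Mlow"

lemma fin_action: "fin_gset G X \<Longrightarrow> is_action G X"
  by (simp add: fin_gset_iff[OF is_group])

lemma up_closed:
  "fin_gset G X \<Longrightarrow> fin_gset G Y \<Longrightarrow> f \<in> gmaps G X Y \<Longrightarrow> m \<in> M Y \<Longrightarrow> Mup X Y f m \<in> M X"
  using semi_mackey unfolding semi_mackey_def by (elim conjE) blast

lemma low_closed:
  "fin_gset G X \<Longrightarrow> fin_gset G Y \<Longrightarrow> f \<in> gmaps G X Y \<Longrightarrow> m \<in> M X \<Longrightarrow> Mlow X Y f m \<in> M Y"
  using semi_mackey unfolding semi_mackey_def by (elim conjE) blast

lemma up_id: "fin_gset G X \<Longrightarrow> m \<in> M X \<Longrightarrow> Mup X X (\<lambda>x\<in>pts X. x) m = m"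
  using semi_mackey unfolding semi_mackey_def by (elim conjE) blast

lemma low_id: "fin_gset G X \<Longrightarrow> m \<in> M X \<Longrightarrow> Mlow X X (\<lambda>x\<in>pts X. x) m = m"
  using semi_mackey unfolding semi_mackey_def by (elim conjE) blast

text \<open>Equivariant maps are extensional, so a map agreeing pointwise with the composite equals
  it. Users therefore check an equation at points and never handle \<open>compose\<close>
  itself.\<close>

lemma up_comp:
  assumes "fin_gset G X" "fin_gset G Y" "fin_gset G Z" "f \<in> gmaps G X Y" "g \<in> gmaps G Y Z"
    and h: "h \<in> gmaps G X Z" "\<And>x. x \<in> pts X \<Longrightarrow> h x = g (f x)" and "m \<in> M Z"
  shows "Mup X Y f (Mup Y Z g m) = Mup X Z h m"
proof -
  have "h = compose (pts X) g f"
    using gmaps_ext[OF h(1)] h(2) by (intro extensionalityI[where A = "pts X"]) (auto simp: compose_def)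
  moreover have "Mup X Z (compose (pts X) g f) m = Mup X Y f (Mup Y Z g m)"
    using semi_mackey assms(1-5,8) unfolding semi_mackey_def by (elim conjE) blast
  ultimately show ?thesis by simp
qed

lemma low_comp:
  assumes "fin_gset G X" "fin_gset G Y" "fin_gset G Z" "f \<in> gmaps G X Y" "g \<in> gmaps G Y Z"
    and h: "h \<in> gmaps G X Z" "\<And>x. x \<in> pts X \<Longrightarrow> h x = g (f x)" and "m \<in> M X"
  shows "Mlow Y Z g (Mlow X Y f m) = Mlow X Z h m"
proof -
  have "h = compose (pts X) g f"
    using gmaps_ext[OF h(1)] h(2) by (intro extensionalityI[where A = "pts X"]) (auto simp: compose_def)
  moreover have "Mlow X Z (compose (pts X) g f) m = Mlow Y Z g (Mlow X Y f m)"
    using semi_mackey assms(1-5,8) unfolding semi_mackey_def by (elim conjE) blast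
  ultimately show ?thesis by simp
qed

lemma coproduct_bij:
  "is_coproduct G n X W \<iota> \<Longrightarrow>
    bij_betw (\<lambda>w. \<lambda>i\<in>{..<n}. Mup (X i) W (\<iota> i) w) (M W) (\<Pi>\<^sub>E i\<in>{..<n}. M (X i))"
  using semi_mackey unfolding semi_mackey_def by (elim conjE) blast

lemma coproduct_inj:
  assumes "is_coproduct G n X W \<iota>" "w \<in> M W" "w' \<in> M W"
    and eq: "\<And>i. i < n \<Longrightarrow> Mup (X i) W (\<iota> i) w = Mup (X i) W (\<iota> i) w'"
  shows "w = w'"
proof -
  have "(\<lambda>i\<in>{..<n}. Mup (X i) W (\<iota> i) w) = (\<lambda>i\<in>{..<n}. Mup (X i) W (\<iota> i) w')"
    using eq by (intro restrict_ext) auto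
  then show ?thesis
    using coproduct_bij[OF assms(1)] assms(2,3) by (auto simp: bij_betw_def inj_on_def)
qed

lemma coproduct_surj:
  assumes "is_coproduct G n X W \<iota>" "\<And>i. i < n \<Longrightarrow> m i \<in> M (X i)"
  obtains w where "w \<in> M W" "\<And>i. i < n \<Longrightarrow> Mup (X i) W (\<iota> i) w = m i"
proof -
  have "restrict m {..<n} \<in> (\<Pi>\<^sub>E i\<in>{..<n}. M (X i))" using assms(2) by auto
  also have "\<dots> = (\<lambda>w. \<lambda>i\<in>{..<n}. Mup (X i) W (\<iota> i) w) ` M W"
    using coproduct_bij[OF assms(1)] by (simp add: bij_betw_def)
  finally obtain w where "w \<in> M W"
    and eq: "restrict m {..<n} = (\<lambda>i\<in>{..<n}. Mup (X i) W (\<iota> i) w)" by blast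
  have "Mup (X i) W (\<iota> i) w = m i" if "i < n" for i
    using that fun_cong[OF eq, of i] by simp
  with \<open>w \<in> M W\<close> that show thesis by blast
qed

lemma pullback:
  assumes "is_pullback G X Y X' Y' f \<eta> \<xi> f'" "m \<in> M X"
  shows "Mup Y' Y \<eta> (Mlow X Y f m) = Mlow X' Y' f' (Mup X' X \<xi> m)"
proof -
  have "\<forall>X Y X' Y' f \<eta> \<xi> f'. is_pullback G X Y X' Y' f \<eta> \<xi> f' \<longrightarrow>
      (\<forall>m\<in>M X. Mup Y' Y \<eta> (Mlow X Y f m) = Mlow X' Y' f' (Mup X' X \<xi> m))"
    using semi_mackey unfolding semi_mackey_def by (elim conjE)
  from this[rule_format, OF assms] show ?thesis .
qed

text \<open>An isomorphism \<open>h\<close> on two parallel sides and identities on the other two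
  form a pull-back square, whence \<open>Mlow X Y h\<close> undoes \<open>Mup X Y h\<close>. The
  rest is functoriality for \<open>d = d' \<circ> h\<close>.\<close>

lemma low_up_iso:
  assumes X: "fin_gset G X" and Y: "fin_gset G Y" and V: "fin_gset G V"
    and h: "h \<in> gset_isos G X Y" and d: "d \<in> gmaps G X V" and d': "d' \<in> gmaps G Y V"
    and dh: "\<And>x. x \<in> pts X \<Longrightarrow> d x = d' (h x)" and m: "m \<in> M Y"
  shows "Mlow X V d (Mup X Y h m) = Mlow Y V d' m"
proof -
  have h': "h \<in> gmaps G X Y" "bij_betw h (pts X) (pts Y)" using h by (auto simp: gset_isos_def)
  have "is_pullback G Y Y X Y (\<lambda>y\<in>pts Y. y) (\<lambda>y\<in>pts Y. y) h h"
  proof (rule pullbackI)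
    fix x y assume "x \<in> pts Y" "y \<in> pts Y" "(\<lambda>y\<in>pts Y. y) x = (\<lambda>y\<in>pts Y. y) y"
    then have "y = x" "x \<in> h ` pts X" using h'(2) by (auto simp: bij_betw_def)
    then show "\<exists>z\<in>pts X. h z = x \<and> h z = y" by auto
  qed (use X Y h' gmaps_id[OF fin_action[OF Y]] gmaps_closed[OF h'(1)] in \<open>auto simp: bij_betw_def inj_on_def\<close>)
  from pullback[OF this m] have "Mlow X Y h (Mup X Y h m) = m"
    using Y m by (simp add: up_id low_id)
  moreover have "Mlow Y V d' (Mlow X Y h (Mup X Y h m)) = Mlow X V d (Mup X Y h m)"
    using X Y V h' d d' dh m by (intro low_comp) (auto intro: up_closed)
  ultimately show ?thesis by simp
qed

text \<open>The canonical isomorphism between the two coproducts pulls \<open>w'\<close> back to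
  \<open>w\<close>, since both have the same restrictions; then \<open>low_up_iso\<close> applies.
  The case \<open>n = 2\<close> makes \<open>fold_op\<close> well defined and \<open>n = 0\<close>
  does so for \<open>fold_unit\<close>.\<close>

lemma fold_value_unique:
  assumes W: "is_coproduct G n (\<lambda>_. X) W \<iota>" and W': "is_coproduct G n (\<lambda>_. X) W' \<iota>'"
    and d: "d \<in> gmaps G W V" and d': "d' \<in> gmaps G W' V" and V: "fin_gset G V"
    and dd': "\<And>i x. i < n \<Longrightarrow> x \<in> pts X \<Longrightarrow> d (\<iota> i x) = d' (\<iota>' i x)"
    and w: "w \<in> M W" and w': "w' \<in> M W'"
    and eq: "\<And>i. i < n \<Longrightarrow> Mup X W (\<iota> i) w = Mup X W' (\<iota>' i) w'"
  shows "Mlow W V d w = Mlow W' V d' w'"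
proof -
  \<comment> \<open>For \<open>n = 0\<close> a coproduct of copies of \<open>X\<close> carries no
    information about \<open>X\<close>, so finiteness of \<open>X\<close> is extracted under
    \<open>i < n\<close> only.\<close>
  have fW: "fin_gset G W" and fW': "fin_gset G W'"
    and X: "\<And>i. i < n \<Longrightarrow> fin_gset G X"
    and \<iota>: "\<And>i. i < n \<Longrightarrow> \<iota> i \<in> gmaps G X W" and \<iota>': "\<And>i. i < n \<Longrightarrow> \<iota>' i \<in> gmaps G X W'"
    and b: "bij_betw (\<lambda>(i, x). \<iota> i x) (SIGMA i:{..<n}. pts X) (pts W)"
    and b': "bij_betw (\<lambda>(i, x). \<iota>' i x) (SIGMA i:{..<n}. pts X) (pts W')"
    using W W' by (auto simp: is_coproduct_def)
  obtain h where h: "h \<in> gmaps G W W'" and h\<iota>: "\<And>i x. i < n \<Longrightarrow> x \<in> pts X \<Longrightarrow> h (\<iota> i x) = \<iota>' i x"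
    using coproduct_map[OF W, of \<iota>' W'] fin_action[OF X] \<iota>' by blast
  have ex: "\<exists>i x. i < n \<and> x \<in> pts X \<and> v = \<iota> i x" if "v \<in> pts W" for v
  proof -
    have "v \<in> (\<lambda>(i, x). \<iota> i x) ` (SIGMA i:{..<n}. pts X)" using b that by (simp add: bij_betw_def)
    then show ?thesis by auto
  qed
  have "bij_betw (h \<circ> (\<lambda>(i, x). \<iota> i x)) (SIGMA i:{..<n}. pts X) (pts W')"
    by (rule bij_betw_cong[THEN iffD1, OF _ b']) (auto simp: h\<iota>)
  then have "h \<in> gset_isos G W W'"
    using bij_betw_comp_iff2[OF b] h b by (auto simp: gset_isos_def bij_betw_comp_iff[OF b])
  moreover have "d v = d' (h v)" if "v \<in> pts W" for v
    using ex[OF that] dd' h\<iota> by auto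
  moreover have "Mup W W' h w' = w"
  proof (rule coproduct_inj[OF W _ w])
    show "Mup W W' h w' \<in> M W" using fW fW' h w' by (rule up_closed)
    fix i assume "i < n"
    then show "Mup X W (\<iota> i) (Mup W W' h w') = Mup X W (\<iota> i) w"
      using up_comp[OF X fW fW' \<iota> h \<iota>' _ w', of i i i] h\<iota> eq by auto
  qed
  ultimately show ?thesis
    using low_up_iso[OF fW fW' V _ d d' _ w', of h] by auto
qed

text \<open>Replaces the definite description by a computation: any coproduct, any folding map and
  any lift \<open>w\<close> of the two arguments may be used.\<close>

lemma fop_eq:
  assumes W: "is_coproduct G 2 (\<lambda>_. X) W \<iota>" and d: "d \<in> gmaps G W X"
    and d\<iota>: "\<And>i x. i < 2 \<Longrightarrow> x \<in> pts X \<Longrightarrow> d (\<iota> i x) = x" and w: "w \<in> M W"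
  shows "fop X (Mup X W (\<iota> 0) w) (Mup X W (\<iota> 1) w) = Mlow W X d w"
  unfolding fold_op_def
proof (rule the_equality)
  show "\<exists>W' \<iota>' d' w'. is_coproduct G 2 (\<lambda>_. X) W' \<iota>' \<and> d' \<in> gmaps G W' X \<and>
     (\<forall>i<2. \<forall>x\<in>pts X. d' (\<iota>' i x) = x) \<and> w' \<in> M W' \<and> Mup X W' (\<iota>' 0) w' = Mup X W (\<iota> 0) w \<and>
     Mup X W' (\<iota>' 1) w' = Mup X W (\<iota> 1) w \<and> Mlow W X d w = Mlow W' X d' w'"
    using assms by blast
next
  fix c
  assume "\<exists>W' \<iota>' d' w'. is_coproduct G 2 (\<lambda>_. X) W' \<iota>' \<and> d' \<in> gmaps G W' X \<and>
     (\<forall>i<2. \<forall>x\<in>pts X. d' (\<iota>' i x) = x) \<and> w' \<in> M W' \<and> Mup X W' (\<iota>' 0) w' = Mup X W (\<iota> 0) w \<and>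
     Mup X W' (\<iota>' 1) w' = Mup X W (\<iota> 1) w \<and> c = Mlow W' X d' w'"
  then obtain W' \<iota>' d' w' where W': "is_coproduct G 2 (\<lambda>_. X) W' \<iota>'" "d' \<in> gmaps G W' X"
     "\<forall>i<2. \<forall>x\<in>pts X. d' (\<iota>' i x) = x" "w' \<in> M W'" "Mup X W' (\<iota>' 0) w' = Mup X W (\<iota> 0) w"
     "Mup X W' (\<iota>' 1) w' = Mup X W (\<iota> 1) w" "c = Mlow W' X d' w'" by blast
  have "fin_gset G X" using W by (auto simp: is_coproduct_def dest: spec[of _ 0])
  then have "Mlow W X d w = Mlow W' X d' w'"
    using W' w d d\<iota> by (intro fold_value_unique[OF W W'(1)]) (auto simp: less_2_cases_iff)
  with W'(7) show "c = Mlow W X d w" by simp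
qed

lemma folding_exists:
  fixes X :: "('g, 'x) gset"
  assumes "fin_gset G X"
  obtains W \<iota> d where "is_coproduct G 2 (\<lambda>_. X) W \<iota>" "d \<in> gmaps G W X"
    "\<And>i x. i < 2 \<Longrightarrow> x \<in> pts X \<Longrightarrow> d (\<iota> i x) = x"
proof -
  obtain W \<iota> where W: "is_coproduct G 2 (\<lambda>_. X) W \<iota>"
    using coproduct_exists[OF is_group infinite_points, of 2 "\<lambda>_. X"] assms by blast
  obtain d where "d \<in> gmaps G W X" "\<And>i x. i < 2 \<Longrightarrow> x \<in> pts X \<Longrightarrow> d (\<iota> i x) = (\<lambda>x\<in>pts X. x) x"
    using coproduct_map[OF W, of "\<lambda>_ x. if x \<in> pts X then x else undefined" X]
      fin_action[OF assms] gmaps_id[OF fin_action[OF assms]] by (auto simp: restrict_def)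
  with W that show thesis by simp
qed

lemma folding_lift:
  assumes "is_coproduct G 2 (\<lambda>_. X) W \<iota>" "a \<in> M X" "b \<in> M X"
  obtains w where "w \<in> M W" "Mup X W (\<iota> 0) w = a" "Mup X W (\<iota> 1) w = b"
proof (rule coproduct_surj[OF assms(1), of "\<lambda>i. if i = 0 then a else b"])
  fix w assume "w \<in> M W" and w: "\<And>i. i < 2 \<Longrightarrow> Mup X W (\<iota> i) w = (if i = 0 then a else b)"
  with that w[of 0] w[of 1] show thesis by simp
qed (use assms(2,3) in auto)

lemma fop_closed:
  assumes "fin_gset G X" "a \<in> M X" "b \<in> M X"
  shows "fop X a b \<in> M X"
proof -
  obtain W \<iota> d where W: "is_coproduct G 2 (\<lambda>_. X) W \<iota>" "d \<in> gmaps G W X"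
    "\<And>i x. i < 2 \<Longrightarrow> x \<in> pts X \<Longrightarrow> d (\<iota> i x) = x" using folding_exists[OF assms(1)] by blast
  obtain w where w: "w \<in> M W" "Mup X W (\<iota> 0) w = a" "Mup X W (\<iota> 1) w = b"
    using folding_lift[OF W(1) assms(2,3)] by blast
  have "fin_gset G W" using W by (auto simp: is_coproduct_def)
  with fop_eq[OF W w(1)] w W(2) assms(1) show ?thesis by (auto intro: low_closed)
qed

lemma funit_eq:
  assumes X: "fin_gset G X" and W: "fin_gset G W" "pts W = {}" and d: "d \<in> gmaps G W X" and w: "w \<in> M W"
  shows "funit X = Mlow W X d w"
  unfolding fold_unit_def
proof (rule the_equality)
  show "\<exists>W' d' w'. fin_gset G W' \<and> pts W' = {} \<and> d' \<in> gmaps G W' X \<and> w' \<in> M W' \<and>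
      Mlow W X d w = Mlow W' X d' w'" using assms by blast
next
  fix c
  assume "\<exists>W' d' w'. fin_gset G W' \<and> pts W' = {} \<and> d' \<in> gmaps G W' X \<and> w' \<in> M W' \<and> c = Mlow W' X d' w'"
  then obtain W' d' w' where W': "fin_gset G W'" "pts W' = {}" "d' \<in> gmaps G W' X" "w' \<in> M W'"
    and c: "c = Mlow W' X d' w'" by blast
  \<comment> \<open>An empty G-set is a coproduct of no summands, with arbitrary inclusions.\<close>
  have "is_coproduct G 0 (\<lambda>_. X) V (\<lambda>_ x. x)" if "fin_gset G V" "pts V = {}" for V
    using that by (auto simp: is_coproduct_def bij_betw_def)
  with W W' have "Mlow W X d w = Mlow W' X d' w'"
    by (intro fold_value_unique[where n = 0 and X = X and \<iota> = "\<lambda>_ x. x" and \<iota>' = "\<lambda>_ x. x"] X d w) auto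
  with c show "c = Mlow W X d w" by simp
qed

lemma empty_gset:
  "fin_gset G \<lparr>pts = {}, act = \<lambda>_ _. undefined\<rparr>"
  by (auto simp: fin_gset_iff[OF is_group] is_action_def extensional_def)

text \<open>The coproduct axiom for \<open>n = 0\<close> identifies \<open>M W\<close> with the
  empty product, whose only element is the function that is \<open>undefined\<close>
  everywhere.\<close>

lemma empty_gset_value:
  assumes "fin_gset G W" "pts W = {}"
  shows "\<exists>w. M W = {w}"
proof -
  have "is_coproduct G 0 (\<lambda>_. W) W (\<lambda>_ x. x)"
    using assms by (auto simp: is_coproduct_def bij_betw_def)
  from coproduct_bij[OF this] have b: "bij_betw (\<lambda>w. \<lambda>i\<in>{..<0::nat}. Mup W W (\<lambda>x. x) w) (M W) {\<lambda>_. undefined}"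
    by simp
  have "card (M W) = card {\<lambda>_::nat. undefined :: 't}" by (rule bij_betw_same_card[OF b])
  then show ?thesis by (simp add: card_1_singleton_iff)
qed

lemma empty_gmap: "pts W = {} \<Longrightarrow> (\<lambda>_. undefined) \<in> gmaps G W X"
  by (auto simp: gmaps_def)

lemma funit_closed: "fin_gset G X \<Longrightarrow> funit X \<in> M X"
proof -
  let ?E = "\<lparr>pts = {}, act = \<lambda>_ _. undefined\<rparr> :: ('g, 'x) gset"
  assume X: "fin_gset G X"
  obtain w where "w \<in> M ?E" using empty_gset_value[OF empty_gset] by auto
  with X show ?thesis
    using funit_eq[OF X empty_gset _ empty_gmap] low_closed[OF empty_gset X empty_gmap] by simp
qed

text \<open>Factor \<open>f\<close> through a coproduct \<open>D\<close> of two copies of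
  \<open>V\<close>. Pulling the inclusion of the \<open>i\<close>-th copy back along
  \<open>W \<rightarrow> D\<close> gives the summand \<open>X i\<close>, so base change computes the
  restrictions of the image of \<open>w\<close> in \<open>M D\<close>; folding then adds
  them.\<close>

lemma low_coproduct:
  assumes W: "is_coproduct G 2 X W \<iota>" and V: "fin_gset G V" and f: "f \<in> gmaps G W V" and w: "w \<in> M W"
    and f0: "f0 \<in> gmaps G (X 0) V" "\<And>x. x \<in> pts (X 0) \<Longrightarrow> f0 x = f (\<iota> 0 x)"
    and f1: "f1 \<in> gmaps G (X 1) V" "\<And>x. x \<in> pts (X 1) \<Longrightarrow> f1 x = f (\<iota> 1 x)"
  shows "Mlow W V f w =
    fop V (Mlow (X 0) V f0 (Mup (X 0) W (\<iota> 0) w)) (Mlow (X 1) V f1 (Mup (X 1) W (\<iota> 1) w))"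
proof -
  have fW: "fin_gset G W" and X: "\<And>i. i < 2 \<Longrightarrow> fin_gset G (X i)"
    and \<iota>: "\<And>i. i < 2 \<Longrightarrow> \<iota> i \<in> gmaps G (X i) W"
    and b: "bij_betw (\<lambda>(i, x). \<iota> i x) (SIGMA i:{..<2}. pts (X i)) (pts W)"
    using W by (auto simp: is_coproduct_def)
  have ex: "\<exists>i x. i < 2 \<and> x \<in> pts (X i) \<and> v = \<iota> i x" if "v \<in> pts W" for v
  proof -
    have "v \<in> (\<lambda>(i, x). \<iota> i x) ` (SIGMA i:{..<2}. pts (X i))" using b that by (simp add: bij_betw_def)
    then show ?thesis by auto
  qed
  obtain D j d where D: "is_coproduct G 2 (\<lambda>_. V) D j" and d: "d \<in> gmaps G D V"
    and dj: "\<And>i x. i < 2 \<Longrightarrow> x \<in> pts V \<Longrightarrow> d (j i x) = x" using folding_exists[OF V] by blast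
  have fD: "fin_gset G D" and j: "\<And>i. i < 2 \<Longrightarrow> j i \<in> gmaps G V D"
    and bD: "bij_betw (\<lambda>(i, x). j i x) (SIGMA i:{..<2}. pts V) (pts D)"
    using D by (auto simp: is_coproduct_def)
  have jinj: "i = i' \<and> x = x'" if "j i x = j i' x'" "i < 2" "i' < 2" "x \<in> pts V" "x' \<in> pts V" for i i' x x'
    using bD that by (auto simp: bij_betw_def inj_on_def)
  define fi where "fi = (\<lambda>i::nat. if i = 0 then f0 else f1)"
  have fi: "fi i \<in> gmaps G (X i) V" "\<And>x. x \<in> pts (X i) \<Longrightarrow> fi i x = f (\<iota> i x)" if "i < 2" for i
    using that f0 f1 by (auto simp: fi_def less_2_cases_iff)
  \<comment> \<open>\<open>h\<close> sends the summand \<open>X i\<close> into the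
    \<open>i\<close>-th copy of \<open>V\<close> by \<open>f \<circ> \<iota> i\<close>, so that
    \<open>d \<circ> h = f\<close>.\<close>
  obtain h where h: "h \<in> gmaps G W D"
    and h\<iota>: "\<And>i x. i < 2 \<Longrightarrow> x \<in> pts (X i) \<Longrightarrow> h (\<iota> i x) = compose (pts (X i)) (j i) (fi i) x"
    using coproduct_map[OF W, of "\<lambda>i. compose (pts (X i)) (j i) (fi i)" D]
      fin_action[OF X] gmaps_compose[OF fin_action[OF X] fi(1) j] by blast
  have h\<iota>': "h (\<iota> i x) = j i (f (\<iota> i x))" if "i < 2" "x \<in> pts (X i)" for i x
    using h\<iota>[OF that] fi(2)[OF that] that by (simp add: compose_def)
  have fcl: "f (\<iota> i x) \<in> pts V" if "i < 2" "x \<in> pts (X i)" for i x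
    using gmaps_closed[OF f] gmaps_closed[OF \<iota>[OF that(1)] that(2)] by blast
  have "Mlow D V d (Mlow W D h w) = Mlow W V f w"
  proof (rule low_comp[OF fW fD V h d f _ w])
    fix v assume "v \<in> pts W"
    then show "f v = d (h v)" using ex[of v] h\<iota>' dj fcl by auto
  qed
  moreover have "Mup V D (j i) (Mlow W D h w) = Mlow (X i) V (fi i) (Mup (X i) W (\<iota> i) w)"
    if i: "i < 2" for i
  proof (rule pullback[OF pullbackI w])
    fix z z' assume "z \<in> pts (X i)" "z' \<in> pts (X i)" "\<iota> i z = \<iota> i z'"
    then show "z = z'" using b i by (auto simp: bij_betw_def inj_on_def)
  next
    fix v y assume v: "v \<in> pts W" and y: "y \<in> pts V" and eq: "h v = j i y"
    obtain k x where k: "k < 2" "x \<in> pts (X k)" "v = \<iota> k x" using ex[OF v] by blast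
    with eq h\<iota>' have "j k (f (\<iota> k x)) = j i y" by simp
    then have "k = i" "f (\<iota> k x) = y" using jinj k(1,2) i y fcl by blast+
    then show "\<exists>z\<in>pts (X i). \<iota> i z = v \<and> fi i z = y" using k fi(2) i by auto
  qed (use fW fD X V j h \<iota> fi h\<iota>' i in auto)
  then have "Mup V D (j 0) (Mlow W D h w) = Mlow (X 0) V f0 (Mup (X 0) W (\<iota> 0) w)"
    "Mup V D (j 1) (Mlow W D h w) = Mlow (X 1) V f1 (Mup (X 1) W (\<iota> 1) w)"
    by (auto simp: fi_def)
  ultimately show ?thesis
    using fop_eq[OF D d dj low_closed[OF fW fD h w]] by simp
qed

end


section \<open>Decomposing covariant maps over invariant subsets\<close>

context semi_mackey_functor
begin

text \<open>The summand that the invariant subset \<open>A\<close> of \<open>W\<close> contributes to the covariant image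
  \<open>Mlow W V f w\<close>. Additivity in \<open>A\<close> (\<open>part_Un\<close>) yields associativity and commutativity of the folding
  operation from those of the union.\<close>

definition part where
  "part W V f w A = Mlow (sub_gset W A) V (restrict f A) (Mup (sub_gset W A) W (\<lambda>x\<in>A. x) w)"

context
  fixes W V :: "('g, 'x) gset" and f w
  assumes W: "fin_gset G W" and V: "fin_gset G V" and f: "f \<in> gmaps G W V" and w: "w \<in> M W"
begin

text \<open>An injective \<open>h\<close> is an isomorphism onto the sub-G-set of its image, so the
  contribution of an invariant subset can be computed from any injective parametrisation of
  it.\<close>

lemma part_image:
  assumes X: "fin_gset G X" and h: "h \<in> gmaps G X W" "inj_on h (pts X)"
    and k: "k \<in> gmaps G X V" "\<And>x. x \<in> pts X \<Longrightarrow> k x = f (h x)"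
  shows "part W V f w (h ` pts X) = Mlow X V k (Mup X W h w)"
proof -
  let ?A = "h ` pts X"
  have A: "invariant_subset G W ?A" by (rule invariant_image[OF fin_action[OF X] h(1)])
  have fA: "fin_gset G (sub_gset W ?A)" by (rule sub_gset_fin[OF is_group W A])
  have hA: "h \<in> gmaps G X (sub_gset W ?A)"
  proof (rule gmapsI)
    fix g x assume "g \<in> carrier G" "x \<in> pts X"
    then show "h (act X g x) = act (sub_gset W ?A) g (h x)"
      using gmaps_act[OF h(1)] by (simp add: sub_gset_def)
  qed (use gmaps_ext[OF h(1)] in auto)
  have incl: "(\<lambda>x\<in>?A. x) \<in> gmaps G (sub_gset W ?A) W" by (rule sub_gset_incl'[OF A])
  have "Mup X (sub_gset W ?A) h (Mup (sub_gset W ?A) W (\<lambda>x\<in>?A. x) w) = Mup X W h w"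
    by (rule up_comp[OF X fA W hA incl h(1) _ w]) simp
  moreover have "h \<in> gset_isos G X (sub_gset W ?A)"
    using hA h(2) by (simp add: gset_isos_def bij_betw_def)
  ultimately show ?thesis
    unfolding part_def
    using low_up_iso[OF X fA V _ k(1) sub_gset_restrict[OF A f] _ up_closed[OF fA W incl w], of h] k(2)
    by simp
qed

lemma part_pts: "part W V f w (pts W) = Mlow W V f w"
  using part_image[OF W gmaps_id[OF fin_action[OF W]] _ f] up_id[OF W w]
  by (simp add: inj_on_def)

lemma part_closed:
  assumes A: "invariant_subset G W A"
  shows "part W V f w A \<in> M V"
  unfolding part_def
  using W A f w V sub_gset_fin[OF is_group W A] sub_gset_incl'[OF A] sub_gset_restrict[OF A f]
  by (meson low_closed up_closed)

lemma part_empty: "part W V f w {} = funit V"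
proof -
  have E: "fin_gset G (sub_gset W {})" by (rule sub_gset_fin[OF is_group W invariant_empty])
  have "Mup (sub_gset W {}) W (\<lambda>x\<in>{}. x) w \<in> M (sub_gset W {})"
    using E W sub_gset_incl'[OF invariant_empty] w by (rule up_closed)
  from funit_eq[OF V E _ sub_gset_restrict[OF invariant_empty f] this] show ?thesis
    by (simp add: part_def)
qed

text \<open>The disjoint union is a coproduct inside \<open>W\<close>, so
  \<open>low_coproduct\<close> splits the image; functoriality identifies restricting in two stages
  with restricting at once.\<close>

lemma part_Un:
  assumes A: "invariant_subset G W A" and B: "invariant_subset G W B" and disj: "A \<inter> B = {}"
  shows "part W V f w (A \<union> B) = fop V (part W V f w A) (part W V f w B)"
proof -
  let ?X = "\<lambda>i::nat. sub_gset W (if i = 0 then A else B)" and ?U = "sub_gset W (A \<union> B)"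
    and ?\<iota> = "\<lambda>i::nat. \<lambda>x\<in>if i = 0 then A else B. x"
  note AB = invariant_Un[OF A B]
  note fin = sub_gset_fin[OF is_group W A] sub_gset_fin[OF is_group W B] sub_gset_fin[OF is_group W AB]
  let ?w = "Mup ?U W (\<lambda>x\<in>A \<union> B. x) w"
  have w': "?w \<in> M ?U" by (rule up_closed[OF fin(3) W sub_gset_incl'[OF AB] w])
  have "Mup (sub_gset W A) ?U (\<lambda>x\<in>A. x) ?w = Mup (sub_gset W A) W (\<lambda>x\<in>A. x) w"
    by (rule up_comp[OF fin(1,3) W _ sub_gset_incl'[OF AB] sub_gset_incl'[OF A] _ w])
      (use sub_gset_incl[OF A AB] in auto)
  moreover have "Mup (sub_gset W B) ?U (\<lambda>x\<in>B. x) ?w = Mup (sub_gset W B) W (\<lambda>x\<in>B. x) w"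
    by (rule up_comp[OF fin(2,3) W _ sub_gset_incl'[OF AB] sub_gset_incl'[OF B] _ w])
      (use sub_gset_incl[OF B AB] in auto)
  moreover have "Mlow ?U V (restrict f (A \<union> B)) ?w =
    fop V (Mlow (?X 0) V (restrict f A) (Mup (?X 0) ?U (?\<iota> 0) ?w))
      (Mlow (?X 1) V (restrict f B) (Mup (?X 1) ?U (?\<iota> 1) ?w))"
    by (rule low_coproduct[OF sub_gset_coproduct[OF is_group W A B disj] V sub_gset_restrict[OF AB f] w'])
      (use sub_gset_restrict[OF A f] sub_gset_restrict[OF B f] in auto)
  ultimately show ?thesis by (simp add: part_def)
qed

end

lemma part_coproduct:
  assumes W: "is_coproduct G n X W \<iota>" and V: "fin_gset G V" and f: "f \<in> gmaps G W V"
    and w: "w \<in> M W" and i: "i < n" and k: "k \<in> gmaps G (X i) V" "\<And>x. x \<in> pts (X i) \<Longrightarrow> k x = f (\<iota> i x)"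
  shows "part W V f w (\<iota> i ` pts (X i)) = Mlow (X i) V k (Mup (X i) W (\<iota> i) w)"
proof (rule part_image[OF _ V f w _ _ _ k])
  show "inj_on (\<iota> i) (pts (X i))"
    using W i by (auto simp: is_coproduct_def bij_betw_def inj_on_def)
qed (use W i in \<open>auto simp: is_coproduct_def\<close>)

lemma coproduct_disjoint:
  assumes "is_coproduct G n X W \<iota>" "i < n" "j < n" "i \<noteq> j"
  shows "\<iota> i ` pts (X i) \<inter> \<iota> j ` pts (X j) = {}"
  using assms unfolding is_coproduct_def bij_betw_def inj_on_def by fastforce

lemma coproduct_image_invariant:
  assumes "is_coproduct G n X W \<iota>" "i < n"
  shows "invariant_subset G W (\<iota> i ` pts (X i))"
  using assms by (auto simp: is_coproduct_def fin_action intro!: invariant_image)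

lemma coproduct_cover:
  assumes "is_coproduct G n X W \<iota>"
  shows "(\<Union>i<n. \<iota> i ` pts (X i)) = pts W"
proof -
  have "pts W = (\<lambda>(i, x). \<iota> i x) ` (SIGMA i:{..<n}. pts (X i))"
    using assms by (simp add: is_coproduct_def bij_betw_def)
  then show ?thesis by auto
qed

text \<open>Induction on the number \<open>m\<close> of summands already included. Invariance of the
  partial union is carried along because \<open>part_Un\<close> needs it for the next
  summand.\<close>

lemma coproduct_partial_sum_mem:
  assumes W: "is_coproduct G n X W \<iota>" and w: "w \<in> M W" and m: "m \<le> n"
    and U: "funit W \<in> U" "\<And>a b. a \<in> U \<Longrightarrow> b \<in> U \<Longrightarrow> fop W a b \<in> U"
    and i: "\<And>i. i < n \<Longrightarrow> Mlow (X i) W (\<iota> i) (Mup (X i) W (\<iota> i) w) \<in> U"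
  shows "part W W (\<lambda>x\<in>pts W. x) w (\<Union>i<m. \<iota> i ` pts (X i)) \<in> U \<and>
    invariant_subset G W (\<Union>i<m. \<iota> i ` pts (X i))"
  using m
proof (induction m)
  have fW: "fin_gset G W" and id: "(\<lambda>x\<in>pts W. x) \<in> gmaps G W W"
    using W gmaps_id[OF fin_action] by (auto simp: is_coproduct_def)
  {
    case 0
    then show ?case using part_empty[OF fW fW id w] U(1)
      by (simp add: invariant_empty del: restrict_apply)
  next
    case (Suc m)
    let ?A = "\<Union>i<m. \<iota> i ` pts (X i)" and ?B = "\<iota> m ` pts (X m)"
    have "m < n" using Suc by simp
    have A: "invariant_subset G W ?A" "part W W (\<lambda>x\<in>pts W. x) w ?A \<in> U"
      using Suc by (auto simp del: restrict_apply)
    have B: "invariant_subset G W ?B" by (rule coproduct_image_invariant[OF W \<open>m < n\<close>])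
    have \<iota>: "\<iota> m \<in> gmaps G (X m) W" using W \<open>m < n\<close> by (auto simp: is_coproduct_def)
    have "part W W (\<lambda>x\<in>pts W. x) w ?B = Mlow (X m) W (\<iota> m) (Mup (X m) W (\<iota> m) w)"
      by (rule part_coproduct[OF W fW id w \<open>m < n\<close> \<iota>]) (simp add: gmaps_closed[OF \<iota>])
    moreover have "\<iota> i ` pts (X i) \<inter> ?B = {}" if "i < m" for i
      using coproduct_disjoint[OF W _ \<open>m < n\<close>, of i] that \<open>m < n\<close> by simp
    then have "?A \<inter> ?B = {}" by blast
    ultimately have "part W W (\<lambda>x\<in>pts W. x) w (?A \<union> ?B) \<in> U"
      using part_Un[OF fW fW id w A(1) B] A(2) i[OF \<open>m < n\<close>] U(2) by simp
    moreover have "(\<Union>i<Suc m. \<iota> i ` pts (X i)) = ?A \<union> ?B" by (auto simp: lessThan_Suc)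
    ultimately show ?case using invariant_Un[OF A(1) B] by (simp del: restrict_apply)
  }
qed

text \<open>For the identity map, \<open>part\<close> over all of \<open>W\<close> is
  \<open>w\<close> itself, which exhibits \<open>w\<close> as the sum of the transfers of its
  restrictions. Membership in a set \<open>U\<close> closed under the operation replaces a formal
  finite sum; the later use takes an ideal for \<open>U\<close>.\<close>

lemma coproduct_mem:
  assumes W: "is_coproduct G n X W \<iota>" and w: "w \<in> M W"
    and U: "funit W \<in> U" "\<And>a b. a \<in> U \<Longrightarrow> b \<in> U \<Longrightarrow> fop W a b \<in> U"
    and i: "\<And>i. i < n \<Longrightarrow> Mlow (X i) W (\<iota> i) (Mup (X i) W (\<iota> i) w) \<in> U"
  shows "w \<in> U"
proof -
  have fW: "fin_gset G W" using W by (auto simp: is_coproduct_def)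
  have "part W W (\<lambda>x\<in>pts W. x) w (pts W) \<in> U"
    using coproduct_partial_sum_mem[OF W w order_refl U i] coproduct_cover[OF W] by simp
  then show ?thesis
    using part_pts[OF fW fW gmaps_id[OF fin_action[OF fW]] w] low_id[OF fW w] by simp
qed

section \<open>Laws of the folding operation and its compatibility with the structure maps\<close>

lemma fop_assoc:
  assumes X: "fin_gset G X" and a: "a \<in> M X" "b \<in> M X" "c \<in> M X"
  shows "fop X (fop X a b) c = fop X a (fop X b c)"
proof -
  obtain W \<iota> where W: "is_coproduct G 3 (\<lambda>_. X) W \<iota>"
    using coproduct_exists[OF is_group infinite_points, of 3 "\<lambda>_. X"] X by blast
  obtain d where d: "d \<in> gmaps G W X" "\<And>i x. i < 3 \<Longrightarrow> x \<in> pts X \<Longrightarrow> d (\<iota> i x) = (\<lambda>x\<in>pts X. x) x"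
    using coproduct_map[OF W, of "\<lambda>_. \<lambda>x\<in>pts X. x" X] fin_action[OF X] gmaps_id[OF fin_action[OF X]]
    by blast
  define m where "m = (\<lambda>i::nat. if i = 0 then a else if i = 1 then b else c)"
  have m: "m i \<in> M X" for i using a by (simp add: m_def)
  obtain w where w: "w \<in> M W" "\<And>i. i < 3 \<Longrightarrow> Mup X W (\<iota> i) w = m i"
    using coproduct_surj[OF W, of m] m by blast
  have fW: "fin_gset G W" using W by (simp add: is_coproduct_def)
  define A where "A = (\<lambda>i. \<iota> i ` pts X)"
  have A: "invariant_subset G W (A i)" "part W X d w (A i) = m i" if "i < 3" for i
  proof -
    show "invariant_subset G W (A i)"
      using coproduct_image_invariant[OF W that] by (simp add: A_def)
    show "part W X d w (A i) = m i"
      using part_coproduct[OF W X d(1) w(1) that gmaps_id[OF fin_action[OF X]]]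
        d(2)[OF that] w(2)[OF that] m low_id[OF X]
      by (simp add: A_def restrict_apply' del: restrict_apply)
  qed
  have disj: "A i \<inter> A j = {}" if "i < 3" "j < 3" "i \<noteq> j" for i j
    using coproduct_disjoint[OF W that] by (simp add: A_def)
  have le: "0 < (3::nat)" "1 < (3::nat)" "2 < (3::nat)" by auto
  note un = part_Un[OF fW X d(1) w(1)]
  have "fop X (fop X (m 0) (m 1)) (m 2) = part W X d w ((A 0 \<union> A 1) \<union> A 2)"
  proof -
    have "(A 0 \<union> A 1) \<inter> A 2 = {}" using disj[OF le(1,3)] disj[OF le(2,3)] by auto
    then show ?thesis
      using un[OF A(1)[OF le(1)] A(1)[OF le(2)] disj[OF le(1,2)]]
        un[OF invariant_Un[OF A(1)[OF le(1)] A(1)[OF le(2)]] A(1)[OF le(3)]]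
      by (simp add: A(2))
  qed
  moreover have "fop X (m 0) (fop X (m 1) (m 2)) = part W X d w (A 0 \<union> (A 1 \<union> A 2))"
  proof -
    have "A 0 \<inter> (A 1 \<union> A 2) = {}" using disj[OF le(1,3)] disj[OF le(1,2)] by auto
    then show ?thesis
      using un[OF A(1)[OF le(2)] A(1)[OF le(3)] disj[OF le(2,3)]]
        un[OF A(1)[OF le(1)] invariant_Un[OF A(1)[OF le(2)] A(1)[OF le(3)]]]
      by (simp add: A(2))
  qed
  ultimately show ?thesis by (simp add: m_def Un_assoc)
qed

lemma fop_comm:
  assumes X: "fin_gset G X" and a: "a \<in> M X" "b \<in> M X"
  shows "fop X a b = fop X b a"
proof -
  obtain W \<iota> d where W: "is_coproduct G 2 (\<lambda>_. X) W \<iota>" and d: "d \<in> gmaps G W X"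
    "\<And>i x. i < 2 \<Longrightarrow> x \<in> pts X \<Longrightarrow> d (\<iota> i x) = x" using folding_exists[OF X] by blast
  obtain w where w: "w \<in> M W" "Mup X W (\<iota> 0) w = a" "Mup X W (\<iota> 1) w = b"
    using folding_lift[OF W a] by blast
  have fW: "fin_gset G W" using W by (simp add: is_coproduct_def)
  have p: "part W X d w (\<iota> i ` pts X) = Mup X W (\<iota> i) w" if "i < 2" for i
  proof -
    have "Mup X W (\<iota> i) w \<in> M X"
      using W that by (auto simp: is_coproduct_def intro!: up_closed w(1))
    then show ?thesis
      using part_coproduct[OF W X d(1) w(1) that gmaps_id[OF fin_action[OF X]]]
        d(2)[OF that] low_id[OF X] by (simp del: restrict_apply add: restrict_apply')
  qed
  have le: "0 < (2::nat)" "1 < (2::nat)" by auto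
  note un = part_Un[OF fW X d(1) w(1)] and inv = coproduct_image_invariant[OF W]
  have "fop X a b = part W X d w (\<iota> 0 ` pts X \<union> \<iota> 1 ` pts X)"
    using un[OF inv[OF le(1)] inv[OF le(2)]] coproduct_disjoint[OF W le] p w by simp
  moreover have "fop X b a = part W X d w (\<iota> 1 ` pts X \<union> \<iota> 0 ` pts X)"
    using un[OF inv[OF le(2)] inv[OF le(1)]] coproduct_disjoint[OF W le(2,1)] p w by simp
  ultimately show ?thesis by (simp add: Un_commute)
qed

text \<open>Additivity of \<open>part\<close> for the identity map, applied to
  \<open>{} \<union> pts X\<close>.\<close>

lemma fop_unit:
  assumes X: "fin_gset G X" and a: "a \<in> M X"
  shows "fop X (funit X) a = a"
proof -
  note id = gmaps_id[OF fin_action[OF X]]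
  have "part X X (\<lambda>x\<in>pts X. x) a ({} \<union> pts X) = fop X (funit X) (part X X (\<lambda>x\<in>pts X. x) a (pts X))"
    using part_Un[OF X X id a invariant_empty invariant_pts[OF fin_action[OF X]]] part_empty[OF X X id a]
    by simp
  then show ?thesis using part_pts[OF X X id a] low_id[OF X a] by simp
qed

text \<open>The square formed by the two folding maps, \<open>f\<close>, and the map
  \<open>h\<close> that is \<open>f\<close> on each copy is a pull-back; base change moves the
  restriction inside the folding.\<close>

lemma up_fop:
  assumes X: "fin_gset G X" and Y: "fin_gset G Y" and f: "f \<in> gmaps G X Y" and a: "a \<in> M Y" "b \<in> M Y"
  shows "Mup X Y f (fop Y a b) = fop X (Mup X Y f a) (Mup X Y f b)"
proof -
  obtain W \<iota> d where W: "is_coproduct G 2 (\<lambda>_. X) W \<iota>" and d: "d \<in> gmaps G W X"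
    "\<And>i x. i < 2 \<Longrightarrow> x \<in> pts X \<Longrightarrow> d (\<iota> i x) = x" using folding_exists[OF X] by blast
  obtain V j e where V: "is_coproduct G 2 (\<lambda>_. Y) V j" and e: "e \<in> gmaps G V Y"
    "\<And>i x. i < 2 \<Longrightarrow> x \<in> pts Y \<Longrightarrow> e (j i x) = x" using folding_exists[OF Y] by blast
  obtain v where v: "v \<in> M V" "Mup Y V (j 0) v = a" "Mup Y V (j 1) v = b"
    using folding_lift[OF V a] by blast
  have fW: "fin_gset G W" and fV: "fin_gset G V"
    and \<iota>: "\<And>i. i < 2 \<Longrightarrow> \<iota> i \<in> gmaps G X W" and j: "\<And>i. i < 2 \<Longrightarrow> j i \<in> gmaps G Y V"
    using W V by (auto simp: is_coproduct_def)
  have ji: "compose (pts X) (j i) f \<in> gmaps G X V" if "i < 2" for i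
    using gmaps_compose[OF fin_action[OF X] f j[OF that]] .
  obtain h where h: "h \<in> gmaps G W V"
    "\<And>i x. i < 2 \<Longrightarrow> x \<in> pts X \<Longrightarrow> h (\<iota> i x) = compose (pts X) (j i) f x"
    using coproduct_map[OF W, of "\<lambda>i. compose (pts X) (j i) f" V] fin_action[OF X] ji by blast
  have h\<iota>: "h (\<iota> i x) = j i (f x)" if "i < 2" "x \<in> pts X" for i x
    using h(2)[OF that] that by (simp add: compose_def)
  have exW: "\<exists>i x. i < 2 \<and> x \<in> pts X \<and> z = \<iota> i x" if "z \<in> pts W" for z
    using coproduct_cover[OF W] that by blast
  have exV: "\<exists>i x. i < 2 \<and> x \<in> pts Y \<and> z = j i x" if "z \<in> pts V" for z
    using coproduct_cover[OF V] that by blast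
  have jinj: "i = i' \<and> x = x'" if "j i x = j i' x'" "i < 2" "i' < 2" "x \<in> pts Y" "x' \<in> pts Y" for i i' x x'
    using V that by (auto simp: is_coproduct_def bij_betw_def inj_on_def)
  have "Mup X Y f (Mlow V Y e v) = Mlow W X d (Mup W V h v)"
  proof (rule pullback[OF pullbackI v(1)])
    fix z assume "z \<in> pts W"
    then show "e (h z) = f (d z)" using exW[of z] h\<iota> d(2) e(2) gmaps_closed[OF f] by auto
  next
    fix z z' assume z: "z \<in> pts W" "z' \<in> pts W" "h z = h z'" "d z = d z'"
    obtain i x where i: "i < 2" "x \<in> pts X" "z = \<iota> i x" using exW z(1) by blast
    obtain i' x' where i': "i' < 2" "x' \<in> pts X" "z' = \<iota> i' x'" using exW z(2) by blast
    have "x = x'" using z(4) i i' d(2) by simp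
    moreover have "i = i'" using z(3) i i' h\<iota> jinj gmaps_closed[OF f] by metis
    ultimately show "z = z'" using i i' by simp
  next
    fix z x assume z: "z \<in> pts V" and x: "x \<in> pts X" "e z = f x"
    obtain i y where i: "i < 2" "y \<in> pts Y" "z = j i y" using exV z by blast
    then have "y = f x" using e(2) x by simp
    then show "\<exists>u\<in>pts W. h u = z \<and> d u = x"
      using i x h\<iota> d(2) gmaps_closed[OF \<iota>] by (intro bexI[of _ "\<iota> i x"]) auto
  qed (use X Y fW fV d e h f in auto)
  moreover have "Mup X W (\<iota> i) (Mup W V h v) = Mup X Y f (Mup Y V (j i) v)" if "i < 2" for i
    using up_comp[OF X fW fV \<iota>[OF that] h(1) ji[OF that] _ v(1)]
      up_comp[OF X Y fV f j[OF that] ji[OF that] _ v(1)] h\<iota>[OF that]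
    by (simp add: compose_def)
  ultimately show ?thesis
    using fop_eq[OF V e v(1)] fop_eq[OF W d up_closed[OF fW fV h(1) v(1)]] v by simp
qed

text \<open>The composite of the folding map with \<open>f\<close> is \<open>f\<close> on each of
  the two copies, so \<open>low_coproduct\<close> evaluates it.\<close>

lemma low_fop:
  assumes X: "fin_gset G X" and Y: "fin_gset G Y" and f: "f \<in> gmaps G X Y" and a: "a \<in> M X" "b \<in> M X"
  shows "Mlow X Y f (fop X a b) = fop Y (Mlow X Y f a) (Mlow X Y f b)"
proof -
  obtain W \<iota> d where W: "is_coproduct G 2 (\<lambda>_. X) W \<iota>" and d: "d \<in> gmaps G W X"
    "\<And>i x. i < 2 \<Longrightarrow> x \<in> pts X \<Longrightarrow> d (\<iota> i x) = x" using folding_exists[OF X] by blast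
  obtain w where w: "w \<in> M W" "Mup X W (\<iota> 0) w = a" "Mup X W (\<iota> 1) w = b"
    using folding_lift[OF W a] by blast
  have fW: "fin_gset G W" and \<iota>: "\<And>i. i < 2 \<Longrightarrow> \<iota> i \<in> gmaps G X W"
    using W by (auto simp: is_coproduct_def)
  have fd: "compose (pts W) f d \<in> gmaps G W Y" by (rule gmaps_compose[OF fin_action[OF fW] d(1) f])
  have fd\<iota>: "f x = compose (pts W) f d (\<iota> i x)" if "i < 2" "x \<in> pts X" for i x
    using that gmaps_closed[OF \<iota>] d(2) by (simp add: compose_def)
  have "Mlow X Y f (fop X a b) = Mlow X Y f (Mlow W X d w)"
    using fop_eq[OF W d w(1)] w by simp
  also have "\<dots> = Mlow W Y (compose (pts W) f d) w"
    by (rule low_comp[OF fW X Y d(1) f fd _ w(1)]) (simp add: compose_def)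
  also have "\<dots> = fop Y (Mlow X Y f a) (Mlow X Y f b)"
    using low_coproduct[OF W Y fd w(1) f fd\<iota>[of 0] f fd\<iota>[of 1]] w by simp
  finally show ?thesis .
qed

text \<open>The pull-back of the empty G-set over \<open>Y\<close> along \<open>f\<close> is empty,
  so base change applies to the value defining the unit.\<close>

lemma up_unit:
  assumes X: "fin_gset G X" and Y: "fin_gset G Y" and f: "f \<in> gmaps G X Y"
  shows "Mup X Y f (funit Y) = funit X"
proof -
  let ?E = "\<lparr>pts = {}, act = \<lambda>_ _. undefined\<rparr> :: ('g, 'x) gset"
  obtain w where w: "w \<in> M ?E" using empty_gset_value[OF empty_gset] by auto
  have e: "(\<lambda>_. undefined) \<in> gmaps G ?E Z" for Z :: "('g, 'x) gset" by (rule empty_gmap) simp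
  have "Mup X Y f (Mlow ?E Y (\<lambda>_. undefined) w) = Mlow ?E X (\<lambda>_. undefined) (Mup ?E ?E (\<lambda>_. undefined) w)"
    by (rule pullback[OF pullbackI w]) (use X Y f empty_gset e in auto)
  then show ?thesis
    using funit_eq[OF Y empty_gset _ e w] funit_eq[OF X empty_gset _ e up_closed[OF empty_gset empty_gset e w]]
    by simp
qed

lemma low_unit:
  assumes X: "fin_gset G X" and Y: "fin_gset G Y" and f: "f \<in> gmaps G X Y"
  shows "Mlow X Y f (funit X) = funit Y"
proof -
  let ?E = "\<lparr>pts = {}, act = \<lambda>_ _. undefined\<rparr> :: ('g, 'x) gset"
  obtain w where w: "w \<in> M ?E" using empty_gset_value[OF empty_gset] by auto
  have e: "(\<lambda>_. undefined) \<in> gmaps G ?E Z" for Z :: "('g, 'x) gset" by (rule empty_gmap) simp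
  have "Mlow X Y f (Mlow ?E X (\<lambda>_. undefined) w) = Mlow ?E Y (\<lambda>_. undefined) w"
    by (rule low_comp[OF empty_gset X Y e f e _ w]) simp
  then show ?thesis
    using funit_eq[OF Y empty_gset _ e w] funit_eq[OF X empty_gset _ e w] by simp
qed

end


section \<open>Exponential diagrams\<close>

context
  fixes G :: "('g, 'm) monoid_scheme" (structure) and A X Y :: "('g, 'x) gset" and p f
  assumes G: "group G" and A: "fin_gset G A" and X: "fin_gset G X" and Y: "fin_gset G Y"
    and p: "p \<in> gmaps G A X" and f: "f \<in> gmaps G X Y"
begin

interpretation group G by (rule G)

lemma exp_actions: "is_action G A" "is_action G X" "is_action G Y"
  using A X Y by (auto simp: fin_gset_iff[OF G])

lemma act_cancel:
  assumes "is_action G V" "g \<in> carrier G" "v \<in> pts V"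
  shows "act V g (act V (inv g) v) = v" "act V (inv g) (act V g v) = v"
  using assms unfolding is_action_def by (metis inv_closed r_inv, metis inv_closed l_inv)

lemma fibre_act:
  assumes g: "g \<in> carrier G" and x: "x \<in> pts X" and y: "y \<in> pts Y"
  shows "act X g x \<in> fibre X f (act Y g y) \<longleftrightarrow> x \<in> fibre X f y"
proof -
  have "f x = y" if "act Y g (f x) = act Y g y"
    using arg_cong[OF that, of "act Y (inv g)"] act_cancel(2)[OF exp_actions(3) g] gmaps_closed[OF f x] y
    by simp
  then show ?thesis
    using x is_action_closed[OF exp_actions(2) g x] by (auto simp: fibre_def gmaps_act[OF f g x])
qed

lemma fibre_act_inv:
  assumes g: "g \<in> carrier G" and y: "y \<in> pts Y" and x: "x \<in> fibre X f (act Y g y)"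
  shows "act X (inv g) x \<in> fibre X f y"
proof -
  have "x \<in> pts X" using x by (simp add: fibre_def)
  then show ?thesis
    using fibre_act[OF g is_action_closed[OF exp_actions(2) inv_closed[OF g], of x] y]
      act_cancel(1)[OF exp_actions(2) g, of x] x by simp
qed

text \<open>The conjugate of \<open>\<sigma>\<close> makes sense because \<open>inv g\<close>
  carries the fibre over \<open>act Y g y\<close> to the fibre over \<open>y\<close>. Keeping
  sections extensional on their fibres turns the action laws into equalities of functions.\<close>

lemma exp_Pi_action: "is_action G (exp_Pi G A X Y p f)"
proof -
  let ?s = "\<lambda>g y \<sigma>. \<lambda>x\<in>fibre X f (act Y g y). act A g (\<sigma> (act X (inv g) x))"
  have "?s g y \<sigma> \<in> fibre X f (act Y g y) \<rightarrow>\<^sub>E pts A \<and> (\<forall>x\<in>fibre X f (act Y g y). p (?s g y \<sigma> x) = x)"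
    if "g \<in> carrier G" "y \<in> pts Y" "\<sigma> \<in> fibre X f y \<rightarrow>\<^sub>E pts A" "\<forall>x\<in>fibre X f y. p (\<sigma> x) = x" for g y \<sigma>
  proof (intro conjI ballI PiE_I)
    fix x assume x: "x \<in> fibre X f (act Y g y)"
    note x' = fibre_act_inv[OF that(1,2) x]
    have \<sigma>: "\<sigma> (act X (inv g) x) \<in> pts A" using that(3) x' by auto
    show "?s g y \<sigma> x \<in> pts A"
      using x is_action_closed[OF exp_actions(1) that(1) \<sigma>] by simp
    have "x \<in> pts X" using x by (simp add: fibre_def)
    then show "p (?s g y \<sigma> x) = x"
      using x gmaps_act[OF p that(1) \<sigma>] that(4) x' act_cancel(1)[OF exp_actions(2) that(1)] by simp
  qed simp
  moreover have "?s \<one> y \<sigma> = \<sigma>" if "y \<in> pts Y" "\<sigma> \<in> fibre X f y \<rightarrow>\<^sub>E pts A" for y \<sigma>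
    using that exp_actions
    by (intro extensionalityI[where A = "fibre X f y"]) (auto simp: is_action_def fibre_def PiE_def)
  moreover have "?s (g \<otimes> h) y \<sigma> = ?s g (act Y h y) (?s h y \<sigma>)"
    if "g \<in> carrier G" "h \<in> carrier G" "y \<in> pts Y" "\<sigma> \<in> fibre X f y \<rightarrow>\<^sub>E pts A" for g h y \<sigma>
  proof (rule extensionalityI[where A = "fibre X f (act Y (g \<otimes> h) y)"])
    fix x assume x: "x \<in> fibre X f (act Y (g \<otimes> h) y)"
    have gh: "act Y (g \<otimes> h) y = act Y g (act Y h y)" using exp_actions that by (simp add: is_action_def)
    have hy: "act Y h y \<in> pts Y" using exp_actions that by (simp add: is_action_def)
    have x1: "act X (inv g) x \<in> fibre X f (act Y h y)"
      using fibre_act_inv[OF that(1) hy] x gh by simp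
    have x2: "act X (inv h) (act X (inv g) x) \<in> fibre X f y" by (rule fibre_act_inv[OF that(2,3) x1])
    have "x \<in> pts X" using x by (simp add: fibre_def)
    then have x3: "act X (inv (g \<otimes> h)) x = act X (inv h) (act X (inv g) x)"
      using exp_actions that by (simp add: is_action_def inv_mult_group)
    have "\<sigma> (act X (inv h) (act X (inv g) x)) \<in> pts A" using x2 that(4) by auto
    then show "?s (g \<otimes> h) y \<sigma> x = ?s g (act Y h y) (?s h y \<sigma>) x"
      using x x1 gh x3 exp_actions that(1,2) by (simp add: is_action_def)
  qed (use exp_actions that in \<open>auto simp: is_action_def\<close>)
  ultimately show ?thesis
    using exp_actions(3) unfolding is_action_def exp_Pi_def by auto
qed

lemma exp_Pi_finite: "finite (pts (exp_Pi G A X Y p f))"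
proof (rule finite_subset)
  show "pts (exp_Pi G A X Y p f) \<subseteq> Sigma (pts Y) (\<lambda>y. fibre X f y \<rightarrow>\<^sub>E pts A)"
    by (auto simp: exp_Pi_def)
  show "finite (Sigma (pts Y) (\<lambda>y. fibre X f y \<rightarrow>\<^sub>E pts A))"
    using A X Y by (intro finite_SigmaI finite_PiE) (auto simp: fin_gset_def fibre_def)
qed

lemma exp_Pi_fst: "u \<in> pts (exp_Pi G A X Y p f) \<Longrightarrow> fst u \<in> pts Y"
  "fst (act (exp_Pi G A X Y p f) g u) = act Y g (fst u)"
  by (auto simp: exp_Pi_def split: prod.splits)

lemma exp_Z_action: "is_action G (exp_Z G A X Y p f)"
proof -
  note Pi = exp_Pi_action[unfolded is_action_def]
  have "f (act X g x) = fst (act (exp_Pi G A X Y p f) g u)"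
    if "g \<in> carrier G" "x \<in> pts X" "f x = fst u" for g x u
    using gmaps_act[OF f that(1,2)] that(3) exp_Pi_fst(2) by simp
  with Pi exp_actions(2) show ?thesis
    unfolding is_action_def exp_Z_def by simp
qed

lemma exp_Z_finite: "finite (pts (exp_Z G A X Y p f))"
proof (rule finite_subset)
  show "pts (exp_Z G A X Y p f) \<subseteq> pts X \<times> pts (exp_Pi G A X Y p f)"
    by (auto simp: exp_Z_def)
  show "finite (pts X \<times> pts (exp_Pi G A X Y p f))"
    using X exp_Pi_finite by (auto simp: fin_gset_def)
qed

text \<open>This is the equivariance of the evaluation map of the exponential diagram: the inverse
  in the conjugation action cancels against \<open>g\<close>.\<close>

lemma exp_eval_act:
  assumes g: "g \<in> carrier G" and z: "(x, u) \<in> pts (exp_Z G A X Y p f)"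
  shows "snd (act (exp_Pi G A X Y p f) g u) (act X g x) = act A g (snd u x)"
proof -
  have "x \<in> fibre X f (fst u)" "x \<in> pts X" "fst u \<in> pts Y"
    using z by (auto simp: exp_Z_def exp_Pi_def fibre_def)
  then have "act X g x \<in> fibre X f (act Y g (fst u))" "act X (inv g) (act X g x) = x"
    using fibre_act[OF g] act_cancel(2)[OF exp_actions(2) g] by auto
  then show ?thesis by (cases u) (simp add: exp_Pi_def)
qed

lemma exp_eval_closed:
  assumes "(x, u) \<in> pts (exp_Z G A X Y p f)"
  shows "snd u x \<in> pts A" "p (snd u x) = x"
  using assms by (auto simp: exp_Z_def exp_Pi_def fibre_def)

text \<open>Both explicit G-sets are copied into \<open>'x\<close> and the three maps are
  conjugated. The isomorphisms \<open>\<theta>\<close> and \<open>\<zeta>\<close> are handed out as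
  well, since identifying the points of \<open>P\<close> requires them.\<close>

lemma exponential_exists:
  assumes "infinite (UNIV :: 'x set)"
  obtains P Z :: "('g, 'x) gset" and \<pi> \<rho> l \<theta> \<zeta> where
    "is_exponential G A X Y P Z p f \<pi> \<rho> l"
    "\<theta> \<in> gset_isos G P (exp_Pi G A X Y p f)" "\<zeta> \<in> gset_isos G Z (exp_Z G A X Y p f)"
    "\<And>u. u \<in> pts P \<Longrightarrow> \<pi> u = fst (\<theta> u)" "\<And>z. z \<in> pts Z \<Longrightarrow> \<theta> (\<rho> z) = snd (\<zeta> z)"
    "\<And>z. z \<in> pts Z \<Longrightarrow> l z = snd (snd (\<zeta> z)) (fst (\<zeta> z))"
proof -
  let ?P = "exp_Pi G A X Y p f" and ?Z = "exp_Z G A X Y p f"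
  obtain P :: "('g, 'x) gset" and \<theta> where P: "fin_gset G P" and \<theta>: "\<theta> \<in> gset_isos G P ?P"
    using gset_transport[OF G exp_Pi_finite exp_Pi_action assms] .
  obtain Z :: "('g, 'x) gset" and \<zeta> where Z: "fin_gset G Z" and \<zeta>: "\<zeta> \<in> gset_isos G Z ?Z"
    using gset_transport[OF G exp_Z_finite exp_Z_action assms] .
  have aP: "is_action G P" and aZ: "is_action G Z" using P Z by (auto simp: fin_gset_iff[OF G])
  have \<theta>m: "\<theta> \<in> gmaps G P ?P" "bij_betw \<theta> (pts P) (pts ?P)"
    and \<zeta>m: "\<zeta> \<in> gmaps G Z ?Z" using \<theta> \<zeta> by (auto simp: gset_isos_def)
  define \<theta>' where "\<theta>' = restrict (inv_into (pts P) \<theta>) (pts ?P)"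
  have \<theta>': "\<theta>' \<in> gmaps G ?P P" "\<And>u. u \<in> pts ?P \<Longrightarrow> \<theta> (\<theta>' u) = u"
    using gset_iso_inverse[OF aP \<theta>] \<theta>m(2)
    by (auto simp: \<theta>'_def gset_isos_def bij_betw_inv_into_right)
  define \<pi> \<rho> l where "\<pi> = (\<lambda>u\<in>pts P. fst (\<theta> u))" and "\<rho> = (\<lambda>z\<in>pts Z. \<theta>' (snd (\<zeta> z)))"
    and "l = (\<lambda>z\<in>pts Z. snd (snd (\<zeta> z)) (fst (\<zeta> z)))"
  have \<zeta>cl: "(fst (\<zeta> z), snd (\<zeta> z)) \<in> pts ?Z" "snd (\<zeta> z) \<in> pts ?P" if "z \<in> pts Z" for z
    using gmaps_closed[OF \<zeta>m that] by (auto simp: exp_Z_def)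
  have \<zeta>act: "fst (\<zeta> (act Z g z)) = act X g (fst (\<zeta> z))" "snd (\<zeta> (act Z g z)) = act ?P g (snd (\<zeta> z))"
    if "g \<in> carrier G" "z \<in> pts Z" for g z
    using gmaps_act[OF \<zeta>m that] by (auto simp: exp_Z_def split: prod.splits)
  have "\<pi> \<in> gmaps G P Y"
  proof (rule gmapsI)
    fix g u assume "g \<in> carrier G" "u \<in> pts P"
    then show "\<pi> (act P g u) = act Y g (\<pi> u)"
      using gmaps_act[OF \<theta>m(1)] is_action_closed[OF aP] exp_Pi_fst(2) by (simp add: \<pi>_def)
  qed (use exp_Pi_fst(1) gmaps_closed[OF \<theta>m(1)] in \<open>auto simp: \<pi>_def\<close>)
  moreover have "\<rho> \<in> gmaps G Z P"
  proof (rule gmapsI)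
    fix g z assume "g \<in> carrier G" "z \<in> pts Z"
    then show "\<rho> (act Z g z) = act P g (\<rho> z)"
      using is_action_closed[OF aZ] gmaps_act[OF \<theta>'(1)] \<zeta>cl \<zeta>act by (simp add: \<rho>_def)
  qed (use \<zeta>cl gmaps_closed[OF \<theta>'(1)] in \<open>auto simp: \<rho>_def\<close>)
  moreover have "l \<in> gmaps G Z A"
  proof (rule gmapsI)
    fix g z assume "g \<in> carrier G" "z \<in> pts Z"
    then show "l (act Z g z) = act A g (l z)"
      using is_action_closed[OF aZ] \<zeta>act exp_eval_act[OF _ \<zeta>cl(1)] by (simp add: l_def)
  qed (use exp_eval_closed(1) \<zeta>cl(1) in \<open>auto simp: l_def\<close>)
  moreover have eqs: "\<And>u. u \<in> pts P \<Longrightarrow> \<pi> u = fst (\<theta> u)" "\<And>z. z \<in> pts Z \<Longrightarrow> \<theta> (\<rho> z) = snd (\<zeta> z)"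
    "\<And>z. z \<in> pts Z \<Longrightarrow> l z = snd (snd (\<zeta> z)) (fst (\<zeta> z))"
    using \<zeta>cl \<theta>'(2) by (auto simp: \<pi>_def \<rho>_def l_def)
  ultimately have "is_exponential G A X Y P Z p f \<pi> \<rho> l"
    unfolding is_exponential_def using A X Y P Z p f \<theta> \<zeta> by blast
  with \<theta> \<zeta> eqs that show thesis by blast
qed

text \<open>A section \<open>\<tau>\<close> of \<open>p\<close> over \<open>X\<close> is the same as a section \<open>m\<close> of \<open>\<pi>\<close>, and \<open>\<rho>\<close> pulls back to \<open>f\<close> along \<open>m\<close>.\<close>

lemma exponential_section:
  assumes E: "is_exponential G A X Y P Z p f \<pi> \<rho> l"
    and \<theta>: "\<theta> \<in> gset_isos G P (exp_Pi G A X Y p f)" and \<zeta>: "\<zeta> \<in> gset_isos G Z (exp_Z G A X Y p f)"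
    and \<rho>: "\<And>z. z \<in> pts Z \<Longrightarrow> \<theta> (\<rho> z) = snd (\<zeta> z)"
    and l: "\<And>z. z \<in> pts Z \<Longrightarrow> l z = snd (snd (\<zeta> z)) (fst (\<zeta> z))"
    and \<tau>: "\<tau> \<in> gmaps G X A" "\<And>x. x \<in> pts X \<Longrightarrow> p (\<tau> x) = x"
  obtains m n where "m \<in> gmaps G Y P" "n \<in> gmaps G X Z"
    "\<And>y. y \<in> pts Y \<Longrightarrow> \<theta> (m y) = (y, restrict \<tau> (fibre X f y))"
    "\<And>x. x \<in> pts X \<Longrightarrow> l (n x) = \<tau> x" "is_pullback G Z P X Y \<rho> m n f"
proof -
  let ?P = "exp_Pi G A X Y p f" and ?Z = "exp_Z G A X Y p f"
  have P: "fin_gset G P" and Z: "fin_gset G Z" and \<rho>m: "\<rho> \<in> gmaps G Z P"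
    using E by (auto simp: is_exponential_def)
  have aP: "is_action G P" and aZ: "is_action G Z" using P Z by (auto simp: fin_gset_iff[OF G])
  define \<theta>' where "\<theta>' = restrict (inv_into (pts P) \<theta>) (pts ?P)"
  define \<zeta>' where "\<zeta>' = restrict (inv_into (pts Z) \<zeta>) (pts ?Z)"
  have \<theta>': "\<theta>' \<in> gmaps G ?P P" "\<And>u. u \<in> pts ?P \<Longrightarrow> \<theta> (\<theta>' u) = u"
    using gset_iso_inverse[OF aP \<theta>] \<theta>
    by (auto simp: \<theta>'_def gset_isos_def bij_betw_inv_into_right)
  have \<zeta>': "\<zeta>' \<in> gmaps G ?Z Z" "\<And>u. u \<in> pts ?Z \<Longrightarrow> \<zeta> (\<zeta>' u) = u" "\<And>z. z \<in> pts Z \<Longrightarrow> \<zeta>' (\<zeta> z) = z"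
    using gset_iso_inverse[OF aZ \<zeta>] \<zeta>
    by (auto simp: \<zeta>'_def gset_isos_def bij_betw_inv_into_right bij_betw_inv_into_left bij_betw_def inv_into_f_f)
  \<comment> \<open>The section in the explicit model: over \<open>y\<close> it is
    \<open>\<tau>\<close> restricted to the fibre, which lies there because
    \<open>p \<circ> \<tau>\<close> is the identity.\<close>
  define s where "s = (\<lambda>y\<in>pts Y. (y, restrict \<tau> (fibre X f y)))"
  have fib: "x \<in> pts X" if "x \<in> fibre X f y" for x y using that by (simp add: fibre_def)
  have s: "s \<in> gmaps G Y ?P"
  proof (rule gmapsI)
    fix g y assume g: "g \<in> carrier G" and y: "y \<in> pts Y"
    have "restrict \<tau> (fibre X f (act Y g y)) =
      (\<lambda>x\<in>fibre X f (act Y g y). act A g (restrict \<tau> (fibre X f y) (act X (inv g) x)))"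
    proof (rule restrict_ext)
      fix x assume x: "x \<in> fibre X f (act Y g y)"
      note x' = fibre_act_inv[OF g y x]
      show "\<tau> x = act A g (restrict \<tau> (fibre X f y) (act X (inv g) x))"
        using x' gmaps_act[OF \<tau>(1) g fib[OF x']] act_cancel(1)[OF exp_actions(2) g fib[OF x]] by simp
    qed
    then show "s (act Y g y) = act ?P g (s y)"
      using g y is_action_closed[OF exp_actions(3)] by (simp add: s_def exp_Pi_def)
  qed (use gmaps_closed[OF \<tau>(1)] \<tau>(2) fib in \<open>auto simp: s_def exp_Pi_def\<close>)
  define m where "m = compose (pts Y) \<theta>' s"
  have m: "m \<in> gmaps G Y P" unfolding m_def by (rule gmaps_compose[OF exp_actions(3) s \<theta>'(1)])
  have \<theta>m: "\<theta> (m y) = s y" if "y \<in> pts Y" for y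
    using that \<theta>'(2) gmaps_closed[OF s] by (simp add: m_def compose_def)
  \<comment> \<open>The lift of \<open>s\<close> to \<open>exp_Z\<close>: evaluating at
    \<open>(x, s (f x))\<close> returns \<open>\<tau> x\<close>, which is what
    \<open>l (n x)\<close> has to be.\<close>
  define r where "r = (\<lambda>x\<in>pts X. (x, s (f x)))"
  have r: "r \<in> gmaps G X ?Z"
  proof (rule gmapsI)
    fix g x assume g: "g \<in> carrier G" and x: "x \<in> pts X"
    then show "r (act X g x) = act ?Z g (r x)"
      using is_action_closed[OF exp_actions(2) g x] gmaps_act[OF f g x]
        gmaps_act[OF s g gmaps_closed[OF f x]] by (simp add: r_def exp_Z_def)
  qed (use gmaps_closed[OF s] gmaps_closed[OF f] in \<open>auto simp: r_def exp_Z_def s_def\<close>)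
  define n where "n = compose (pts X) \<zeta>' r"
  have n: "n \<in> gmaps G X Z" unfolding n_def by (rule gmaps_compose[OF exp_actions(2) r \<zeta>'(1)])
  have \<zeta>n: "\<zeta> (n x) = (x, s (f x))" if "x \<in> pts X" for x
    using that \<zeta>'(2) gmaps_closed[OF r that] by (simp add: n_def compose_def r_def)
  have ln: "l (n x) = \<tau> x" if "x \<in> pts X" for x
    using that l[OF gmaps_closed[OF n that]] \<zeta>n[OF that] gmaps_closed[OF f that]
    by (simp add: s_def fibre_def)
  have \<theta>inj: "u = u'" if "u \<in> pts P" "u' \<in> pts P" "\<theta> u = \<theta> u'" for u u'
    using \<theta> that by (auto simp: gset_isos_def bij_betw_def inj_on_def)
  \<comment> \<open>A point of \<open>Z\<close> lying over \<open>m y\<close> is a pair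
    \<open>(x, s y)\<close> with \<open>f x = y\<close>, so it is determined by
    \<open>x\<close>.\<close>
  have "is_pullback G Z P X Y \<rho> m n f"
  proof (rule pullbackI[OF Z P X Y \<rho>m m n f])
    fix x assume x: "x \<in> pts X"
    then show "\<rho> (n x) = m (f x)"
      using gmaps_closed[OF n] gmaps_closed[OF f] gmaps_closed[OF m] gmaps_closed[OF \<rho>m] \<rho> \<zeta>n \<theta>m
      by (intro \<theta>inj) auto
  next
    fix x x' assume x: "x \<in> pts X" "x' \<in> pts X" and eq: "n x = n x'"
    have "(x, s (f x)) = \<zeta> (n x')" by (simp only: \<zeta>n[OF x(1), symmetric] eq)
    also have "\<dots> = (x', s (f x'))" by (rule \<zeta>n[OF x(2)])
    finally show "x = x'" by simp
  next
    fix z y assume z: "z \<in> pts Z" and y: "y \<in> pts Y" and eq: "\<rho> z = m y"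
    obtain x u where xu: "\<zeta> z = (x, u)" by (cases "\<zeta> z")
    have zcl: "(x, u) \<in> pts ?Z"
      using gmaps_closed[of \<zeta> G Z ?Z z] z \<zeta> xu by (simp add: gset_isos_def)
    have u: "u = s y" using \<rho>[OF z] xu eq \<theta>m[OF y] by simp
    have x: "x \<in> pts X" "f x = y" using zcl u y by (auto simp: exp_Z_def s_def)
    have "n x = z"
      using \<zeta>'(3)[OF z] x u xu by (simp add: n_def compose_def r_def)
    with x show "\<exists>x\<in>pts X. n x = z \<and> f x = y" by blast
  qed
  with m n ln \<theta>m that show thesis by (simp add: s_def)
qed

end


section \<open>The ring structure of a Tambara functor\<close>

locale tambara = group G for G :: "('g, 'm) monoid_scheme" (structure) +
  fixes T :: "('g, 'x, 't) tambara_data"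
  assumes tambara: "tambara_functor G T"
    and infinite_points: "infinite (UNIV :: 'x set)"
begin

text \<open>The additive and the multiplicative structure instantiate one locale with the same
  restriction maps; facts about \<open>res\<close> alone may thus be taken from either copy.\<close>

sublocale add: semi_mackey_functor G "val T" "res T" "tr T"
  using tambara infinite_points
  by unfold_locales (auto simp: tambara_functor_def mackey_def)

sublocale mul: semi_mackey_functor G "val T" "res T" "nm T"
  using tambara infinite_points
  by unfold_locales (auto simp: tambara_functor_def)

lemma nm_tr:
  assumes "is_exponential G A X Y P Z p f \<pi> \<rho> l" "t \<in> val T A"
  shows "nm T X Y f (tr T A X p t) = tr T P Y \<pi> (nm T Z P \<rho> (res T Z A l t))"
proof -
  have "\<forall>A X Y P Z p f \<pi> \<rho> l. is_exponential G A X Y P Z p f \<pi> \<rho> l \<longrightarrow>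
       (\<forall>t\<in>val T A. nm T X Y f (tr T A X p t) = tr T P Y \<pi> (nm T Z P \<rho> (res T Z A l t)))"
    using tambara unfolding tambara_functor_def by (elim conjE)
  from this[rule_format, OF assms] show ?thesis .
qed

text \<open>For the folding map \<open>f : X \<amalg> X \<rightarrow> X\<close> and the obvious \<open>p : X \<amalg> (X \<amalg> X) \<rightarrow> X \<amalg> X\<close>, the base \<open>P\<close> of the
  exponential diagram is \<open>X \<amalg> X\<close>, its two inclusions being given by the two sections of \<open>p\<close>.\<close>

lemma distrib:
  assumes X: "fin_gset G X" and a: "a \<in> val T X" and b: "b \<in> val T X" and c: "c \<in> val T X"
  shows "mul.fop X a (add.fop X b c) = add.fop X (mul.fop X a b) (mul.fop X a c)"
proof -
  obtain W \<iota> d where W: "is_coproduct G 2 (\<lambda>_. X) W \<iota>" and d: "d \<in> gmaps G W X"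
    "\<And>i x. i < 2 \<Longrightarrow> x \<in> pts X \<Longrightarrow> d (\<iota> i x) = x" using add.folding_exists[OF X] by blast
  have fW: "fin_gset G W" and \<iota>: "\<And>i. i < 2 \<Longrightarrow> \<iota> i \<in> gmaps G X W"
    using W by (auto simp: is_coproduct_def)
  have \<iota>0: "\<iota> 0 \<in> gmaps G X W" and \<iota>1: "\<iota> 1 \<in> gmaps G X W" using \<iota> by auto
  have exW: "\<exists>i x. i < 2 \<and> x \<in> pts X \<and> z = \<iota> i x" if "z \<in> pts W" for z
    using add.coproduct_cover[OF W] that by blast
  have \<iota>inj: "i = i' \<and> x = x'" if "\<iota> i x = \<iota> i' x'" "i < 2" "i' < 2" "x \<in> pts X" "x' \<in> pts X" for i i' x x'
    using W that by (auto simp: is_coproduct_def bij_betw_def inj_on_def)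
  obtain A k where A: "is_coproduct G 3 (\<lambda>_. X) A k"
    using coproduct_exists[OF is_group infinite_points, of 3 "\<lambda>_. X"] X by blast
  have fA: "fin_gset G A" and k: "\<And>i. i < 3 \<Longrightarrow> k i \<in> gmaps G X A"
    using A by (auto simp: is_coproduct_def)
  have exA: "\<exists>i x. i < 3 \<and> x \<in> pts X \<and> z = k i x" if "z \<in> pts A" for z
    using add.coproduct_cover[OF A] that by blast
  have kinj: "i = i' \<and> x = x'" if "k i x = k i' x'" "i < 3" "i' < 3" "x \<in> pts X" "x' \<in> pts X" for i i' x x'
    using A that by (auto simp: is_coproduct_def bij_betw_def inj_on_def)
  have aX: "is_action G X" using add.fin_action[OF X] .
  have "\<iota> (if i = 0 then 0 else 1) \<in> gmaps G X W" for i :: nat using \<iota>0 \<iota>1 by simp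
  \<comment> \<open>\<open>p\<close> is the identity on the summand \<open>0\<close> and folds the
    summands \<open>1\<close> and \<open>2\<close> onto the second copy in \<open>W\<close>.\<close>
  then obtain p where p: "p \<in> gmaps G A W"
    and pk: "\<And>i x. i < 3 \<Longrightarrow> x \<in> pts X \<Longrightarrow> p (k i x) = \<iota> (if i = 0 then 0 else 1) x"
    using coproduct_map[OF A, of "\<lambda>i. \<iota> (if i = 0 then 0 else 1)" W] aX by blast
  \<comment> \<open>The element \<open>t\<close> over the three summands is prescribed so that its
    transfer along \<open>p\<close> restricts to \<open>a\<close> on one copy and to
    \<open>b + c\<close> on the other.\<close>
  define ts where "ts = (\<lambda>i::nat. if i = 0 then a else if i = 1 then b else c)"
  have "ts i \<in> val T X" for i using a b c by (simp add: ts_def)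
  then obtain t where t: "t \<in> val T A" and tk: "\<And>i. i < 3 \<Longrightarrow> res T X A (k i) t = ts i"
    using add.coproduct_surj[OF A, of ts] by blast
  let ?s = "tr T A W p t"
  have s: "?s \<in> val T W" by (rule add.low_closed[OF fA fW p t])
  have k0: "k 0 \<in> gmaps G X A" using k by simp
  have "res T X W (\<iota> 0) ?s = tr T X X (\<lambda>x\<in>pts X. x) (res T X A (k 0) t)"
  proof (rule add.pullback[OF pullbackI[OF fA fW X X p \<iota>0 k0 gmaps_id[OF aX]] t])
    fix x assume "x \<in> pts X"
    then show "p (k 0 x) = \<iota> 0 ((\<lambda>x\<in>pts X. x) x)" using pk[of 0] by simp
  next
    fix z x assume z: "z \<in> pts A" and x: "x \<in> pts X" and eq: "p z = \<iota> 0 x"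
    obtain i y where i: "i < 3" "y \<in> pts X" "z = k i y" using exA[OF z] by blast
    then have "\<iota> (if i = 0 then 0 else 1) y = \<iota> 0 x" using pk eq by simp
    then have "(if i = 0 then 0 else 1) = (0::nat) \<and> y = x"
      by (rule \<iota>inj) (use i x in auto)
    then show "\<exists>u\<in>pts X. k 0 u = z \<and> (\<lambda>x\<in>pts X. x) u = x"
      using i by (auto split: if_splits)
  qed simp
  then have s0: "res T X W (\<iota> 0) ?s = a"
    using tk[of 0] a add.low_id[OF X a] by (simp add: ts_def)
  \<comment> \<open>The preimage of the second copy under \<open>p\<close> consists of the summands
    \<open>1\<close> and \<open>2\<close>; hence the index shift by one in
    \<open>\<xi>\<close>.\<close>
  have "k (Suc i) \<in> gmaps G X A" if "i < 2" for i using k[of "Suc i"] that by simp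
  then obtain \<xi> where \<xi>: "\<xi> \<in> gmaps G W A"
    and \<xi>\<iota>: "\<And>i x. i < 2 \<Longrightarrow> x \<in> pts X \<Longrightarrow> \<xi> (\<iota> i x) = k (Suc i) x"
    using coproduct_map[OF W, of "\<lambda>i. k (Suc i)" A] aX by blast
  have "res T X W (\<iota> 1) ?s = tr T W X d (res T W A \<xi> t)"
  proof (rule add.pullback[OF pullbackI[OF fA fW fW X p \<iota>1 \<xi> d(1)] t])
    fix z assume "z \<in> pts W"
    then obtain i x where "i < 2" "x \<in> pts X" "z = \<iota> i x" using exW by blast
    then show "p (\<xi> z) = \<iota> 1 (d z)" using pk[of "Suc i"] \<xi>\<iota> d(2) by simp
  next
    fix z z' assume z: "z \<in> pts W" "z' \<in> pts W" and eq: "\<xi> z = \<xi> z'"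
    obtain i x where i: "i < 2" "x \<in> pts X" "z = \<iota> i x" using exW z(1) by blast
    obtain i' x' where i': "i' < 2" "x' \<in> pts X" "z' = \<iota> i' x'" using exW z(2) by blast
    have "Suc i = Suc i' \<and> x = x'"
      by (rule kinj) (use eq i i' \<xi>\<iota> in auto)
    then show "z = z'" using i i' by simp
  next
    fix z x assume z: "z \<in> pts A" and x: "x \<in> pts X" and eq: "p z = \<iota> 1 x"
    obtain i y where i: "i < 3" "y \<in> pts X" "z = k i y" using exA[OF z] by blast
    then have "\<iota> (if i = 0 then 0 else 1) y = \<iota> 1 x" using pk eq by simp
    then have iy: "(if i = 0 then 0 else 1) = (1::nat) \<and> y = x"
      by (rule \<iota>inj) (use i x in auto)
    then have i1: "i - 1 < 2" "Suc (i - 1) = i" using i by (auto split: if_splits)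
    show "\<exists>u\<in>pts W. \<xi> u = z \<and> d u = x"
      using i iy x \<xi>\<iota>[OF i1(1) x] d(2)[OF i1(1) x] i1 gmaps_closed[OF \<iota>[OF i1(1)] x]
      by (intro bexI[of _ "\<iota> (i - 1) x"]) auto
  qed
  also have "\<dots> = add.fop X (res T X W (\<iota> 0) (res T W A \<xi> t)) (res T X W (\<iota> 1) (res T W A \<xi> t))"
    using add.fop_eq[OF W d add.up_closed[OF fW fA \<xi> t]] by simp
  also have "res T X W (\<iota> 0) (res T W A \<xi> t) = res T X A (k 1) t"
    by (rule add.up_comp[OF X fW fA \<iota>0 \<xi> _ _ t]) (use \<xi>\<iota>[of 0] k in auto)
  also have "res T X W (\<iota> 1) (res T W A \<xi> t) = res T X A (k 2) t"
    by (rule add.up_comp[OF X fW fA \<iota>1 \<xi> _ _ t]) (use \<xi>\<iota>[of 1] k in \<open>auto simp: numeral_2_eq_2\<close>)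
  finally have s1: "res T X W (\<iota> 1) ?s = add.fop X b c"
    using tk by (simp add: ts_def)
  \<comment> \<open>The norm along the folding map multiplies the two restrictions, so the product
    is a norm of a transfer, ready for the exponential formula.\<close>
  have lhs: "mul.fop X a (add.fop X b c) = nm T W X d ?s"
    using mul.fop_eq[OF W d s] s0 s1 by simp
  obtain P Z \<pi> \<rho> l \<theta> \<zeta> where E: "is_exponential G A W X P Z p d \<pi> \<rho> l"
    and \<theta>: "\<theta> \<in> gset_isos G P (exp_Pi G A W X p d)" and \<zeta>: "\<zeta> \<in> gset_isos G Z (exp_Z G A W X p d)"
    and \<pi>: "\<And>u. u \<in> pts P \<Longrightarrow> \<pi> u = fst (\<theta> u)" and \<rho>: "\<And>z. z \<in> pts Z \<Longrightarrow> \<theta> (\<rho> z) = snd (\<zeta> z)"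
    and l: "\<And>z. z \<in> pts Z \<Longrightarrow> l z = snd (snd (\<zeta> z)) (fst (\<zeta> z))"
    using exponential_exists[OF is_group fA fW X p d(1) infinite_points] by blast
  have P: "fin_gset G P" and Z: "fin_gset G Z" and \<pi>m: "\<pi> \<in> gmaps G P X"
    and \<rho>m: "\<rho> \<in> gmaps G Z P" and lm: "l \<in> gmaps G Z A"
    using E by (auto simp: is_exponential_def)
  have \<theta>m: "\<theta> \<in> gmaps G P (exp_Pi G A W X p d)" "inj_on \<theta> (pts P)"
    using \<theta> by (auto simp: gset_isos_def bij_betw_def)
  let ?w = "nm T Z P \<rho> (res T Z A l t)"
  have lt: "res T Z A l t \<in> val T Z" by (rule add.up_closed[OF Z fA lm t])
  have w: "?w \<in> val T P" by (rule mul.low_closed[OF Z P \<rho>m lt])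
  \<comment> \<open>For \<open>j = 1, 2\<close> the section \<open>\<tau>\<close> of
    \<open>p\<close> takes the summand \<open>j\<close> over the second copy. It yields
    \<open>m : X \<rightarrow> P\<close>, and base change along \<open>m\<close> turns
    \<open>?w\<close> into the norm of the restriction of \<open>t\<close> along
    \<open>\<tau>\<close>, which is the product of \<open>a\<close> and \<open>ts j\<close>.\<close>
  have "\<exists>m \<tau>. m \<in> gmaps G X P \<and> (\<forall>x\<in>pts X. \<theta> (m x) = (x, restrict \<tau> (fibre W d x))) \<and>
     (\<forall>i<2. \<forall>x\<in>pts X. \<tau> (\<iota> i x) = k (if i = 0 then 0 else j) x) \<and>
     res T X P m ?w = mul.fop X a (ts j)" if j: "j \<in> {1, 2}" for j
  proof -
    have j3: "j < 3" using j by auto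
    have "k (if i = 0 then 0 else j) \<in> gmaps G X A" for i :: nat using k[OF j3] k0 by simp
    then obtain \<tau> where \<tau>: "\<tau> \<in> gmaps G W A"
      and \<tau>\<iota>: "\<And>i x. i < 2 \<Longrightarrow> x \<in> pts X \<Longrightarrow> \<tau> (\<iota> i x) = k (if i = 0 then 0 else j) x"
      using coproduct_map[OF W, of "\<lambda>i. k (if i = 0 then 0 else j)" A] aX by blast
    have p\<tau>: "p (\<tau> z) = z" if z: "z \<in> pts W" for z
    proof -
      obtain i x where i: "i < 2" "x \<in> pts X" "z = \<iota> i x" using exW[OF z] by blast
      have "(if i = 0 then 0 else j) < 3" using j3 by simp
      from pk[OF this i(2)] show ?thesis using \<tau>\<iota>[OF i(1,2)] i j
        by (auto simp: less_2_cases_iff)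
    qed
    obtain m n where m: "m \<in> gmaps G X P" and n: "n \<in> gmaps G W Z"
      and \<theta>m: "\<And>y. y \<in> pts X \<Longrightarrow> \<theta> (m y) = (y, restrict \<tau> (fibre W d y))"
      and ln: "\<And>x. x \<in> pts W \<Longrightarrow> l (n x) = \<tau> x" and pb: "is_pullback G Z P W X \<rho> m n d"
      using exponential_section[OF is_group fA fW X p d(1) E \<theta> \<zeta> \<rho> l \<tau> p\<tau>] by blast
    have \<tau>t: "res T W A \<tau> t \<in> val T W" by (rule add.up_closed[OF fW fA \<tau> t])
    have "res T X P m ?w = nm T W X d (res T W Z n (res T Z A l t))"
      by (rule mul.pullback[OF pb lt])
    also have "res T W Z n (res T Z A l t) = res T W A \<tau> t"
      by (rule add.up_comp[OF fW Z fA n lm \<tau> _ t]) (simp add: ln)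
    also have "nm T W X d (res T W A \<tau> t) =
        mul.fop X (res T X W (\<iota> 0) (res T W A \<tau> t)) (res T X W (\<iota> 1) (res T W A \<tau> t))"
      using mul.fop_eq[OF W d \<tau>t] by simp
    also have "res T X W (\<iota> 0) (res T W A \<tau> t) = res T X A (k 0) t"
      by (rule add.up_comp[OF X fW fA \<iota>0 \<tau> k0 _ t]) (simp add: \<tau>\<iota>)
    also have "res T X W (\<iota> 1) (res T W A \<tau> t) = res T X A (k j) t"
      by (rule add.up_comp[OF X fW fA \<iota>1 \<tau> k[OF j3] _ t]) (use \<tau>\<iota>[of 1] in simp)
    finally have "res T X P m ?w = mul.fop X a (ts j)" using tk[of 0] tk[OF j3] by (simp add: ts_def)
    with m \<theta>m \<tau>\<iota> show ?thesis by blast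
  qed
  from this[of 1] this[of 2] obtain m1 \<tau>1 m2 \<tau>2 where
    m1: "m1 \<in> gmaps G X P" "\<And>x. x \<in> pts X \<Longrightarrow> \<theta> (m1 x) = (x, restrict \<tau>1 (fibre W d x))"
      "\<And>i x. i < 2 \<Longrightarrow> x \<in> pts X \<Longrightarrow> \<tau>1 (\<iota> i x) = k (if i = 0 then 0 else 1) x"
      "res T X P m1 ?w = mul.fop X a b"
    and m2: "m2 \<in> gmaps G X P" "\<And>x. x \<in> pts X \<Longrightarrow> \<theta> (m2 x) = (x, restrict \<tau>2 (fibre W d x))"
      "\<And>i x. i < 2 \<Longrightarrow> x \<in> pts X \<Longrightarrow> \<tau>2 (\<iota> i x) = k (if i = 0 then 0 else 2) x"
      "res T X P m2 ?w = mul.fop X a c"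
    by (auto simp: ts_def)
  \<comment> \<open>The fibre of the folding map has the two points \<open>\<iota> 0 x\<close> and
    \<open>\<iota> 1 x\<close>, so a point of \<open>P\<close> over \<open>x\<close> is given by two
    values.\<close>
  have fib: "fibre W d x = {\<iota> 0 x, \<iota> 1 x}" if x: "x \<in> pts X" for x
  proof (intro equalityI subsetI)
    fix z assume "z \<in> fibre W d x"
    then have z: "z \<in> pts W" "d z = x" by (auto simp: fibre_def)
    obtain i y where i: "i < 2" "y \<in> pts X" "z = \<iota> i y" using exW[OF z(1)] by blast
    then have "y = x" using z d(2) by simp
    then show "z \<in> {\<iota> 0 x, \<iota> 1 x}" using i by (auto simp: less_2_cases_iff)
  qed (use x d(2) gmaps_closed[OF \<iota>0 x] gmaps_closed[OF \<iota>1 x] in \<open>auto simp: fibre_def\<close>)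
  have m12: "m1 x \<noteq> m2 y" if x: "x \<in> pts X" and y: "y \<in> pts X" for x y
  proof
    assume "m1 x = m2 y"
    then have "(x, restrict \<tau>1 (fibre W d x)) = (y, restrict \<tau>2 (fibre W d y))"
      by (simp only: m1(2)[OF x, symmetric] m2(2)[OF y, symmetric])
    then have eq: "restrict \<tau>1 (fibre W d x) = restrict \<tau>2 (fibre W d x)" by auto
    have "\<tau>1 (\<iota> 1 x) = \<tau>2 (\<iota> 1 x)" using fun_cong[OF eq, of "\<iota> 1 x"] fib[OF x] by simp
    then have "k 1 x = k 2 x" using m1(3)[of 1 x] m2(3)[of 1 x] x by simp
    then have "(1::nat) = 2 \<and> x = x" by (rule kinj) (use x in auto)
    then show False by simp
  qed
  \<comment> \<open>The value at \<open>\<iota> 0 x\<close> must be \<open>k 0 x\<close>, while the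
    value at \<open>\<iota> 1 x\<close> can only be \<open>k 1 x\<close> or \<open>k 2 x\<close>;
    these two cases are the images of \<open>m1\<close> and \<open>m2\<close>.\<close>
  have cover: "u \<in> m1 ` pts X \<union> m2 ` pts X" if u: "u \<in> pts P" for u
  proof -
    obtain x \<sigma> where x\<sigma>: "\<theta> u = (x, \<sigma>)" by (cases "\<theta> u")
    have "(x, \<sigma>) \<in> pts (exp_Pi G A W X p d)" using gmaps_closed[OF \<theta>m(1) u] x\<sigma> by simp
    then have x: "x \<in> pts X" and \<sigma>: "\<sigma> \<in> fibre W d x \<rightarrow>\<^sub>E pts A" "\<forall>z\<in>fibre W d x. p (\<sigma> z) = z"
      by (auto simp: exp_Pi_def)
    have val: "\<exists>i<3. \<sigma> (\<iota> j x) = k i x \<and> (if i = 0 then 0 else 1) = j" if j: "j < 2" for j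
    proof -
      have jf: "\<iota> j x \<in> fibre W d x" using j fib[OF x] by (auto simp: less_2_cases_iff)
      then have "\<sigma> (\<iota> j x) \<in> pts A" using \<sigma>(1) by auto
      then obtain i y where i: "i < 3" "y \<in> pts X" "\<sigma> (\<iota> j x) = k i y" using exA by blast
      have "\<iota> (if i = 0 then 0 else 1) y = \<iota> j x" using \<sigma>(2) jf i pk[OF i(1,2)] by force
      then have "(if i = 0 then 0 else 1) = j \<and> y = x" by (rule \<iota>inj) (use i x j in auto)
      with i show ?thesis by (intro exI[of _ i]) simp
    qed
    have \<sigma>0: "\<sigma> (\<iota> 0 x) = k 0 x" using val[of 0] by (auto split: if_splits)
    have \<sigma>1: "\<sigma> (\<iota> 1 x) = k 1 x \<or> \<sigma> (\<iota> 1 x) = k 2 x"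
    proof -
      obtain i where i: "i < 3" "\<sigma> (\<iota> 1 x) = k i x" "(if i = 0 then 0 else 1) = (1::nat)"
        using val[of 1] by auto
      have "i \<noteq> 0" using i(3) by (cases i) auto
      then have "i = 1 \<or> i = 2" using i(1) by arith
      then show ?thesis using i(2) by blast
    qed
    have inj: "u = v" if "v \<in> pts P" "\<theta> v = \<theta> u" for v
      using inj_onD[OF \<theta>m(2) that(2) that(1) u] by simp
    have \<sigma>eq: "\<sigma> = restrict \<tau> (fibre W d x)" if "\<tau> (\<iota> 0 x) = \<sigma> (\<iota> 0 x)" "\<tau> (\<iota> 1 x) = \<sigma> (\<iota> 1 x)" for \<tau>
      using that \<sigma>(1) fib[OF x] by (intro extensionalityI[where A = "fibre W d x"]) (auto simp: PiE_def)
    show ?thesis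
      using \<sigma>1
    proof
      assume "\<sigma> (\<iota> 1 x) = k 1 x"
      then have "\<sigma> = restrict \<tau>1 (fibre W d x)" using \<sigma>0 m1(3)[of 0 x] m1(3)[of 1 x] x by (intro \<sigma>eq) auto
      then have "u = m1 x" using x\<sigma> m1(2)[OF x] by (intro inj gmaps_closed[OF m1(1) x]) simp
      with x show ?thesis by blast
    next
      assume "\<sigma> (\<iota> 1 x) = k 2 x"
      then have "\<sigma> = restrict \<tau>2 (fibre W d x)" using \<sigma>0 m2(3)[of 0 x] m2(3)[of 1 x] x by (intro \<sigma>eq) auto
      then have "u = m2 x" using x\<sigma> m2(2)[OF x] by (intro inj gmaps_closed[OF m2(1) x]) simp
      with x show ?thesis by blast
    qed
  qed
  have \<pi>m1: "\<pi> (m1 x) = x" and \<pi>m2: "\<pi> (m2 x) = x" if x: "x \<in> pts X" for x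
    using \<pi>[OF gmaps_closed[OF m1(1) x]] \<pi>[OF gmaps_closed[OF m2(1) x]] m1(2)[OF x] m2(2)[OF x] by auto
  define m where "m = (\<lambda>i::nat. if i = 0 then m1 else m2)"
  have \<pi>mi: "\<pi> (m i x) = x" if "x \<in> pts X" for i x using that \<pi>m1 \<pi>m2 by (simp add: m_def)
  \<comment> \<open>With the inclusions \<open>m1\<close> and \<open>m2\<close>, the map
    \<open>\<pi>\<close> is the folding map of \<open>P\<close>, so the transfer along it adds the
    two products.\<close>
  have "is_coproduct G 2 (\<lambda>_. X) P m"
  proof -
    have "inj_on (\<lambda>(i, x). m i x) ({..<2} \<times> pts X)"
    proof (rule inj_onI, clarify)
      fix i x i' x' assume i: "i < (2::nat)" "i' < (2::nat)" and x: "x \<in> pts X" "x' \<in> pts X"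
        and eq: "m i x = m i' x'"
      have "x = x'" using arg_cong[OF eq, of \<pi>] \<pi>mi x by simp
      moreover have "i = i'"
        using eq m12 x i by (auto simp: m_def less_2_cases_iff split: if_splits) (metis m12)
      ultimately show "i = i' \<and> x = x'" by simp
    qed
    moreover have "(\<lambda>(i, x). m i x) ` ({..<2} \<times> pts X) = pts P"
    proof (intro equalityI subsetI)
      fix u assume "u \<in> pts P"
      from cover[OF this] show "u \<in> (\<lambda>(i, x). m i x) ` ({..<2} \<times> pts X)"
      proof
        assume "u \<in> m1 ` pts X"
        then obtain x where "x \<in> pts X" "u = m1 x" by blast
        then show ?thesis by (intro image_eqI[of _ _ "(0, x)"]) (auto simp: m_def)
      next
        assume "u \<in> m2 ` pts X"
        then obtain x where "x \<in> pts X" "u = m2 x" by blast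
        then show ?thesis by (intro image_eqI[of _ _ "(1, x)"]) (auto simp: m_def)
      qed
    qed (use gmaps_closed[OF m1(1)] gmaps_closed[OF m2(1)] in \<open>auto simp: m_def\<close>)
    ultimately show ?thesis
      using X P m1(1) m2(1) by (simp add: is_coproduct_def bij_betw_def m_def)
  qed
  from add.fop_eq[OF this \<pi>m \<pi>mi w] have "add.fop X (mul.fop X a b) (mul.fop X a c) = tr T P X \<pi> ?w"
    using m1(4) m2(4) by (simp add: m_def)
  then show ?thesis using lhs nm_tr[OF E t] by simp
qed

lemma tring_simps [simp]:
  "carrier (tring G T X) = val T X"
  "x \<otimes>\<^bsub>tring G T X\<^esub> y = mul.fop X x y"
  "x \<oplus>\<^bsub>tring G T X\<^esub> y = add.fop X x y"
  "\<zero>\<^bsub>tring G T X\<^esub> = add.funit X"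
  "\<one>\<^bsub>tring G T X\<^esub> = mul.funit X"
  by (simp_all add: tring_def)

text \<open>The additive group is part of the Mackey axiom; the multiplicative monoid comes from the
  folding laws and the link between the two from \<open>distrib\<close>.\<close>

lemma tring_cring:
  assumes X: "fin_gset G X"
  shows "cring (tring G T X)"
proof (rule cringI)
  have "comm_group \<lparr>carrier = val T X, mult = add.fop X, one = add.funit X\<rparr>"
    using tambara X by (simp add: tambara_functor_def mackey_def)
  moreover have "add_monoid (tring G T X) = \<lparr>carrier = val T X, mult = add.fop X, one = add.funit X\<rparr>"
    by (simp add: tring_def)
  ultimately have "comm_group (add_monoid (tring G T X))" by simp
  then show "abelian_group (tring G T X)"
    by (simp add: abelian_group_def abelian_group_axioms_def abelian_monoid_def comm_group_def)
  show "comm_monoid (tring G T X)"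
    by (rule comm_monoidI)
      (use mul.fop_closed[OF X] mul.funit_closed[OF X] mul.fop_assoc[OF X] mul.fop_unit[OF X] mul.fop_comm[OF X]
        in auto)
  show "(x \<oplus>\<^bsub>tring G T X\<^esub> y) \<otimes>\<^bsub>tring G T X\<^esub> z =
      x \<otimes>\<^bsub>tring G T X\<^esub> z \<oplus>\<^bsub>tring G T X\<^esub> y \<otimes>\<^bsub>tring G T X\<^esub> z"
    if "x \<in> carrier (tring G T X)" "y \<in> carrier (tring G T X)" "z \<in> carrier (tring G T X)" for x y z
    using that distrib[OF X] mul.fop_comm[OF X] add.fop_closed[OF X] by simp
qed

lemma tring_ring: "fin_gset G X \<Longrightarrow> ring (tring G T X)"
  using tring_cring by (simp add: cring_def)

end


section \<open>Images of Tambara functors and congruences modulo ideals\<close>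

text \<open>The premise \<open>inj\<close> is left open because its two uses need different
  arguments: for quotients a difference is rebuilt from transfers, for images injectivity is
  borrowed from the target functor.\<close>

lemma semi_mackey_image:
  fixes q :: "('g, 'x) gset \<Rightarrow> 't \<Rightarrow> 'u"
  assumes M: "semi_mackey_functor G M Mup Mlow"
    and surj: "\<And>X. fin_gset G X \<Longrightarrow> q X ` M X = N X"
    and up: "\<And>X Y f m. fin_gset G X \<Longrightarrow> fin_gset G Y \<Longrightarrow> f \<in> gmaps G X Y \<Longrightarrow> m \<in> M Y \<Longrightarrow>
      q X (Mup X Y f m) = Nup X Y f (q Y m)"
    and low: "\<And>X Y f m. fin_gset G X \<Longrightarrow> fin_gset G Y \<Longrightarrow> f \<in> gmaps G X Y \<Longrightarrow> m \<in> M X \<Longrightarrow>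
      q Y (Mlow X Y f m) = Nlow X Y f (q X m)"
    and inj: "\<And>n X W \<iota> w w'. is_coproduct G n X W \<iota> \<Longrightarrow> w \<in> M W \<Longrightarrow> w' \<in> M W \<Longrightarrow>
      (\<And>i. i < n \<Longrightarrow> q (X i) (Mup (X i) W (\<iota> i) w) = q (X i) (Mup (X i) W (\<iota> i) w')) \<Longrightarrow> q W w = q W w'"
  shows "semi_mackey G N Nup Nlow"
proof -
  interpret semi_mackey_functor G M Mup Mlow by (rule M)
  have qN: "q X m \<in> N X" if "fin_gset G X" "m \<in> M X" for X m using surj[OF that(1)] that(2) by blast
  have ex: "\<exists>m\<in>M X. c = q X m" if "fin_gset G X" "c \<in> N X" for X c using surj[OF that(1)] that(2) by blast
  show ?thesis
    unfolding semi_mackey_def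
  proof (intro conjI allI impI ballI; (elim conjE)?)
    fix X Y :: "('g, 'x) gset" and f
    assume X: "fin_gset G X" and Y: "fin_gset G Y" and f: "f \<in> gmaps G X Y"
    show "Nup X Y f \<in> N Y \<rightarrow> N X"
    proof
      fix c assume "c \<in> N Y"
      then obtain m where m: "m \<in> M Y" "c = q Y m" using ex[OF Y] by blast
      then show "Nup X Y f c \<in> N X" using up[OF X Y f m(1)] qN[OF X up_closed[OF X Y f m(1)]] by simp
    qed
    show "Nlow X Y f \<in> N X \<rightarrow> N Y"
    proof
      fix c assume "c \<in> N X"
      then obtain m where m: "m \<in> M X" "c = q X m" using ex[OF X] by blast
      then show "Nlow X Y f c \<in> N Y" using low[OF X Y f m(1)] qN[OF Y low_closed[OF X Y f m(1)]] by simp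
    qed
  next
    fix X :: "('g, 'x) gset" and c
    assume X: "fin_gset G X" and c: "c \<in> N X"
    obtain m where m: "m \<in> M X" "c = q X m" using ex[OF X c] by blast
    note id = gmaps_id[OF fin_action[OF X]]
    show "Nup X X (\<lambda>x\<in>pts X. x) c = c" using up[OF X X id m(1)] up_id[OF X m(1)] m(2) by simp
    show "Nlow X X (\<lambda>x\<in>pts X. x) c = c" using low[OF X X id m(1)] low_id[OF X m(1)] m(2) by simp
  next
    fix X Y Z :: "('g, 'x) gset" and f g c
    assume X: "fin_gset G X" and Y: "fin_gset G Y" and Z: "fin_gset G Z"
      and f: "f \<in> gmaps G X Y" and g: "g \<in> gmaps G Y Z" and c: "c \<in> N Z"
    obtain m where m: "m \<in> M Z" "c = q Z m" using ex[OF Z c] by blast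
    note gf = gmaps_compose[OF fin_action[OF X] f g]
    have "Nup X Z (compose (pts X) g f) c = q X (Mup X Y f (Mup Y Z g m))"
      using up[OF X Z gf m(1)] up_comp[OF X Y Z f g gf _ m(1)] m(2) by (simp add: compose_def)
    then show "Nup X Z (compose (pts X) g f) c = Nup X Y f (Nup Y Z g c)"
      using up[OF X Y f up_closed[OF Y Z g m(1)]] up[OF Y Z g m(1)] m(2) by simp
  next
    fix X Y Z :: "('g, 'x) gset" and f g c
    assume X: "fin_gset G X" and Y: "fin_gset G Y" and Z: "fin_gset G Z"
      and f: "f \<in> gmaps G X Y" and g: "g \<in> gmaps G Y Z" and c: "c \<in> N X"
    obtain m where m: "m \<in> M X" "c = q X m" using ex[OF X c] by blast
    note gf = gmaps_compose[OF fin_action[OF X] f g]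
    have "Nlow X Z (compose (pts X) g f) c = q Z (Mlow Y Z g (Mlow X Y f m))"
      using low[OF X Z gf m(1)] low_comp[OF X Y Z f g gf _ m(1)] m(2) by (simp add: compose_def)
    then show "Nlow X Z (compose (pts X) g f) c = Nlow Y Z g (Nlow X Y f c)"
      using low[OF Y Z g low_closed[OF X Y f m(1)]] low[OF X Y f m(1)] m(2) by simp
  next
    fix n W \<iota> and X :: "nat \<Rightarrow> ('g, 'x) gset"
    assume C: "is_coproduct G n X W \<iota>"
    have W: "fin_gset G W" and X: "\<And>i. i < n \<Longrightarrow> fin_gset G (X i)"
      and \<iota>: "\<And>i. i < n \<Longrightarrow> \<iota> i \<in> gmaps G (X i) W" using C by (auto simp: is_coproduct_def)
    let ?r = "\<lambda>w. \<lambda>i\<in>{..<n}. Nup (X i) W (\<iota> i) w"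
    have r: "Nup (X i) W (\<iota> i) (q W w) = q (X i) (Mup (X i) W (\<iota> i) w)" if "i < n" "w \<in> M W" for i w
      using up[OF X W \<iota>] that by simp
    show "bij_betw ?r (N W) (\<Pi>\<^sub>E i\<in>{..<n}. N (X i))"
    proof (rule bij_betw_imageI)
      show "inj_on ?r (N W)"
      proof (rule inj_onI)
        fix c c' assume c: "c \<in> N W" "c' \<in> N W" and eq: "?r c = ?r c'"
        obtain w where w: "w \<in> M W" "c = q W w" using ex[OF W c(1)] by blast
        obtain w' where w': "w' \<in> M W" "c' = q W w'" using ex[OF W c(2)] by blast
        have "q W w = q W w'"
        proof (rule inj[OF C w(1) w'(1)])
          fix i assume "i < n"
          with fun_cong[OF eq, of i]
          show "q (X i) (Mup (X i) W (\<iota> i) w) = q (X i) (Mup (X i) W (\<iota> i) w')"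
            using r w w' by simp
        qed
        with w w' show "c = c'" by simp
      qed
      show "?r ` N W = (\<Pi>\<^sub>E i\<in>{..<n}. N (X i))"
      proof (intro equalityI subsetI)
        fix s assume "s \<in> ?r ` N W"
        then obtain c where c: "c \<in> N W" "s = ?r c" by blast
        obtain w where w: "w \<in> M W" "c = q W w" using ex[OF W c(1)] by blast
        show "s \<in> (\<Pi>\<^sub>E i\<in>{..<n}. N (X i))"
          using c(2) w r qN[OF X up_closed[OF X W \<iota> w(1)]] by auto
      next
        fix s assume s: "s \<in> (\<Pi>\<^sub>E i\<in>{..<n}. N (X i))"
        \<comment> \<open>Surjectivity onto the product: representatives chosen on the summands are
          glued in \<open>M W\<close>, and the result is pushed forward by \<open>q\<close>.\<close>
        have "\<exists>m\<in>M (X i). s i = q (X i) m" if "i < n" for i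
          using ex[OF X[OF that]] s that by (auto simp: PiE_def)
        then obtain m where m: "\<And>i. i < n \<Longrightarrow> m i \<in> M (X i) \<and> s i = q (X i) (m i)" by metis
        then obtain w where w: "w \<in> M W" "\<And>i. i < n \<Longrightarrow> Mup (X i) W (\<iota> i) w = m i"
          using coproduct_surj[OF C, of m] by blast
        have "s = ?r (q W w)"
        proof (rule extensionalityI[where A = "{..<n}"])
          fix i assume "i \<in> {..<n}"
          then show "s i = ?r (q W w) i" using m r w by simp
        qed (use s in \<open>auto simp: PiE_def\<close>)
        then show "s \<in> ?r ` N W" using qN[OF W w(1)] by blast
      qed
    qed
  next
    fix X Y X' Y' :: "('g, 'x) gset" and f \<eta> \<xi> f' c
    assume pb: "is_pullback G X Y X' Y' f \<eta> \<xi> f'" and c: "c \<in> N X"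
    have X: "fin_gset G X" "fin_gset G Y" "fin_gset G X'" "fin_gset G Y'"
      and f: "f \<in> gmaps G X Y" "\<eta> \<in> gmaps G Y' Y" "\<xi> \<in> gmaps G X' X" "f' \<in> gmaps G X' Y'"
      using pb by (auto simp: is_pullback_def)
    obtain m where m: "m \<in> M X" "c = q X m" using ex[OF X(1) c] by blast
    have "Nup Y' Y \<eta> (Nlow X Y f c) = q Y' (Mup Y' Y \<eta> (Mlow X Y f m))"
      using up[OF X(4,2) f(2) low_closed[OF X(1,2) f(1) m(1)]] low[OF X(1,2) f(1) m(1)] m(2) by simp
    also have "\<dots> = q Y' (Mlow X' Y' f' (Mup X' X \<xi> m))" using pullback[OF pb m(1)] by simp
    also have "\<dots> = Nlow X' Y' f' (Nup X' X \<xi> c)"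
      using low[OF X(3,4) f(4) up_closed[OF X(3,1) f(3) m(1)]] up[OF X(3,1) f(3) m(1)] m(2) by simp
    finally show "Nup Y' Y \<eta> (Nlow X Y f c) = Nlow X' Y' f' (Nup X' X \<xi> c)" .
  qed
qed

text \<open>Operation and unit are built from \<open>Mup\<close> and \<open>Mlow\<close> alone, so a
  family commuting with these preserves them. This is why compatibility with the structure maps
  already makes each component a ring homomorphism.\<close>

lemma semi_mackey_hom:
  fixes q :: "('g, 'x) gset \<Rightarrow> 't \<Rightarrow> 'u"
  assumes M: "semi_mackey_functor G M Mup Mlow" and N: "semi_mackey_functor G N Nup Nlow"
    and qN: "\<And>X m. fin_gset G X \<Longrightarrow> m \<in> M X \<Longrightarrow> q X m \<in> N X"
    and up: "\<And>X Y f m. fin_gset G X \<Longrightarrow> fin_gset G Y \<Longrightarrow> f \<in> gmaps G X Y \<Longrightarrow> m \<in> M Y \<Longrightarrow>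
      q X (Mup X Y f m) = Nup X Y f (q Y m)"
    and low: "\<And>X Y f m. fin_gset G X \<Longrightarrow> fin_gset G Y \<Longrightarrow> f \<in> gmaps G X Y \<Longrightarrow> m \<in> M X \<Longrightarrow>
      q Y (Mlow X Y f m) = Nlow X Y f (q X m)"
    and X: "fin_gset G X"
  shows "a \<in> M X \<Longrightarrow> b \<in> M X \<Longrightarrow>
      q X (fold_op G M Mup Mlow X a b) = fold_op G N Nup Nlow X (q X a) (q X b)"
    and "q X (fold_unit G M Mlow X) = fold_unit G N Nlow X"
proof -
  interpret M: semi_mackey_functor G M Mup Mlow by (rule M)
  interpret N: semi_mackey_functor G N Nup Nlow by (rule N)
  {
    assume a: "a \<in> M X" "b \<in> M X"
    obtain W \<iota> d where W: "is_coproduct G 2 (\<lambda>_. X) W \<iota>" and d: "d \<in> gmaps G W X"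
      "\<And>i x. i < 2 \<Longrightarrow> x \<in> pts X \<Longrightarrow> d (\<iota> i x) = x" using M.folding_exists[OF X] by blast
    obtain w where w: "w \<in> M W" "Mup X W (\<iota> 0) w = a" "Mup X W (\<iota> 1) w = b"
      using M.folding_lift[OF W a] by blast
    have fW: "fin_gset G W" and \<iota>: "\<iota> 0 \<in> gmaps G X W" "\<iota> 1 \<in> gmaps G X W"
      using W by (auto simp: is_coproduct_def)
    show "q X (M.fop X a b) = N.fop X (q X a) (q X b)"
      using M.fop_eq[OF W d w(1)] N.fop_eq[OF W d qN[OF fW w(1)]] w low[OF fW X d(1) w(1)]
        up[OF X fW \<iota>(1) w(1)] up[OF X fW \<iota>(2) w(1)] by simp
  }
  obtain w where w: "w \<in> M \<lparr>pts = {}, act = \<lambda>_ _. undefined\<rparr>"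
    using M.empty_gset_value[OF M.empty_gset] by auto
  have e: "(\<lambda>_. undefined) \<in> gmaps G \<lparr>pts = {}, act = \<lambda>_ _. undefined\<rparr> X"
    by (rule M.empty_gmap) simp
  show "q X (M.funit X) = N.funit X"
    using M.funit_eq[OF X M.empty_gset _ e w] N.funit_eq[OF X M.empty_gset _ e qN[OF M.empty_gset w]]
      low[OF M.empty_gset X e w] by simp
qed

lemma tambara_morphismI:
  assumes T: "tambara G T" and S: "tambara G S"
    and val: "\<And>X t. fin_gset G X \<Longrightarrow> t \<in> val T X \<Longrightarrow> q X t \<in> val S X"
    and res: "\<And>X Y f t. fin_gset G X \<Longrightarrow> fin_gset G Y \<Longrightarrow> f \<in> gmaps G X Y \<Longrightarrow> t \<in> val T Y \<Longrightarrow>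
      q X (res T X Y f t) = res S X Y f (q Y t)"
    and tr: "\<And>X Y f t. fin_gset G X \<Longrightarrow> fin_gset G Y \<Longrightarrow> f \<in> gmaps G X Y \<Longrightarrow> t \<in> val T X \<Longrightarrow>
      q Y (tr T X Y f t) = tr S X Y f (q X t)"
    and nm: "\<And>X Y f t. fin_gset G X \<Longrightarrow> fin_gset G Y \<Longrightarrow> f \<in> gmaps G X Y \<Longrightarrow> t \<in> val T X \<Longrightarrow>
      q Y (nm T X Y f t) = nm S X Y f (q X t)"
  shows "tambara_morphism G T S q"
proof -
  interpret T: tambara G T by (rule T)
  interpret S: tambara G S by (rule S)
  have "q X \<in> ring_hom (tring G T X) (tring G S X)" if X: "fin_gset G X" for X
  proof (rule ring_hom_memI)
    fix a b assume "a \<in> carrier (tring G T X)" "b \<in> carrier (tring G T X)"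
    then have a: "a \<in> val T X" and b: "b \<in> val T X" by simp_all
    have "q X (T.mul.fop X a b) = S.mul.fop X (q X a) (q X b)"
      by (rule semi_mackey_hom(1)[OF T.mul.semi_mackey_functor_axioms S.mul.semi_mackey_functor_axioms val res nm X a b])
    then show "q X (a \<otimes>\<^bsub>tring G T X\<^esub> b) = q X a \<otimes>\<^bsub>tring G S X\<^esub> q X b" by simp
    have "q X (T.add.fop X a b) = S.add.fop X (q X a) (q X b)"
      by (rule semi_mackey_hom(1)[OF T.add.semi_mackey_functor_axioms S.add.semi_mackey_functor_axioms val res tr X a b])
    then show "q X (a \<oplus>\<^bsub>tring G T X\<^esub> b) = q X a \<oplus>\<^bsub>tring G S X\<^esub> q X b" by simp
  next
    have "q X (T.mul.funit X) = S.mul.funit X"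
      by (rule semi_mackey_hom(2)[OF T.mul.semi_mackey_functor_axioms S.mul.semi_mackey_functor_axioms val res nm X])
    then show "q X \<one>\<^bsub>tring G T X\<^esub> = \<one>\<^bsub>tring G S X\<^esub>" by simp
  qed (use val[OF X] in simp)
  then show ?thesis using res tr nm by (simp add: tambara_morphism_def)
qed

lemma tambara_image:
  fixes T :: "('g, 'x, 't) tambara_data" and S :: "('g, 'x, 's) tambara_data"
  assumes T: "tambara G T"
    and surj: "\<And>X. fin_gset G X \<Longrightarrow> q X ` val T X = val S X"
    and res: "\<And>X Y f t. fin_gset G X \<Longrightarrow> fin_gset G Y \<Longrightarrow> f \<in> gmaps G X Y \<Longrightarrow> t \<in> val T Y \<Longrightarrow>
      q X (res T X Y f t) = res S X Y f (q Y t)"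
    and tr: "\<And>X Y f t. fin_gset G X \<Longrightarrow> fin_gset G Y \<Longrightarrow> f \<in> gmaps G X Y \<Longrightarrow> t \<in> val T X \<Longrightarrow>
      q Y (tr T X Y f t) = tr S X Y f (q X t)"
    and nm: "\<And>X Y f t. fin_gset G X \<Longrightarrow> fin_gset G Y \<Longrightarrow> f \<in> gmaps G X Y \<Longrightarrow> t \<in> val T X \<Longrightarrow>
      q Y (nm T X Y f t) = nm S X Y f (q X t)"
    and inj: "\<And>n X W \<iota> w w'. is_coproduct G n X W \<iota> \<Longrightarrow> w \<in> val T W \<Longrightarrow> w' \<in> val T W \<Longrightarrow>
      (\<And>i. i < n \<Longrightarrow> q (X i) (res T (X i) W (\<iota> i) w) = q (X i) (res T (X i) W (\<iota> i) w')) \<Longrightarrow> q W w = q W w'"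
  shows "tambara G S" "tambara_morphism G T S q"
proof -
  interpret T: tambara G T by (rule T)
  have qS: "q X t \<in> val S X" if "fin_gset G X" "t \<in> val T X" for X t
    using surj[OF that(1)] that(2) by blast
  have add: "semi_mackey G (val S) (res S) (tr S)"
    by (rule semi_mackey_image[OF T.add.semi_mackey_functor_axioms surj res tr inj])
  have mul: "semi_mackey G (val S) (res S) (nm S)"
    by (rule semi_mackey_image[OF T.mul.semi_mackey_functor_axioms surj res nm inj])
  interpret S: semi_mackey_functor G "val S" "res S" "tr S"
    using add T.infinite_points by unfold_locales
  have "comm_group \<lparr>carrier = val S X, mult = S.fop X, one = S.funit X\<rparr>" if X: "fin_gset G X" for X
  proof (rule comm_groupI)
    fix s assume "s \<in> carrier \<lparr>carrier = val S X, mult = S.fop X, one = S.funit X\<rparr>"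
    then obtain t where t: "t \<in> val T X" "s = q X t" using surj[OF X] by auto
    \<comment> \<open>Additive inverses are not produced by the semi-Mackey axioms; they are pushed
      forward from \<open>T\<close>.\<close>
    interpret R: cring "tring G T X" by (rule T.tring_cring[OF X])
    have t': "\<ominus>\<^bsub>tring G T X\<^esub> t \<in> val T X" using R.a_inv_closed[of t] t(1) by simp
    have "T.add.fop X (\<ominus>\<^bsub>tring G T X\<^esub> t) t = T.add.funit X" using R.l_neg[of t] t(1) by simp
    moreover have "q X (T.add.fop X (\<ominus>\<^bsub>tring G T X\<^esub> t) t) = S.fop X (q X (\<ominus>\<^bsub>tring G T X\<^esub> t)) (q X t)"
      by (rule semi_mackey_hom(1)[OF T.add.semi_mackey_functor_axioms S.semi_mackey_functor_axioms qS res tr X t' t(1)])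
    moreover have "q X (T.add.funit X) = S.funit X"
      by (rule semi_mackey_hom(2)[OF T.add.semi_mackey_functor_axioms S.semi_mackey_functor_axioms qS res tr X])
    ultimately have "S.fop X (q X (\<ominus>\<^bsub>tring G T X\<^esub> t)) s = S.funit X"
      using t(2) by simp
    then show "\<exists>y\<in>carrier \<lparr>carrier = val S X, mult = S.fop X, one = S.funit X\<rparr>.
        y \<otimes>\<^bsub>\<lparr>carrier = val S X, mult = S.fop X, one = S.funit X\<rparr>\<^esub> s =
        \<one>\<^bsub>\<lparr>carrier = val S X, mult = S.fop X, one = S.funit X\<rparr>\<^esub>"
      using qS[OF X t'] by auto
  qed (use S.fop_closed[OF X] S.funit_closed[OF X] S.fop_assoc[OF X] S.fop_unit[OF X] S.fop_comm[OF X] in auto)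
  then have "mackey G (val S) (res S) (tr S)" using add by (simp add: mackey_def)
  moreover have "nm S X Y f (tr S A X p s) = tr S P Y \<pi> (nm S Z P \<rho> (res S Z A l s))"
    if E: "is_exponential G A X Y P Z p f \<pi> \<rho> l" and s: "s \<in> val S A" for A X Y P Z p f \<pi> \<rho> l s
  proof -
    have fin: "fin_gset G A" "fin_gset G X" "fin_gset G Y" "fin_gset G P" "fin_gset G Z"
      and maps: "p \<in> gmaps G A X" "f \<in> gmaps G X Y" "\<pi> \<in> gmaps G P Y" "\<rho> \<in> gmaps G Z P" "l \<in> gmaps G Z A"
      using E by (auto simp: is_exponential_def)
    obtain t where t: "t \<in> val T A" "s = q A t" using surj[OF fin(1)] s by blast
    note t1 = T.add.up_closed[OF fin(5,1) maps(5) t(1)]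
    note t2 = T.mul.low_closed[OF fin(5,4) maps(4) t1]
    show ?thesis
      using arg_cong[OF T.nm_tr[OF E t(1)], of "q Y"]
        nm[OF fin(2,3) maps(2) T.add.low_closed[OF fin(1,2) maps(1) t(1)]] tr[OF fin(1,2) maps(1) t(1)]
        tr[OF fin(4,3) maps(3) t2] nm[OF fin(5,4) maps(4) t1] res[OF fin(5,1) maps(5) t(1)] t(2)
      by simp
  qed
  ultimately have "tambara_functor G S" using mul by (simp add: tambara_functor_def)
  then show S': "tambara G S" using T.infinite_points by unfold_locales
  show "tambara_morphism G T S q" by (rule tambara_morphismI[OF T S' qS res tr nm])
qed

section \<open>Norms modulo an ideal\<close>

context tambara
begin

context
  fixes I assumes I: "tambara_ideal G T I"
begin

lemma ideal_I: "fin_gset G X \<Longrightarrow> ideal (I X) (tring G T X)"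
  using I by (simp add: tambara_ideal_def)

lemma ideal_subset: "fin_gset G X \<Longrightarrow> i \<in> I X \<Longrightarrow> i \<in> val T X"
  using additive_subgroup.a_subset[OF ideal.axioms(1)[OF ideal_I]] by auto

lemma ideal_maps:
  assumes "fin_gset G X" "fin_gset G Y" "f \<in> gmaps G X Y"
  shows "i \<in> I Y \<Longrightarrow> res T X Y f i \<in> I X" and "i \<in> I X \<Longrightarrow> tr T X Y f i \<in> I Y"
    and "i \<in> I X \<Longrightarrow> \<exists>j\<in>I Y. nm T X Y f i = add.fop Y (nm T X Y f (add.funit X)) j"
proof -
  have "res T X Y f ` I Y \<subseteq> I X \<and> tr T X Y f ` I X \<subseteq> I Y \<and>
       nm T X Y f ` I X \<subseteq> nm T X Y f \<zero>\<^bsub>tring G T X\<^esub> <+\<^bsub>tring G T Y\<^esub> I Y"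
    using I assms by (simp add: tambara_ideal_def)
  then show "i \<in> I Y \<Longrightarrow> res T X Y f i \<in> I X" "i \<in> I X \<Longrightarrow> tr T X Y f i \<in> I Y"
    "i \<in> I X \<Longrightarrow> \<exists>j\<in>I Y. nm T X Y f i = add.fop Y (nm T X Y f (add.funit X)) j"
    by (auto simp: a_l_coset_def' image_subset_iff)
qed

text \<open>Write \<open>t + i\<close> and \<open>t = t + 0\<close> as transfers along the same
  folding map \<open>d\<close>, so that one exponential diagram of \<open>d\<close> and
  \<open>f\<close> serves both. The two norms over \<open>Z\<close> then differ in a single factor,
  to which the ideal condition applies.\<close>

lemma nm_ideal:
  assumes X: "fin_gset G X" and Y: "fin_gset G Y" and f: "f \<in> gmaps G X Y"
    and t: "t \<in> val T X" and i: "i \<in> I X"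
  shows "\<exists>j\<in>I Y. nm T X Y f (add.fop X t i) = add.fop Y (nm T X Y f t) j"
proof -
  obtain W \<iota> d where W: "is_coproduct G 2 (\<lambda>_. X) W \<iota>" and d: "d \<in> gmaps G W X"
    "\<And>i x. i < 2 \<Longrightarrow> x \<in> pts X \<Longrightarrow> d (\<iota> i x) = x" using add.folding_exists[OF X] by blast
  have fW: "fin_gset G W" and \<iota>: "\<And>i. i < 2 \<Longrightarrow> \<iota> i \<in> gmaps G X W"
    using W by (auto simp: is_coproduct_def)
  have iX: "i \<in> val T X" by (rule ideal_subset[OF X i])
  have zX: "add.funit X \<in> val T X" by (rule add.funit_closed[OF X])
  obtain w where w: "w \<in> val T W" "res T X W (\<iota> 0) w = t" "res T X W (\<iota> 1) w = i"
    using add.folding_lift[OF W t iX] by blast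
  obtain w' where w': "w' \<in> val T W" "res T X W (\<iota> 0) w' = t" "res T X W (\<iota> 1) w' = add.funit X"
    using add.folding_lift[OF W t zX] by blast
  have trw: "tr T W X d w = add.fop X t i" using add.fop_eq[OF W d w(1)] w by simp
  have trw': "tr T W X d w' = t"
    using add.fop_eq[OF W d w'(1)] w' add.fop_unit[OF X t] add.fop_comm[OF X t zX] by simp
  obtain P Z \<pi> \<rho> l \<theta> \<zeta> where E: "is_exponential G W X Y P Z d f \<pi> \<rho> l"
    using exponential_exists[OF is_group fW X Y d(1) f infinite_points] by metis
  have P: "fin_gset G P" and Z: "fin_gset G Z" and \<pi>: "\<pi> \<in> gmaps G P Y"
    and \<rho>: "\<rho> \<in> gmaps G Z P" and l: "l \<in> gmaps G Z W"
    using E by (auto simp: is_exponential_def)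
  \<comment> \<open>\<open>Z\<close> is split according to the copy of \<open>X\<close> in which the
    evaluation \<open>l\<close> takes its value.\<close>
  define B where "B = (\<lambda>k. {z \<in> pts Z. l z \<in> \<iota> k ` pts X})"
  have B: "invariant_subset G Z (B k)" if "k < 2" for k
    unfolding B_def
    by (rule invariant_vimage[OF add.fin_action[OF Z] l])
      (use add.coproduct_image_invariant[OF W that] in simp)
  have disj: "B 0 \<inter> B 1 = {}"
    using add.coproduct_disjoint[OF W, of 0 1] by (auto simp: B_def)
  have cover: "pts Z = B 0 \<union> B 1"
  proof -
    have "l z \<in> \<iota> 0 ` pts X \<union> \<iota> 1 ` pts X" if "z \<in> pts Z" for z
      using gmaps_closed[OF l that] add.coproduct_cover[OF W] by (auto simp: numeral_2_eq_2 lessThan_Suc)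
    then show ?thesis by (auto simp: B_def)
  qed
  \<comment> \<open>\<open>\<mu> k\<close> is \<open>l\<close> on \<open>B k\<close> with the label
    of the copy forgotten, so \<open>\<iota> k \<circ> \<mu> k\<close> is \<open>l\<close>
    there.\<close>
  define \<mu> where "\<mu> = (\<lambda>k. compose (B k) d (restrict l (B k)))"
  have fB: "fin_gset G (sub_gset Z (B k))" if "k < 2" for k
    by (rule sub_gset_fin[OF is_group Z B[OF that]])
  have lB: "restrict l (B k) \<in> gmaps G (sub_gset Z (B k)) W" if "k < 2" for k
    by (rule sub_gset_restrict[OF B[OF that] l])
  have \<mu>: "\<mu> k \<in> gmaps G (sub_gset Z (B k)) X" if "k < 2" for k
    using gmaps_compose[OF add.fin_action[OF fB[OF that]] lB[OF that] d(1)] by (simp add: \<mu>_def)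
  have \<mu>l: "\<iota> k (\<mu> k z) = l z" if k: "k < 2" and z: "z \<in> B k" for k z
  proof -
    obtain x where x: "x \<in> pts X" "l z = \<iota> k x" using z by (auto simp: B_def)
    then show ?thesis using d(2)[OF k x(1)] z by (simp add: \<mu>_def compose_def)
  qed
  have part: "mul.part Z P \<rho> (res T Z W l v) (B k) =
      nm T (sub_gset Z (B k)) P (restrict \<rho> (B k)) (res T (sub_gset Z (B k)) X (\<mu> k) (res T X W (\<iota> k) v))"
    if k: "k < 2" and v: "v \<in> val T W" for k v
  proof -
    have "res T (sub_gset Z (B k)) Z (\<lambda>x\<in>B k. x) (res T Z W l v) = res T (sub_gset Z (B k)) W (restrict l (B k)) v"
      by (rule add.up_comp[OF fB[OF k] Z fW sub_gset_incl'[OF B[OF k]] l lB[OF k] _ v]) simp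
    moreover have "res T (sub_gset Z (B k)) X (\<mu> k) (res T X W (\<iota> k) v) = res T (sub_gset Z (B k)) W (restrict l (B k)) v"
      by (rule add.up_comp[OF fB[OF k] X fW \<mu>[OF k] \<iota>[OF k] lB[OF k] _ v]) (simp add: \<mu>l[OF k])
    ultimately show ?thesis by (simp add: mul.part_def)
  qed
  have split: "nm T Z P \<rho> (res T Z W l v) =
      mul.fop P (mul.part Z P \<rho> (res T Z W l v) (B 0)) (mul.part Z P \<rho> (res T Z W l v) (B 1))"
    if v: "v \<in> val T W" for v
    using mul.part_Un[OF Z P \<rho> add.up_closed[OF Z fW l v] B B disj] mul.part_pts[OF Z P \<rho> add.up_closed[OF Z fW l v]]
      cover by simp
  define c where "c = mul.part Z P \<rho> (res T Z W l w) (B 0)"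
  \<comment> \<open>\<open>w\<close> and \<open>w'\<close> both restrict to \<open>t\<close> on the
    first copy, so this factor is common to them.\<close>
  have c': "c = mul.part Z P \<rho> (res T Z W l w') (B 0)" using part[of 0] w w' by (simp add: c_def)
  have c: "c \<in> val T P"
    unfolding c_def by (rule mul.part_closed[OF Z P \<rho> add.up_closed[OF Z fW l w(1)] B]) simp
  define e where "e = mul.part Z P \<rho> (res T Z W l w') (B 1)"
  have e: "e \<in> val T P"
    unfolding e_def by (rule mul.part_closed[OF Z P \<rho> add.up_closed[OF Z fW l w'(1)] B]) simp
  let ?B = "sub_gset Z (B 1)"
  have B1: "fin_gset G ?B" and \<mu>1: "\<mu> 1 \<in> gmaps G ?B X" using fB[of 1] \<mu>[of 1] by auto
  have \<rho>1: "restrict \<rho> (B 1) \<in> gmaps G ?B P" using sub_gset_restrict[OF B \<rho>] by simp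
  \<comment> \<open>\<open>e\<close> is a norm of \<open>0\<close> and need not be zero, as
    \<open>\<rho>\<close> restricted to \<open>B 1\<close> may miss points of \<open>P\<close>. The
    ideal condition compares against precisely this element.\<close>
  have "e = nm T ?B P (restrict \<rho> (B 1)) (add.funit ?B)"
    using part[of 1, OF _ w'(1)] w'(3) add.up_unit[OF B1 X \<mu>1] by (simp add: e_def)
  moreover have "res T ?B X (\<mu> 1) i \<in> I ?B" by (rule ideal_maps(1)[OF B1 X \<mu>1 i])
  ultimately obtain j where j: "j \<in> I P" "nm T ?B P (restrict \<rho> (B 1)) (res T ?B X (\<mu> 1) i) = add.fop P e j"
    using ideal_maps(3)[OF B1 P \<rho>1] by blast
  have jP: "j \<in> val T P" by (rule ideal_subset[OF P j(1)])
  \<comment> \<open>Multiplying by \<open>c\<close> stays in the ideal over \<open>P\<close>, and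
    the transfer along \<open>\<pi>\<close> brings the error into \<open>I Y\<close>.\<close>
  have cj: "mul.fop P c j \<in> I P"
    using ideal.I_l_closed[OF ideal_I[OF P] j(1), of c] c by simp
  have ce: "mul.fop P c e \<in> val T P" by (rule mul.fop_closed[OF P c e])
  have "nm T X Y f (add.fop X t i) = tr T P Y \<pi> (nm T Z P \<rho> (res T Z W l w))"
    using nm_tr[OF E w(1)] trw by simp
  also have "nm T Z P \<rho> (res T Z W l w) = mul.fop P c (add.fop P e j)"
    using split[OF w(1)] part[of 1, OF _ w(1)] w(3) j(2) by (simp add: c_def)
  also have "\<dots> = add.fop P (mul.fop P c e) (mul.fop P c j)" by (rule distrib[OF P c e jP])
  also have "tr T P Y \<pi> \<dots> = add.fop Y (tr T P Y \<pi> (mul.fop P c e)) (tr T P Y \<pi> (mul.fop P c j))"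
    by (rule add.low_fop[OF P Y \<pi> ce ideal_subset[OF P cj]])
  also have "tr T P Y \<pi> (mul.fop P c e) = nm T X Y f t"
    using nm_tr[OF E w'(1)] trw' split[OF w'(1)] c' e_def by simp
  finally show ?thesis using ideal_maps(2)[OF P Y \<pi> cj] by blast
qed

end

end


section \<open>Quotients, images and projections\<close>

lemma tambara_morphismD:
  assumes "tambara_morphism G T S \<phi>"
  shows "fin_gset G X \<Longrightarrow> \<phi> X \<in> ring_hom (tring G T X) (tring G S X)"
    and "fin_gset G X \<Longrightarrow> t \<in> val T X \<Longrightarrow> \<phi> X t \<in> val S X"
    and "fin_gset G X \<Longrightarrow> fin_gset G Y \<Longrightarrow> f \<in> gmaps G X Y \<Longrightarrow> t \<in> val T Y \<Longrightarrow>
      \<phi> X (res T X Y f t) = res S X Y f (\<phi> Y t)"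
    and "fin_gset G X \<Longrightarrow> fin_gset G Y \<Longrightarrow> f \<in> gmaps G X Y \<Longrightarrow> t \<in> val T X \<Longrightarrow>
      \<phi> Y (tr T X Y f t) = tr S X Y f (\<phi> X t)"
    and "fin_gset G X \<Longrightarrow> fin_gset G Y \<Longrightarrow> f \<in> gmaps G X Y \<Longrightarrow> t \<in> val T X \<Longrightarrow>
      \<phi> Y (nm T X Y f t) = nm S X Y f (\<phi> X t)"
proof -
  show "\<phi> X \<in> ring_hom (tring G T X) (tring G S X)" if "fin_gset G X"
    using assms that by (simp add: tambara_morphism_def)
  from ring_hom_closed[OF this] show "\<phi> X t \<in> val S X" if "fin_gset G X" "t \<in> val T X"
    using that by (simp add: tring_def)
qed (use assms in \<open>auto simp: tambara_morphism_def\<close>)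

context tambara
begin

section \<open>The quotient by an ideal\<close>

context
  fixes I assumes I: "tambara_ideal G T I"
begin

lemma quot_proj_mem:
  assumes X: "fin_gset G X" and t: "t \<in> val T X"
  shows "s \<in> quot_proj G T I X t \<longleftrightarrow> (\<exists>j\<in>I X. s = add.fop X t j)"
  using add.fop_comm[OF X t ideal_subset[OF I X]]
  by (auto simp: quot_proj_def a_r_coset_def')

lemma quot_proj_eq_iff:
  assumes X: "fin_gset G X" and t: "t \<in> val T X" and s: "s \<in> val T X"
  shows "quot_proj G T I X t = quot_proj G T I X s \<longleftrightarrow> (\<exists>j\<in>I X. s = add.fop X t j)"
proof -
  interpret R: cring "tring G T X" by (rule tring_cring[OF X])
  interpret J: ideal "I X" "tring G T X" by (rule ideal_I[OF I X])
  have sub: "abelian_subgroup (I X) (tring G T X)"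
    by (rule abelian_subgroupI3) unfold_locales
  have "s \<in> quot_proj G T I X t" if "quot_proj G T I X t = quot_proj G T I X s"
    using abelian_subgroup.a_rcos_self[OF sub, of s] s that by (simp add: quot_proj_def)
  moreover have "quot_proj G T I X t = quot_proj G T I X s" if "s \<in> quot_proj G T I X t"
    using abelian_subgroup.a_repr_independence'[OF sub, of s t] t that by (simp add: quot_proj_def)
  ultimately show ?thesis using quot_proj_mem[OF X t] by blast
qed

text \<open>Under \<open>resp\<close> all classes in the union coincide, so the union used in
  \<open>quot_tambara\<close> is the single class of \<open>h t\<close>.\<close>

lemma quot_induced:
  assumes X: "fin_gset G X" and Y: "fin_gset G Y" and t: "t \<in> val T X"
    and h: "\<And>t. t \<in> val T X \<Longrightarrow> h t \<in> val T Y"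
    and resp: "\<And>t i. t \<in> val T X \<Longrightarrow> i \<in> I X \<Longrightarrow> \<exists>j\<in>I Y. h (add.fop X t i) = add.fop Y (h t) j"
  shows "(\<Union>s\<in>quot_proj G T I X t. quot_proj G T I Y (h s)) = quot_proj G T I Y (h t)"
proof -
  have "quot_proj G T I Y (h s) = quot_proj G T I Y (h t)" if sq: "s \<in> quot_proj G T I X t" for s
  proof -
    obtain i where i: "i \<in> I X" "s = add.fop X t i"
      using quot_proj_mem[OF X t] sq by blast
    have s: "s \<in> val T X"
      unfolding i(2) by (rule add.fop_closed[OF X t ideal_subset[OF I X i(1)]])
    have "\<exists>j\<in>I Y. h s = add.fop Y (h t) j" unfolding i(2) by (rule resp[OF t i(1)])
    then show ?thesis
      using quot_proj_eq_iff[OF Y h[OF t] h[OF s]] by simp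
  qed
  \<comment> \<open>The union runs over a nonempty set, since \<open>t\<close> lies in its own
    class.\<close>
  moreover have "t \<in> quot_proj G T I X t"
    using quot_proj_mem[OF X t] quot_proj_eq_iff[OF X t t] by simp
  ultimately show ?thesis by blast
qed

lemma quot_val:
  "val (quot_tambara G T I) X = quot_proj G T I X ` val T X"
  by (auto simp: quot_tambara_def quot_proj_def FactRing_def A_RCOSETS_def')

lemma quot_res:
  assumes "fin_gset G X" "fin_gset G Y" "f \<in> gmaps G X Y" "t \<in> val T Y"
  shows "res (quot_tambara G T I) X Y f (quot_proj G T I Y t) = quot_proj G T I X (res T X Y f t)"
proof -
  have "(\<Union>s\<in>quot_proj G T I Y t. quot_proj G T I X (res T X Y f s)) = quot_proj G T I X (res T X Y f t)"
  proof (rule quot_induced[OF assms(2,1,4)])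
    fix t i assume "t \<in> val T Y" "i \<in> I Y"
    then show "\<exists>j\<in>I X. res T X Y f (add.fop Y t i) = add.fop X (res T X Y f t) j"
      using add.up_fop[OF assms(1-3)] ideal_subset[OF I assms(2)] ideal_maps(1)[OF I assms(1-3)] by blast
  qed (rule add.up_closed[OF assms(1-3)])
  then show ?thesis by (simp add: quot_tambara_def)
qed

lemma quot_tr:
  assumes "fin_gset G X" "fin_gset G Y" "f \<in> gmaps G X Y" "t \<in> val T X"
  shows "tr (quot_tambara G T I) X Y f (quot_proj G T I X t) = quot_proj G T I Y (tr T X Y f t)"
proof -
  have "(\<Union>s\<in>quot_proj G T I X t. quot_proj G T I Y (tr T X Y f s)) = quot_proj G T I Y (tr T X Y f t)"
  proof (rule quot_induced[OF assms(1,2,4)])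
    fix t i assume "t \<in> val T X" "i \<in> I X"
    then show "\<exists>j\<in>I Y. tr T X Y f (add.fop X t i) = add.fop Y (tr T X Y f t) j"
      using add.low_fop[OF assms(1-3)] ideal_subset[OF I assms(1)] ideal_maps(2)[OF I assms(1-3)] by blast
  qed (rule add.low_closed[OF assms(1-3)])
  then show ?thesis by (simp add: quot_tambara_def)
qed

lemma quot_nm:
  assumes "fin_gset G X" "fin_gset G Y" "f \<in> gmaps G X Y" "t \<in> val T X"
  shows "nm (quot_tambara G T I) X Y f (quot_proj G T I X t) = quot_proj G T I Y (nm T X Y f t)"
proof -
  have "(\<Union>s\<in>quot_proj G T I X t. quot_proj G T I Y (nm T X Y f s)) = quot_proj G T I Y (nm T X Y f t)"
    by (rule quot_induced[OF assms(1,2,4) mul.low_closed[OF assms(1-3)] nm_ideal[OF I assms(1-3)]])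
  then show ?thesis by (simp add: quot_tambara_def)
qed

text \<open>The difference of \<open>w\<close> and \<open>w'\<close> is the sum of the transfers of its restrictions to the summands.\<close>

lemma quot_coproduct_inj:
  assumes W: "is_coproduct G n X W \<iota>" and w: "w \<in> val T W" and w': "w' \<in> val T W"
    and eq: "\<And>i. i < n \<Longrightarrow>
      quot_proj G T I (X i) (res T (X i) W (\<iota> i) w) = quot_proj G T I (X i) (res T (X i) W (\<iota> i) w')"
  shows "quot_proj G T I W w = quot_proj G T I W w'"
proof -
  have fW: "fin_gset G W" and X: "\<And>i. i < n \<Longrightarrow> fin_gset G (X i)"
    and \<iota>: "\<And>i. i < n \<Longrightarrow> \<iota> i \<in> gmaps G (X i) W" using W by (auto simp: is_coproduct_def)
  interpret R: cring "tring G T W" by (rule tring_cring[OF fW])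
  interpret J: ideal "I W" "tring G T W" by (rule ideal_I[OF I fW])
  \<comment> \<open>The difference is taken so that \<open>w' = w + j\<close>, matching the form in
    \<open>quot_proj_eq_iff\<close>.\<close>
  define j where "j = \<ominus>\<^bsub>tring G T W\<^esub> w \<oplus>\<^bsub>tring G T W\<^esub> w'"
  have j: "j \<in> val T W"
    using R.add.m_closed[OF R.a_inv_closed[of w], of w'] w w' by (simp add: j_def)
  have w'j: "w' = add.fop W w j" using R.r_neg2[of w w'] w w' by (simp add: j_def)
  have "res T (X i) W (\<iota> i) j \<in> I (X i)" if i: "i < n" for i
  proof -
    interpret Ri: cring "tring G T (X i)" by (rule tring_cring[OF X[OF i]])
    have cl: "res T (X i) W (\<iota> i) v \<in> val T (X i)" if "v \<in> val T W" for v
      using add.up_closed[OF X[OF i] fW \<iota>[OF i] that] .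
    obtain k where k: "k \<in> I (X i)" "res T (X i) W (\<iota> i) w' = add.fop (X i) (res T (X i) W (\<iota> i) w) k"
      using quot_proj_eq_iff[OF X[OF i] cl[OF w] cl[OF w']] eq[OF i] by blast
    have "add.fop (X i) (res T (X i) W (\<iota> i) w) (res T (X i) W (\<iota> i) j) =
        add.fop (X i) (res T (X i) W (\<iota> i) w) k"
      using add.up_fop[OF X[OF i] fW \<iota>[OF i] w j] k(2) w'j by simp
    \<comment> \<open>Restriction is additive, so cancelling the restriction of \<open>w\<close>
      identifies that of \<open>j\<close> with the element \<open>k\<close> of the ideal.\<close>
    then have "res T (X i) W (\<iota> i) j = k"
      using Ri.r_neg1[of "res T (X i) W (\<iota> i) w" "res T (X i) W (\<iota> i) j"]
        Ri.r_neg1[of "res T (X i) W (\<iota> i) w" k] cl[OF w] cl[OF j] ideal_subset[OF I X[OF i] k(1)]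
      by simp
    with k(1) show ?thesis by simp
  qed
  then have "tr T (X i) W (\<iota> i) (res T (X i) W (\<iota> i) j) \<in> I W" if "i < n" for i
    using ideal_maps(2)[OF I X fW \<iota>] that by blast
  \<comment> \<open>\<open>coproduct_mem\<close> with \<open>I W\<close> as the closed set.\<close>
  then have "j \<in> I W"
    using J.zero_closed J.a_closed by (intro add.coproduct_mem[OF W j]) auto
  with w'j show ?thesis using quot_proj_eq_iff[OF fW w w'] by blast
qed

lemma quotient_tambara: "tambara G (quot_tambara G T I)"
  and quot_proj_morphism: "tambara_morphism G T (quot_tambara G T I) (quot_proj G T I)"
proof -
  note facts = tambara_axioms quot_val[symmetric] quot_res[symmetric] quot_tr[symmetric] quot_nm[symmetric]
    quot_coproduct_inj
  show "tambara G (quot_tambara G T I)"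
    by (rule tambara_image(1)[OF facts])
  show "tambara_morphism G T (quot_tambara G T I) (quot_proj G T I)"
    by (rule tambara_image(2)[OF facts])
qed

lemma quot_proj_projection: "tambara_projection G T (quot_tambara G T I) (quot_proj G T I)"
  using tambara.tambara[OF quotient_tambara] quot_proj_morphism quot_val
  by (simp add: tambara_projection_def)

lemma quot_proj_kernel:
  assumes X: "fin_gset G X"
  shows "kernel_family G T (quot_tambara G T I) (quot_proj G T I) X = I X"
proof -
  interpret Q: tambara G "quot_tambara G T I" by (rule quotient_tambara)
  interpret R: cring "tring G T X" by (rule tring_cring[OF X])
  note z = add.funit_closed[OF X]
  have "quot_proj G T I X (add.funit X) = \<zero>\<^bsub>tring G (quot_tambara G T I) X\<^esub>"
    using ring_hom_zero[OF tambara_morphismD(1)[OF quot_proj_morphism X] R.ring_axioms Q.tring_ring[OF X]]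
    by simp
  moreover have "quot_proj G T I X (add.funit X) = quot_proj G T I X t \<longleftrightarrow> t \<in> I X" if t: "t \<in> val T X" for t
    using quot_proj_eq_iff[OF X z t] add.fop_unit[OF X] ideal_subset[OF I X] by force
  ultimately show ?thesis
    using ideal_subset[OF I X] by (auto simp: kernel_family_def a_kernel_def')
qed

end

section \<open>Kernel and image of a morphism\<close>

context
  fixes S :: "('g, 'x, 's) tambara_data" and \<phi>
  assumes S: "tambara G S" and \<phi>: "tambara_morphism G T S \<phi>"
begin

interpretation S: tambara G S by (rule S)

lemma morphism_ring_hom: "fin_gset G X \<Longrightarrow> ring_hom_ring (tring G T X) (tring G S X) (\<phi> X)"
  by (intro ring_hom_ringI2 tring_ring S.tring_ring tambara_morphismD(1)[OF \<phi>])

lemma morphism_unit: "fin_gset G X \<Longrightarrow> \<phi> X (add.funit X) = S.add.funit X"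
  using ring_hom_zero[OF tambara_morphismD(1)[OF \<phi>] tring_ring S.tring_ring] by simp

lemma kernel_iff: "t \<in> kernel_family G T S \<phi> X \<longleftrightarrow> t \<in> val T X \<and> \<phi> X t = S.add.funit X"
  by (simp add: kernel_family_def a_kernel_def')

text \<open>Turns equality of images into a condition on the kernel; both the norm condition for
  kernels and the factorisation through a projection rest on it.\<close>

lemma morphism_eq_iff:
  assumes X: "fin_gset G X" and t: "t \<in> val T X" "s \<in> val T X"
  shows "\<phi> X t = \<phi> X s \<longleftrightarrow> t \<ominus>\<^bsub>tring G T X\<^esub> s \<in> kernel_family G T S \<phi> X"
proof -
  interpret h: ring_hom_ring "tring G T X" "tring G S X" "\<phi> X" by (rule morphism_ring_hom[OF X])
  have "\<phi> X (t \<ominus>\<^bsub>tring G T X\<^esub> s) = \<phi> X t \<ominus>\<^bsub>tring G S X\<^esub> \<phi> X s"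
    using t h.hom_add[of t "\<ominus>\<^bsub>tring G T X\<^esub> s"] h.hom_a_inv[of s] h.R.a_inv_closed[of s]
    by (simp add: a_minus_def)
  moreover have "t \<ominus>\<^bsub>tring G T X\<^esub> s \<in> val T X" using h.R.minus_closed[of t s] t by simp
  ultimately show ?thesis
    using h.S.r_right_minus_eq[of "\<phi> X t" "\<phi> X s"] tambara_morphismD(2)[OF \<phi> X] t
    by (simp add: kernel_iff)
qed

text \<open>For the norm condition: if \<open>\<phi>\<close> kills \<open>t\<close>, then the norms
  of \<open>t\<close> and of \<open>0\<close> have the same image, because \<open>\<phi>\<close>
  commutes with norms. Their difference therefore lies in the kernel.\<close>

lemma kernel_ideal: "tambara_ideal G T (kernel_family G T S \<phi>)"
  unfolding tambara_ideal_def
proof (intro conjI allI impI; (elim conjE)?)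
  show "ideal (kernel_family G T S \<phi> X) (tring G T X)" if "fin_gset G X" for X
    unfolding kernel_family_def by (rule ring_hom_ring.kernel_is_ideal[OF morphism_ring_hom[OF that]])
next
  fix X Y :: "('g, 'x) gset" and f
  assume X: "fin_gset G X" and Y: "fin_gset G Y" and f: "f \<in> gmaps G X Y"
  note comm = tambara_morphismD(3-5)[OF \<phi> X Y f]
  show "res T X Y f ` kernel_family G T S \<phi> Y \<subseteq> kernel_family G T S \<phi> X"
    using add.up_closed[OF X Y f] comm(1) S.add.up_unit[OF X Y f] by (auto simp: kernel_iff)
  show "tr T X Y f ` kernel_family G T S \<phi> X \<subseteq> kernel_family G T S \<phi> Y"
    using add.low_closed[OF X Y f] comm(2) S.add.low_unit[OF X Y f] by (auto simp: kernel_iff)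
  show "nm T X Y f ` kernel_family G T S \<phi> X \<subseteq>
      nm T X Y f \<zero>\<^bsub>tring G T X\<^esub> <+\<^bsub>tring G T Y\<^esub> kernel_family G T S \<phi> Y"
  proof
    fix u assume "u \<in> nm T X Y f ` kernel_family G T S \<phi> X"
    then obtain t where t: "t \<in> val T X" "\<phi> X t = S.add.funit X" "u = nm T X Y f t" by (auto simp: kernel_iff)
    interpret R: cring "tring G T Y" by (rule tring_cring[OF Y])
    define z where "z = nm T X Y f (add.funit X)"
    have z: "z \<in> val T Y" unfolding z_def by (rule mul.low_closed[OF X Y f add.funit_closed[OF X]])
    have u: "u \<in> val T Y" using mul.low_closed[OF X Y f t(1)] t(3) by simp
    have "\<phi> Y u = \<phi> Y z"
      using comm(3)[OF t(1)] comm(3)[OF add.funit_closed[OF X]] morphism_unit[OF X] t by (simp add: z_def)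
    then have k: "u \<ominus>\<^bsub>tring G T Y\<^esub> z \<in> kernel_family G T S \<phi> Y" using morphism_eq_iff[OF Y u z] by simp
    have "u = z \<oplus>\<^bsub>tring G T Y\<^esub> (u \<ominus>\<^bsub>tring G T Y\<^esub> z)"
      using R.a_lcomm[of z u "\<ominus>\<^bsub>tring G T Y\<^esub> z"] R.a_inv_closed[of z] R.r_neg[of z] R.r_zero[of u] u z
      by (simp add: a_minus_def)
    with k show "u \<in> nm T X Y f \<zero>\<^bsub>tring G T X\<^esub> <+\<^bsub>tring G T Y\<^esub> kernel_family G T S \<phi> Y"
      by (auto simp: a_l_coset_def' z_def)
  qed
qed

text \<open>The remaining condition over coproducts holds because elements of \<open>S\<close> over
  a coproduct are already determined by their restrictions.\<close>

lemma image_tambara: "tambara G (sub_tambara S (image_family T \<phi>))"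
  and image_morphism: "tambara_morphism G T (sub_tambara S (image_family T \<phi>)) \<phi>"
proof -
  let ?S = "sub_tambara S (image_family T \<phi>)"
  have surj: "\<phi> X ` val T X = val ?S X" for X by (simp add: sub_tambara_def image_family_def)
  have res: "\<phi> X (res T X Y f t) = res ?S X Y f (\<phi> Y t)"
    if "fin_gset G X" "fin_gset G Y" "f \<in> gmaps G X Y" "t \<in> val T Y" for X Y f t
    using tambara_morphismD(3)[OF \<phi> that] by (simp add: sub_tambara_def)
  have tr: "\<phi> Y (tr T X Y f t) = tr ?S X Y f (\<phi> X t)"
    if "fin_gset G X" "fin_gset G Y" "f \<in> gmaps G X Y" "t \<in> val T X" for X Y f t
    using tambara_morphismD(4)[OF \<phi> that] by (simp add: sub_tambara_def)
  have nm: "\<phi> Y (nm T X Y f t) = nm ?S X Y f (\<phi> X t)"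
    if "fin_gset G X" "fin_gset G Y" "f \<in> gmaps G X Y" "t \<in> val T X" for X Y f t
    using tambara_morphismD(5)[OF \<phi> that] by (simp add: sub_tambara_def)
  have inj: "\<phi> W w = \<phi> W w'"
    if W: "is_coproduct G n X W \<iota>" and w: "w \<in> val T W" "w' \<in> val T W"
      and eq: "\<And>i. i < n \<Longrightarrow> \<phi> (X i) (res T (X i) W (\<iota> i) w) = \<phi> (X i) (res T (X i) W (\<iota> i) w')"
    for n X W \<iota> w w'
  proof (rule S.add.coproduct_inj[OF W])
    have fW: "fin_gset G W" using W by (simp add: is_coproduct_def)
    show "\<phi> W w \<in> val S W" "\<phi> W w' \<in> val S W" using tambara_morphismD(2)[OF \<phi> fW] w by auto
    fix i assume i: "i < n"
    then have "fin_gset G (X i)" "\<iota> i \<in> gmaps G (X i) W" using W by (auto simp: is_coproduct_def)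
    then show "res S (X i) W (\<iota> i) (\<phi> W w) = res S (X i) W (\<iota> i) (\<phi> W w')"
      using tambara_morphismD(3)[OF \<phi> _ fW] w eq[OF i] by simp
  qed
  show "tambara G ?S"
    by (rule tambara_image(1)[OF tambara_axioms surj res tr nm inj])
  show "tambara_morphism G T ?S \<phi>"
    by (rule tambara_image(2)[OF tambara_axioms surj res tr nm inj])
qed

lemma image_subfunctor: "tambara_subfunctor G S (image_family T \<phi>)"
  unfolding tambara_subfunctor_def
proof (intro conjI allI impI; (elim conjE)?)
  fix X :: "('g, 'x) gset" assume X: "fin_gset G X"
  interpret h: ring_hom_ring "tring G T X" "tring G S X" "\<phi> X" by (rule morphism_ring_hom[OF X])
  show "subring (image_family T \<phi> X) (tring G S X)"
    using h.img_is_subring[OF h.R.carrier_is_subring] by (simp add: image_family_def)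
next
  fix X Y :: "('g, 'x) gset" and f
  assume X: "fin_gset G X" and Y: "fin_gset G Y" and f: "f \<in> gmaps G X Y"
  note comm = tambara_morphismD(3-5)[OF \<phi> X Y f, symmetric]
  show "res S X Y f ` image_family T \<phi> Y \<subseteq> image_family T \<phi> X"
    using comm(1) add.up_closed[OF X Y f] by (auto simp: image_family_def)
  show "tr S X Y f ` image_family T \<phi> X \<subseteq> image_family T \<phi> Y"
    using comm(2) add.low_closed[OF X Y f] by (auto simp: image_family_def)
  show "nm S X Y f ` image_family T \<phi> X \<subseteq> image_family T \<phi> Y"
    using comm(3) mul.low_closed[OF X Y f] by (auto simp: image_family_def)
qed

text \<open>The zero of \<open>sub_tambara\<close> is a definite description over the smaller value
  sets, so it is not literally the zero of \<open>S\<close>; both are the image of the zero of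
  \<open>T\<close>.\<close>

lemma image_kernel:
  "kernel_family G T (sub_tambara S (image_family T \<phi>)) \<phi> X = kernel_family G T S \<phi> X"
  if X: "fin_gset G X"
proof -
  interpret Q: tambara G "sub_tambara S (image_family T \<phi>)" by (rule image_tambara)
  have "\<phi> X (add.funit X) = Q.add.funit X"
    using ring_hom_zero[OF tambara_morphismD(1)[OF image_morphism X] tring_ring[OF X] Q.tring_ring[OF X]] by simp
  then show ?thesis
    using morphism_unit[OF X] by (simp add: kernel_family_def a_kernel_def')
qed

lemma image_projection: "tambara_projection G T (sub_tambara S (image_family T \<phi>)) \<phi>"
  using image_morphism tambara.tambara[OF image_tambara]
  by (simp add: tambara_projection_def sub_tambara_def image_family_def)

end

end

text \<open>A preimage under \<open>p\<close> is chosen. Two preimages differ by an element of the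
  kernel of \<open>p\<close>, which \<open>q\<close> kills, so the choice does not affect the value;
  surjectivity of \<open>p\<close> then carries the compatibilities of \<open>q\<close> over to
  \<open>\<theta>\<close>.\<close>

lemma projection_factor:
  fixes T :: "('g, 'x, 't) tambara_data" and R :: "('g, 'x, 'r) tambara_data" and Q :: "('g, 'x, 's) tambara_data"
  assumes T: "tambara G T" and p: "tambara_projection G T R p"
    and Q: "tambara_functor G Q" and q: "tambara_morphism G T Q q"
    and ker: "\<And>X. fin_gset G X \<Longrightarrow> kernel_family G T R p X \<subseteq> kernel_family G T Q q X"
  obtains \<theta> where "tambara_morphism G R Q \<theta>"
    "\<And>X t. fin_gset G X \<Longrightarrow> t \<in> val T X \<Longrightarrow> \<theta> X (p X t) = q X t"
proof -
  interpret T: tambara G T by (rule T)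
  have R: "tambara G R" and Q': "tambara G Q"
    using p Q T.infinite_points by (auto intro!: tambara.intro tambara_axioms.intro T.is_group simp: tambara_projection_def)
  have pm: "tambara_morphism G T R p" and surj: "\<And>X. fin_gset G X \<Longrightarrow> p X ` val T X = val R X"
    using p by (auto simp: tambara_projection_def)
  define \<theta> where "\<theta> = (\<lambda>X r. q X (SOME t. t \<in> val T X \<and> p X t = r))"
  have \<theta>: "\<theta> X (p X t) = q X t" if X: "fin_gset G X" and t: "t \<in> val T X" for X t
  proof -
    let ?s = "SOME s. s \<in> val T X \<and> p X s = p X t"
    have s: "?s \<in> val T X" "p X ?s = p X t"
      using someI[of "\<lambda>s. s \<in> val T X \<and> p X s = p X t", OF conjI[OF t refl]] by auto
    then have "?s \<ominus>\<^bsub>tring G T X\<^esub> t \<in> kernel_family G T R p X"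
      using T.morphism_eq_iff[OF R pm X s(1) t] by simp
    then have "q X ?s = q X t" using T.morphism_eq_iff[OF Q' q X s(1) t] ker[OF X] by blast
    then show ?thesis by (simp add: \<theta>_def)
  qed
  have ex: "\<exists>t\<in>val T X. r = p X t" if "fin_gset G X" "r \<in> val R X" for X r
    using surj[OF that(1)] that(2) by blast
  have "tambara_morphism G R Q \<theta>"
  proof (rule tambara_morphismI[OF R Q'])
    fix X r assume X: "fin_gset G X" and "r \<in> val R X"
    then obtain t where "t \<in> val T X" "r = p X t" using ex by blast
    then show "\<theta> X r \<in> val Q X" using \<theta>[OF X] tambara_morphismD(2)[OF q X] by simp
  next
    fix X Y :: "('g, 'x) gset" and f r
    assume X: "fin_gset G X" and Y: "fin_gset G Y" and f: "f \<in> gmaps G X Y" and "r \<in> val R Y"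
    then obtain t where t: "t \<in> val T Y" "r = p Y t" using ex by blast
    show "\<theta> X (res R X Y f r) = res Q X Y f (\<theta> Y r)"
      using tambara_morphismD(3)[OF pm X Y f t(1)] tambara_morphismD(3)[OF q X Y f t(1)]
        \<theta>[OF Y t(1)] \<theta>[OF X T.add.up_closed[OF X Y f t(1)]] t(2) by simp
  next
    fix X Y :: "('g, 'x) gset" and f r
    assume X: "fin_gset G X" and Y: "fin_gset G Y" and f: "f \<in> gmaps G X Y" and "r \<in> val R X"
    then obtain t where t: "t \<in> val T X" "r = p X t" using ex by blast
    show "\<theta> Y (tr R X Y f r) = tr Q X Y f (\<theta> X r)"
      using tambara_morphismD(4)[OF pm X Y f t(1)] tambara_morphismD(4)[OF q X Y f t(1)]
        \<theta>[OF X t(1)] \<theta>[OF Y T.add.low_closed[OF X Y f t(1)]] t(2) by simp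
    show "\<theta> Y (nm R X Y f r) = nm Q X Y f (\<theta> X r)"
      using tambara_morphismD(5)[OF pm X Y f t(1)] tambara_morphismD(5)[OF q X Y f t(1)]
        \<theta>[OF X t(1)] \<theta>[OF Y T.mul.low_closed[OF X Y f t(1)]] t(2) by simp
  qed
  with \<theta> that show thesis by blast
qed

text \<open>Equal kernels allow factoring in both directions, and the two factors are mutually
  inverse because each is determined on the images of elements of \<open>T\<close>.\<close>

lemma projections_iso:
  fixes T :: "('g, 'x, 't) tambara_data" and R :: "('g, 'x, 'r) tambara_data" and Q :: "('g, 'x, 's) tambara_data"
  assumes T: "tambara G T" and p: "tambara_projection G T R p" and q: "tambara_projection G T Q q"
    and ker: "\<And>X. fin_gset G X \<Longrightarrow> kernel_family G T R p X = kernel_family G T Q q X"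
  shows "\<exists>\<theta>. tambara_iso G R Q \<theta> \<and> (\<forall>X. fin_gset G X \<longrightarrow> (\<forall>t\<in>val T X. \<theta> X (p X t) = q X t))"
proof -
  have R: "tambara_functor G R" "tambara_morphism G T R p" and Q: "tambara_functor G Q" "tambara_morphism G T Q q"
    and surj: "\<And>X. fin_gset G X \<Longrightarrow> p X ` val T X = val R X" "\<And>X. fin_gset G X \<Longrightarrow> q X ` val T X = val Q X"
    using p q by (auto simp: tambara_projection_def)
  obtain \<theta> where \<theta>: "tambara_morphism G R Q \<theta>"
    "\<And>X t. fin_gset G X \<Longrightarrow> t \<in> val T X \<Longrightarrow> \<theta> X (p X t) = q X t"
    using projection_factor[OF T p Q] ker by (metis order_refl)
  obtain \<psi> where \<psi>: "tambara_morphism G Q R \<psi>"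
    "\<And>X t. fin_gset G X \<Longrightarrow> t \<in> val T X \<Longrightarrow> \<psi> X (q X t) = p X t"
    using projection_factor[OF T q R] ker by (metis order_refl)
  have "\<psi> X (\<theta> X r) = r" if "fin_gset G X" "r \<in> val R X" for X r
    using surj(1)[OF that(1)] that \<theta>(2) \<psi>(2) by force
  moreover have "\<theta> X (\<psi> X s) = s" if "fin_gset G X" "s \<in> val Q X" for X s
    using surj(2)[OF that(1)] that \<theta>(2) \<psi>(2) by force
  ultimately have "tambara_iso G R Q \<theta>"
    unfolding tambara_iso_def using \<theta>(1) \<psi>(1) by blast
  with \<theta>(2) show ?thesis by blast
qed

text \<open>\<open>\<theta>\<close> is injective on \<open>R\<close>, so \<open>p\<close> and
  \<open>q\<close> identify the same elements with the zero of \<open>T\<close>.\<close>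

lemma iso_kernel:
  fixes T :: "('g, 'x, 't) tambara_data" and R :: "('g, 'x, 'r) tambara_data" and Q :: "('g, 'x, 's) tambara_data"
  assumes T: "tambara G T" and p: "tambara_projection G T R p" and q: "tambara_projection G T Q q"
    and \<theta>: "tambara_iso G R Q \<theta>" and \<theta>p: "\<And>t. t \<in> val T X \<Longrightarrow> \<theta> X (p X t) = q X t"
    and X: "fin_gset G X"
  shows "kernel_family G T R p X = kernel_family G T Q q X"
proof -
  interpret T: tambara G T by (rule T)
  have R: "tambara G R" and Q: "tambara G Q"
    using p q T.infinite_points by (auto intro!: tambara.intro tambara_axioms.intro T.is_group simp: tambara_projection_def)
  have pm: "tambara_morphism G T R p" and qm: "tambara_morphism G T Q q"
    using p q by (auto simp: tambara_projection_def)
  obtain \<psi> where \<psi>: "\<And>r. r \<in> val R X \<Longrightarrow> \<psi> X (\<theta> X r) = r"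
    using \<theta> X by (auto simp: tambara_iso_def)
  note z = T.add.funit_closed[OF X]
  have "p X t = p X (T.add.funit X) \<longleftrightarrow> q X t = q X (T.add.funit X)" if t: "t \<in> val T X" for t
    using \<theta>p[OF t] \<theta>p[OF z] \<psi>[OF tambara_morphismD(2)[OF pm X t]] \<psi>[OF tambara_morphismD(2)[OF pm X z]]
    by metis
  then show ?thesis
    using T.kernel_iff[OF R pm] T.kernel_iff[OF Q qm] T.morphism_unit[OF R pm X] T.morphism_unit[OF Q qm X]
    by auto
qed

theorem mainTheorem2:
  fixes G :: "('g, 'm) monoid_scheme"
    and T :: "('g, 'x, 't) tambara_data"
    and S :: "('g, 'x, 's) tambara_data"
    and \<phi> :: "('g, 'x) gset \<Rightarrow> 't \<Rightarrow> 's"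
  assumes "group G" and "finite (carrier G)"
    and "infinite (UNIV :: 'x set)"
    and "tambara_functor G T" and "tambara_functor G S"
    and "tambara_morphism G T S \<phi>"
  shows
    "\<comment> \<open>the image is a Tambara subfunctor, isomorphic to the quotient by the kernel\<close>
     (tambara_subfunctor G S (image_family T \<phi>) \<and>
      tambara_functor G (sub_tambara S (image_family T \<phi>)) \<and>
      tambara_functor G (quot_tambara G T (kernel_family G T S \<phi>)) \<and>
      (\<exists>\<psi>. tambara_iso G (quot_tambara G T (kernel_family G T S \<phi>))
                         (sub_tambara S (image_family T \<phi>)) \<psi> \<and>
           (\<forall>X. fin_gset G X \<longrightarrow> (\<forall>t\<in>val T X.
              \<psi> X (quot_proj G T (kernel_family G T S \<phi>) X t) = \<phi> X t)))) \<and>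
     \<comment> \<open>(A)\<close>
     (\<forall>I. tambara_ideal G T I \<longrightarrow>
        tambara_functor G (quot_tambara G T I) \<and>
        tambara_morphism G T (quot_tambara G T I) (quot_proj G T I)) \<and>
     \<comment> \<open>(B)\<close>
     (\<forall>(R :: ('g, 'x, 's) tambara_data) p.
        tambara_functor G R \<and> tambara_morphism G T R p \<longrightarrow>
        tambara_ideal G T (kernel_family G T R p)) \<and>
     \<comment> \<open>the correspondence: an ideal is the kernel of its projection, a projection is isomorphic
        under \<open>T\<close> to the projection of its kernel, and two projections are isomorphic under \<open>T\<close>
        exactly when their kernels agree\<close>
     (\<forall>I. tambara_ideal G T I \<longrightarrow>
        tambara_projection G T (quot_tambara G T I) (quot_proj G T I) \<and>
        (\<forall>X. fin_gset G X \<longrightarrow>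
           kernel_family G T (quot_tambara G T I) (quot_proj G T I) X = I X)) \<and>
     (\<forall>(R :: ('g, 'x, 's) tambara_data) p. tambara_projection G T R p \<longrightarrow>
        tambara_ideal G T (kernel_family G T R p) \<and>
        (\<exists>\<theta>. tambara_iso G (quot_tambara G T (kernel_family G T R p)) R \<theta> \<and>
           (\<forall>X. fin_gset G X \<longrightarrow> (\<forall>t\<in>val T X.
              \<theta> X (quot_proj G T (kernel_family G T R p) X t) = p X t)))) \<and>
     (\<forall>(R :: ('g, 'x, 's) tambara_data) p (Q :: ('g, 'x, 'r) tambara_data) q.
        tambara_projection G T R p \<and> tambara_projection G T Q q \<longrightarrow>
        ((\<forall>X. fin_gset G X \<longrightarrow> kernel_family G T R p X = kernel_family G T Q q X) \<longleftrightarrow>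
         (\<exists>\<theta>. tambara_iso G R Q \<theta> \<and>
            (\<forall>X. fin_gset G X \<longrightarrow> (\<forall>t\<in>val T X. \<theta> X (p X t) = q X t)))))"

proof -
  interpret T: tambara G T
    using assms by (intro tambara.intro tambara_axioms.intro)
  \<comment> \<open>Stated for an arbitrary value type, since it serves functors with values in
    different types.\<close>
  have tamb: "tambara G R" if "tambara_functor G R" for R :: "('g, 'x, 'v) tambara_data"
    using assms that by (intro tambara.intro tambara_axioms.intro)
  note S = tamb[OF assms(5)]
  note K = T.kernel_ideal[OF S assms(6)]
  have image: "\<exists>\<psi>. tambara_iso G (quot_tambara G T (kernel_family G T S \<phi>))
      (sub_tambara S (image_family T \<phi>)) \<psi> \<and>
      (\<forall>X. fin_gset G X \<longrightarrow> (\<forall>t\<in>val T X. \<psi> X (quot_proj G T (kernel_family G T S \<phi>) X t) = \<phi> X t))"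
    by (rule projections_iso[OF T.tambara_axioms T.quot_proj_projection[OF K]
          T.image_projection[OF S assms(6)]])
      (simp add: T.quot_proj_kernel[OF K] T.image_kernel[OF S assms(6)])
  have ker: "tambara_ideal G T (kernel_family G T R p)"
    if "tambara_functor G R" "tambara_morphism G T R p" for R :: "('g, 'x, 's) tambara_data" and p
    by (rule T.kernel_ideal[OF tamb[OF that(1)] that(2)])
  have proj: "\<exists>\<theta>. tambara_iso G (quot_tambara G T (kernel_family G T R p)) R \<theta> \<and>
      (\<forall>X. fin_gset G X \<longrightarrow> (\<forall>t\<in>val T X. \<theta> X (quot_proj G T (kernel_family G T R p) X t) = p X t))"
    if p: "tambara_projection G T R p" for R :: "('g, 'x, 's) tambara_data" and p
  proof -
    have K: "tambara_ideal G T (kernel_family G T R p)"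
      using p by (intro ker) (auto simp: tambara_projection_def)
    show ?thesis
      by (rule projections_iso[OF T.tambara_axioms T.quot_proj_projection[OF K] p])
        (simp add: T.quot_proj_kernel[OF K])
  qed
  have corr: "(\<forall>X. fin_gset G X \<longrightarrow> kernel_family G T R p X = kernel_family G T Q q X) \<longleftrightarrow>
      (\<exists>\<theta>. tambara_iso G R Q \<theta> \<and> (\<forall>X. fin_gset G X \<longrightarrow> (\<forall>t\<in>val T X. \<theta> X (p X t) = q X t)))"
    if p: "tambara_projection G T R p" and q: "tambara_projection G T Q q"
    for R :: "('g, 'x, 's) tambara_data" and p and Q :: "('g, 'x, 'r) tambara_data" and q
    using projections_iso[OF T.tambara_axioms p q] iso_kernel[OF T.tambara_axioms p q] by blast
  show ?thesis
  proof (intro conjI allI impI)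
    show "tambara_subfunctor G S (image_family T \<phi>)" by (rule T.image_subfunctor[OF S assms(6)])
    show "tambara_functor G (sub_tambara S (image_family T \<phi>))"
      by (rule tambara.tambara[OF T.image_tambara[OF S assms(6)]])
    show "tambara_functor G (quot_tambara G T (kernel_family G T S \<phi>))"
      by (rule tambara.tambara[OF T.quotient_tambara[OF K]])
  next
    fix I assume I: "tambara_ideal G T I"
    show "tambara_functor G (quot_tambara G T I)" by (rule tambara.tambara[OF T.quotient_tambara[OF I]])
    show "tambara_morphism G T (quot_tambara G T I) (quot_proj G T I)" by (rule T.quot_proj_morphism[OF I])
    show "tambara_projection G T (quot_tambara G T I) (quot_proj G T I)" by (rule T.quot_proj_projection[OF I])
    fix X :: "('g, 'x) gset" assume "fin_gset G X"
    then show "kernel_family G T (quot_tambara G T I) (quot_proj G T I) X = I X" by (rule T.quot_proj_kernel[OF I])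
  next
    fix R :: "('g, 'x, 's) tambara_data" and p
    assume "tambara_projection G T R p"
    then show "tambara_ideal G T (kernel_family G T R p)" by (intro ker) (auto simp: tambara_projection_def)
  qed (use image ker proj corr in blast)+
qed

end
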